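(* Let $\varphi=(\varphi_1,\ldots,\varphi_n)$ be a free holomorphic self-map of the noncommutative ball $[B(\mathcal H)^n]_1$. Then the essential norm of the composition operator $C_\varphi$ on $H^2_{\bf ball}$ satisfies the equality $$\|C_\varphi\|_e=\lim_{k\to\infty}\ \sup_{f\in H^2_{\bf ball},\ \|f\|_2\le1}\left(\sum_{|\alpha|\ge k}|\langle f,\varphi_\alpha\rangle|^2\right)^{1/2}.$$ Consequently, $C_\varphi$ is a compact operator if and only if $$\lim_{k\to\infty}\ \sup_{f\in H^2_{\bf ball},\ \|f\|_2\le1}\ \sum_{|\alpha|\ge k}|\langle f,\varphi_\alpha\rangle|^2=0.$$
   Context: $n\ge1$; $\mathcal H$ is a separable infinite dimensional complex Hilbert space. $\mathbb F_n^+$ is the free semigroup with generators $g_1,\ldots,g_n$ and identity $g_0$; $|g_0|=0$, $|\alpha|=k$ if $\alpha=g_{i_1}\cdots g_{i_k}$; $X_\alpha:=X_{i_1}\cdots X_{i_k}$, $X_{g_0}:=I$. $[B(\mathcal H)^n]_1:=\{(X_1,\ldots,X_n)\in B(\mathcal H)^n:\ \|X_1X_1^*+\cdots+X_nX_n^*\|^{1/2}<1\}$. A free holomorphic function $f:[B(\mathcal H)^n]_1\to B(\mathcal H)$ is a map $f(X)=\sum_{k=0}^\infty\sum_{|\alpha|=k}a_\alpha X_\alpha$ (series over $k$ converging in operator norm) with $a_\alpha\in\mathbb C$ and $\limsup_{k\to\infty}(\sum_{|\alpha|=k}|a_\alpha|^2)^{1/2k}\le1$. A free holomorphic self-map $\varphi=(\varphi_1,\ldots,\varphi_n)$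 of $[B(\mathcal H)^n]_1$ has each $\varphi_i$ free holomorphic and maps $[B(\mathcal H)^n]_1$ into itself. $\varphi_\alpha:=\varphi_{i_1}\cdots\varphi_{i_k}$ (pointwise product; $\varphi_{g_0}=I$), and $(f\circ\varphi)(X)=\sum_{k=0}^\infty\sum_{|\alpha|=k}a_\alpha\varphi_\alpha(X)$. $H^2_{\bf ball}$ is the Hilbert space of free holomorphic functions $f=\sum_\alpha a_\alpha X_\alpha$ on $[B(\mathcal H)^n]_1$ with $\|f\|_2^2:=\sum_\alpha|a_\alpha|^2<\infty$ and inner product $\langle f,g\rangle=\sum_\alpha a_\alpha\overline b_\alpha$ for $g=\sum_\alpha b_\alpha X_\alpha$; the functions $\varphi_\alpha$ belong to $H^2_{\bf ball}$, and $C_\varphi f:=f\circ\varphi$ is a bounded operator on $H^2_{\bf ball}$. The essential norm of a bounded operator $T$ on a Hilbert space is $\|T\|_e:=\inf\{\|T-K\|:\ K\text{ compact}\}$. *)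

theory Defs
  imports "HOL-Analysis.Analysis"
begin

text \<open>The norm, metric and completeness are those of the class \<^class>\<open>banach\<close>;
  the inner product is linear in the first argument.\<close>

class complex_hilbert = banach +
  fixes scaleC :: "complex \<Rightarrow> 'a \<Rightarrow> 'a" (infixr "*\<^sub>C" 75)
    and cinner :: "'a \<Rightarrow> 'a \<Rightarrow> complex"
  assumes scaleC_add_right: "c *\<^sub>C (x + y) = c *\<^sub>C x + c *\<^sub>C y"
    and scaleC_add_left: "(c + d) *\<^sub>C x = c *\<^sub>C x + d *\<^sub>C x"
    and scaleC_scaleC: "c *\<^sub>C d *\<^sub>C x = (c * d) *\<^sub>C x"
    and scaleC_one: "1 *\<^sub>C x = x"
    and scaleR_scaleC: "scaleR r x = complex_of_real r *\<^sub>C x"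
    and cinner_commute: "cinner x y = cnj (cinner y x)"
    and cinner_add_left: "cinner (x + y) z = cinner x z + cinner y z"
    and cinner_scaleC_left: "cinner (c *\<^sub>C x) y = c * cinner x y"
    and norm_eq_sqrt_cinner: "norm x = sqrt (Re (cinner x x))"

global_interpretation complex_vector: vector_space "scaleC :: complex \<Rightarrow> 'a \<Rightarrow> 'a::complex_hilbert"
  by standard (simp_all add: scaleC_add_right scaleC_add_left scaleC_scaleC scaleC_one)

lemma cinner_scaleC_right: "cinner x (c *\<^sub>C y) = cnj c * cinner x y"
  by (metis cinner_commute cinner_scaleC_left complex_cnj_mult)

lemma norm_scaleC: "norm (c *\<^sub>C x) = cmod c * norm (x :: 'a::complex_hilbert)"
proof -
  have "cinner (c *\<^sub>C x) (c *\<^sub>C x) = complex_of_real ((cmod c)\<^sup>2) * cinner x x"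
    unfolding cinner_scaleC_left cinner_scaleC_right complex_norm_square by (simp only: ac_simps)
  then have "Re (cinner (c *\<^sub>C x) (c *\<^sub>C x)) = (cmod c)\<^sup>2 * Re (cinner x x)"
    by (simp del: of_real_power)
  then show ?thesis
    by (simp add: norm_eq_sqrt_cinner real_sqrt_mult)
qed

definition infinite_dimensional :: "'h::complex_hilbert itself \<Rightarrow> bool" where
  "infinite_dimensional _ \<longleftrightarrow>
     \<not> (\<exists>B :: 'h set. finite B \<and> complex_vector.span B = UNIV)"

text \<open>The library's bounded linear maps are real linear; the elements of \<open>B(H)\<close> are the
  complex linear ones among them, with the same norm.\<close>

type_synonym 'h operator = "'h \<Rightarrow>\<^sub>L 'h"

definition complex_linear :: "('h::complex_hilbert) operator \<Rightarrow> bool" where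
  "complex_linear A \<longleftrightarrow> (\<forall>c x. blinfun_apply A (c *\<^sub>C x) = c *\<^sub>C blinfun_apply A x)"

lift_definition op_scaleC ::
  "complex \<Rightarrow> ('h::complex_hilbert) operator \<Rightarrow> 'h operator"
  is "\<lambda>c A x. c *\<^sub>C A x"
proof -
  fix c :: complex and A :: "'h \<Rightarrow> 'h"
  assume "bounded_linear A"
  moreover have "bounded_linear (\<lambda>x::'h. c *\<^sub>C x)"
    by (rule bounded_linear_intro[where K = "cmod c"])
      (simp_all add: scaleC_add_right scaleR_scaleC scaleC_scaleC norm_scaleC mult.commute)
  ultimately show "bounded_linear (\<lambda>x. c *\<^sub>C A x)"
    by (rule bounded_linear_compose[rotated])
qed

definition op_adjoint :: "('h::complex_hilbert) operator \<Rightarrow> 'h operator" where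
  "op_adjoint A = (THE B. \<forall>x y. cinner (blinfun_apply A x) y = cinner x (blinfun_apply B y))"

text \<open>The \<open>n\<close> generators of the free semigroup are the elements of a finite type \<open>'n\<close>, and
  its elements are the words over \<open>'n\<close>.\<close>

definition nc_ball :: "('n::finite \<Rightarrow> ('h::complex_hilbert) operator) set" where
  "nc_ball = {X. (\<forall>i. complex_linear (X i)) \<and>
                 sqrt (norm (\<Sum>i\<in>UNIV. X i o\<^sub>L op_adjoint (X i))) < 1}"

fun word_prod :: "('n \<Rightarrow> ('h::complex_hilbert) operator) \<Rightarrow> 'n list \<Rightarrow> 'h operator" where
  "word_prod X [] = id_blinfun"
| "word_prod X (i # \<alpha>) = X i o\<^sub>L word_prod X \<alpha>"

text \<open>A map on the ball is a total function that is \<open>0\<close> off the ball, so that maps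
  which agree on the ball are equal.\<close>

type_synonym ('n, 'h) ball_fun = "('n \<Rightarrow> 'h operator) \<Rightarrow> 'h operator"

definition has_free_expansion ::
  "('n::finite, 'h::complex_hilbert) ball_fun \<Rightarrow> ('n list \<Rightarrow> complex) \<Rightarrow> bool" where
  "has_free_expansion f a \<longleftrightarrow>
     limsup (\<lambda>k. ereal (root (2 * k) (\<Sum>\<alpha> | length \<alpha> = k. (cmod (a \<alpha>))\<^sup>2))) \<le> 1 \<and>
     (\<forall>X\<in>nc_ball. (\<lambda>k. \<Sum>\<alpha> | length \<alpha> = k. op_scaleC (a \<alpha>) (word_prod X \<alpha>)) sums f X) \<and>
     (\<forall>X. X \<notin> nc_ball \<longrightarrow> f X = 0)"

definition free_holomorphic :: "('n::finite, 'h::complex_hilbert) ball_fun \<Rightarrow> bool" where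
  "free_holomorphic f \<longleftrightarrow> (\<exists>a. has_free_expansion f a)"

text \<open>On an infinite dimensional space the coefficients are determined by the function.\<close>

definition free_coeff :: "('n::finite, 'h::complex_hilbert) ball_fun \<Rightarrow> 'n list \<Rightarrow> complex" where
  "free_coeff f = (THE a. has_free_expansion f a)"

definition free_holomorphic_self_map ::
  "('n::finite \<Rightarrow> ('n, 'h::complex_hilbert) ball_fun) \<Rightarrow> bool" where
  "free_holomorphic_self_map \<phi> \<longleftrightarrow>
     (\<forall>i. free_holomorphic (\<phi> i)) \<and> (\<forall>X\<in>nc_ball. (\<lambda>i. \<phi> i X) \<in> nc_ball)"

definition word_map ::
  "('n::finite \<Rightarrow> ('n, 'h::complex_hilbert) ball_fun) \<Rightarrow> 'n list \<Rightarrow> ('n, 'h) ball_fun" where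
  "word_map \<phi> \<alpha> = (\<lambda>X. if X \<in> nc_ball then word_prod (\<lambda>i. \<phi> i X) \<alpha> else 0)"

definition composition_op ::
  "('n::finite \<Rightarrow> ('n, 'h::complex_hilbert) ball_fun) \<Rightarrow> ('n, 'h) ball_fun \<Rightarrow> ('n, 'h) ball_fun"
  where
  "composition_op \<phi> f =
     (\<lambda>X. \<Sum>k. \<Sum>\<alpha> | length \<alpha> = k. op_scaleC (free_coeff f \<alpha>) (word_map \<phi> \<alpha> X))"

definition H2_ball :: "('n::finite, 'h::complex_hilbert) ball_fun set" where
  "H2_ball = {f. free_holomorphic f \<and> (\<lambda>\<alpha>. (cmod (free_coeff f \<alpha>))\<^sup>2) summable_on UNIV}"

definition H2_inner ::
  "('n::finite, 'h::complex_hilbert) ball_fun \<Rightarrow> ('n, 'h) ball_fun \<Rightarrow> complex" where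
  "H2_inner f g = (\<Sum>\<^sub>\<infinity>\<alpha>. free_coeff f \<alpha> * cnj (free_coeff g \<alpha>))"

definition H2_norm :: "('n::finite, 'h::complex_hilbert) ball_fun \<Rightarrow> real" where
  "H2_norm f = sqrt (\<Sum>\<^sub>\<infinity>\<alpha>. (cmod (free_coeff f \<alpha>))\<^sup>2)"

definition H2_dist ::
  "('n::finite, 'h::complex_hilbert) ball_fun \<Rightarrow> ('n, 'h) ball_fun \<Rightarrow> real" where
  "H2_dist f g = H2_norm (\<lambda>X. f X - g X)"

definition H2_unit_ball :: "('n::finite, 'h::complex_hilbert) ball_fun set" where
  "H2_unit_ball = {f \<in> H2_ball. H2_norm f \<le> 1}"

abbreviation H2_topology :: "('n::finite, 'h::complex_hilbert) ball_fun topology" where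
  "H2_topology \<equiv> Metric_space.mtopology H2_ball H2_dist"

text \<open>Operators on \<^const>\<open>H2_ball\<close> are given by total functions of which only the
  restriction to \<^const>\<open>H2_ball\<close> matters.\<close>

definition H2_linear ::
  "(('n::finite, 'h::complex_hilbert) ball_fun \<Rightarrow> ('n, 'h) ball_fun) \<Rightarrow> bool" where
  "H2_linear T \<longleftrightarrow> T \<in> H2_ball \<rightarrow> H2_ball \<and>
     (\<forall>f\<in>H2_ball. \<forall>g\<in>H2_ball. T (\<lambda>X. f X + g X) = (\<lambda>X. T f X + T g X)) \<and>
     (\<forall>c. \<forall>f\<in>H2_ball. T (\<lambda>X. op_scaleC c (f X)) = (\<lambda>X. op_scaleC c (T f X)))"

definition H2_compact_op ::
  "(('n::finite, 'h::complex_hilbert) ball_fun \<Rightarrow> ('n, 'h) ball_fun) \<Rightarrow> bool" where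
  "H2_compact_op T \<longleftrightarrow> H2_linear T \<and>
     compactin H2_topology (H2_topology closure_of (T ` H2_unit_ball))"

definition H2_op_norm ::
  "(('n::finite, 'h::complex_hilbert) ball_fun \<Rightarrow> ('n, 'h) ball_fun) \<Rightarrow> real" where
  "H2_op_norm T = (SUP f\<in>H2_unit_ball. H2_norm (T f))"

definition H2_essential_norm ::
  "(('n::finite, 'h::complex_hilbert) ball_fun \<Rightarrow> ('n, 'h) ball_fun) \<Rightarrow> real" where
  "H2_essential_norm T = (INF K\<in>Collect H2_compact_op. H2_op_norm (\<lambda>f X. T f X - K f X))"

end

theory Submission imports Defs begin

text \<open>Identify \<^const>\<open>H2_ball\<close> with the space of square summable families on words, on which
  \<open>C\<^sub>\<phi>\<close> becomes an operator \<open>T\<close> and \<open>Q\<^sub>k\<close> denotes the projection onto the words of length at least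
  \<open>k\<close>. The adjoint of \<open>T\<close> has the coefficients \<open>\<langle>f, \<phi>\<^sub>\<alpha>\<rangle>\<close>, so the supremum in the statement is
  \<open>\<parallel>Q\<^sub>k T\<^sup>*\<parallel> = \<parallel>T Q\<^sub>k\<parallel>\<close>. As \<open>T - T Q\<^sub>k\<close> has finite rank this bounds the essential norm from above, and
  \<open>\<parallel>T Q\<^sub>k\<parallel> \<le> \<parallel>T - K\<parallel> + \<parallel>K Q\<^sub>k\<parallel>\<close> with \<open>\<parallel>K Q\<^sub>k\<parallel> \<longlonglongrightarrow> 0\<close> for compact \<open>K\<close> gives the lower bound.

  Boundedness of \<open>C\<^sub>\<phi>\<close> is a noncommutative Littlewood subordination argument. Evaluating \<open>\<phi>\<close> at truncated
  creation operators, which exist on every infinite dimensional space, shows that multiplication by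
  \<open>(\<phi>\<^sub>1, \<dots>, \<phi>\<^sub>n)\<close> is a row contraction. Writing \<open>f = f(0) + \<Sum>i. X\<^sub>i f\<^sub>i\<close> one gets
  \<open>\<parallel>f \<circ> \<phi>\<parallel>\<^sup>2 \<le> \<bar>f(\<phi>(0))\<bar>\<^sup>2 + \<Sum>i. \<parallel>f\<^sub>i \<circ> \<phi>\<parallel>\<^sup>2\<close>, and iterating bounds the left side by a multiple of
  \<open>\<parallel>f\<parallel>\<^sup>2\<close> because \<open>\<phi>(0)\<close> lies in the open unit ball.\<close>

subsection \<open>Complex Hilbert spaces\<close>

text \<open>The hypothesis on \<open>\<phi>\<close> speaks of operators on \<open>'h\<close>, the
  conclusion of coefficient families, and the two must be connected without knowing beforehand that
  \<open>C\<^sub>\<phi>\<close> is bounded. An inequality between finitely many coefficients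
  involves words of bounded length only, so it can be read off from shifts of a finite orthonormal
  family. \<open>T\<close> is then built from its values on monomials:
  \<open>\<phi>\<^sub>\<alpha>\<close> is the word \<open>\<alpha>\<close> in the multiplication
  operators applied to the constant \<open>1\<close>, and an estimate on finite combinations of
  these vectors defines \<open>T\<close>. It agrees with the pointwise series because evaluation at
  a point of the ball is continuous in the coefficients; a row of norm at most \<rho> < 1 stays of
  norm at most \<open>\<rho> ^ k\<close> on the words of length \<open>k\<close>, however many there
  are. The constant \<open>1 / (1 - \<rho>)\<close> arises as follows: each round of the iteration
  removes the first letter of every word, so a word is charged once for each of its suffixes, with
  weight \<open>\<rho> ^ j\<close> for the suffix of length \<open>j\<close>, and these weights sum
  to a partial geometric series. A second such factor comes from Cauchy-Schwarz at the constant
  term.\<close>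

lemma cinner_add_right: "cinner x (y + z) = cinner x y + cinner x z"
  by (metis cinner_add_left cinner_commute complex_cnj_add)

lemma cinner_zero_left [simp]: "cinner 0 x = 0"
  using cinner_add_left[of 0 0 x] by simp

lemma cinner_zero_right [simp]: "cinner x 0 = 0"
  using cinner_add_right[of x 0 0] by simp

lemma cinner_minus_left: "cinner (- x) y = - cinner x y"
  using cinner_add_left[of "- x" x y] by (simp add: eq_neg_iff_add_eq_0)

lemma cinner_minus_right: "cinner x (- y) = - cinner x y"
  using cinner_add_right[of x "- y" y] by (simp add: eq_neg_iff_add_eq_0)

lemma cinner_diff_left: "cinner (x - y) z = cinner x z - cinner y z"
  using cinner_add_left[of x "- y" z] by (simp add: cinner_minus_left)

lemma cinner_diff_right: "cinner x (y - z) = cinner x y - cinner x z"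
  using cinner_add_right[of x y "- z"] by (simp add: cinner_minus_right)

lemma cinner_sum_left: "cinner (sum f A) y = (\<Sum>i\<in>A. cinner (f i) y)"
  by (induction A rule: infinite_finite_induct) (simp_all add: cinner_add_left)

lemma cinner_sum_right: "cinner x (sum f A) = (\<Sum>i\<in>A. cinner x (f i))"
  by (induction A rule: infinite_finite_induct) (simp_all add: cinner_add_right)

lemma cinner_self: "cinner x x = of_real ((norm x)\<^sup>2)"
proof (rule complex_eqI)
  \<comment> \<open>Positivity of the inner product is not an axiom of the class. As
    \<open>sqrt\<close> is odd, it follows from the norm being nonnegative.\<close>
  have "0 \<le> norm x"
    by simp
  then show "Re (cinner x x) = Re (of_real ((norm x)\<^sup>2))"
    unfolding norm_eq_sqrt_cinner
    by (simp add: real_sqrt_ge_0_iff del: of_real_power)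
  show "Im (cinner x x) = Im (of_real ((norm x)\<^sup>2))"
    using cinner_commute[of x x] by (simp add: complex_eq_iff del: of_real_power)
qed

lemma norm_add_sq: "(norm (x + y))\<^sup>2 = (norm x)\<^sup>2 + 2 * Re (cinner x y) + (norm (y :: 'a::complex_hilbert))\<^sup>2"
proof -
  have "complex_of_real ((norm (x + y))\<^sup>2) = cinner x x + cinner y y + (cinner x y + cnj (cinner x y))"
    unfolding cinner_self[symmetric]
    by (simp add: cinner_add_left cinner_add_right cinner_commute[of y x])
  also have "\<dots> = of_real ((norm x)\<^sup>2 + 2 * Re (cinner x y) + (norm y)\<^sup>2)"
    by (simp add: cinner_self complex_add_cnj)
  finally show ?thesis
    by (simp only: of_real_eq_iff)
qed

lemma norm_diff_sq: "(norm (x - y))\<^sup>2 = (norm x)\<^sup>2 - 2 * Re (cinner x y) + (norm (y :: 'a::complex_hilbert))\<^sup>2"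
  using norm_add_sq[of x "- y"] by (simp add: cinner_minus_right)

lemma cauchy_schwarz: "cmod (cinner x y) \<le> norm x * norm (y :: 'a::complex_hilbert)"
proof (cases "y = 0")
  case False
  \<comment> \<open>\<open>c *\<^sub>C y\<close> is the orthogonal projection of \<open>x\<close>
    onto the line through \<open>y\<close>; the claim is that the remainder has nonnegative squared
    norm.\<close>
  define c where "c = cinner x y / of_real ((norm y)\<^sup>2)"
  have "cinner x (c *\<^sub>C y) = of_real ((cmod (cinner x y))\<^sup>2 / (norm y)\<^sup>2)"
    unfolding c_def cinner_scaleC_right of_real_divide complex_norm_square by (simp add: mult.commute)
  moreover have "(norm (c *\<^sub>C y))\<^sup>2 = (cmod (cinner x y))\<^sup>2 / (norm y)\<^sup>2"
    using False
    by (simp add: c_def norm_scaleC norm_divide norm_mult power_mult_distrib power_divide power2_eq_square)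
  moreover have "0 \<le> (norm (x - c *\<^sub>C y))\<^sup>2"
    by simp
  ultimately have "(cmod (cinner x y))\<^sup>2 / (norm y)\<^sup>2 \<le> (norm x)\<^sup>2"
    by (simp add: norm_diff_sq)
  then have "(cmod (cinner x y))\<^sup>2 \<le> (norm x * norm y)\<^sup>2"
    using False by (simp add: power_mult_distrib divide_le_eq)
  then show ?thesis
    by (rule power2_le_imp_le) simp
qed simp

lemma bounded_linear_cinner_left: "bounded_linear (\<lambda>x :: 'a::complex_hilbert. cinner x y)"
  by (rule bounded_linear_intro[where K = "norm y"])
    (simp_all add: cinner_add_left scaleR_scaleC cinner_scaleC_left scaleR_conv_of_real cauchy_schwarz)

lemma bounded_linear_scaleC_left: "bounded_linear (\<lambda>c. c *\<^sub>C (v :: 'a::complex_hilbert))"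
  by (rule bounded_linear_intro[where K = "norm v"])
    (simp_all add: scaleC_add_left scaleR_scaleC scaleC_scaleC norm_scaleC scaleR_conv_of_real)

lemma cinner_ext:
  assumes "\<And>z. cinner z x = cinner z (y :: 'a::complex_hilbert)"
  shows "x = y"
proof -
  have "cinner (x - y) (x - y) = 0"
    using assms[of "x - y"] by (simp add: cinner_diff_right)
  then show ?thesis
    by (simp add: cinner_self)
qed

text \<open>Midpoints are the form in which convexity enters the parallelogram law, which makes
  every minimising sequence Cauchy.\<close>

lemma minimal_norm_exists:
  fixes S :: "'a::complex_hilbert set"
  assumes S: "closed S" "S \<noteq> {}" and mid: "\<And>x y. x \<in> S \<Longrightarrow> y \<in> S \<Longrightarrow> (1/2) *\<^sub>R (x + y) \<in> S"
  shows "\<exists>z\<in>S. \<forall>x\<in>S. norm z \<le> norm x"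
proof -
  define d where "d = Inf (norm ` S)"
  have bdd: "bdd_below (norm ` S)"
    by (rule bdd_belowI2[of _ 0]) simp
  have d_le: "d \<le> norm x" if "x \<in> S" for x
    unfolding d_def using that bdd by (rule cINF_lower[rotated])
  have d0: "0 \<le> d"
    unfolding d_def using S(2) by (intro cINF_greatest) auto
  have "\<exists>x\<in>S. norm x < d + 1 / real (Suc n)" for n
    using cInf_lessD[of "norm ` S" "d + 1 / real (Suc n)"] S(2) by (auto simp: d_def)
  then obtain x where xS: "\<And>n. x n \<in> S" and xd: "\<And>n. norm (x n) < d + 1 / real (Suc n)"
    by metis
  have lim: "(\<lambda>n. norm (x n)) \<longlonglongrightarrow> d"
  proof (rule tendsto_sandwich[of "\<lambda>_. d" _ _ "\<lambda>n. d + 1 / real (Suc n)"])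
    show "\<forall>\<^sub>F n in sequentially. d \<le> norm (x n)"
      using d_le xS by simp
    show "\<forall>\<^sub>F n in sequentially. norm (x n) \<le> d + 1 / real (Suc n)"
      using xd by (simp add: less_imp_le)
    show "(\<lambda>n. d + 1 / real (Suc n)) \<longlonglongrightarrow> d"
      using tendsto_add[OF tendsto_const LIMSEQ_Suc[OF lim_1_over_n], of d] by (simp del: of_nat_Suc)
  qed simp
  have para: "(norm (x m - x n))\<^sup>2 \<le> 2 * (norm (x m))\<^sup>2 + 2 * (norm (x n))\<^sup>2 - 4 * d\<^sup>2" for m n
  proof -
    have "d \<le> norm ((1/2) *\<^sub>R (x m + x n))"
      by (intro d_le mid xS)
    then have "2 * d \<le> norm (x m + x n)"
      by simp
    then have "(2 * d)\<^sup>2 \<le> (norm (x m + x n))\<^sup>2"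
      using d0 by (intro power_mono) auto
    then show ?thesis
      using norm_add_sq[of "x m" "x n"] norm_diff_sq[of "x m" "x n"] by (simp add: power_mult_distrib)
  qed
  have "Cauchy x"
  proof (rule metric_CauchyI)
    fix e :: real
    assume "0 < e"
    have "(\<lambda>n. (norm (x n))\<^sup>2) \<longlonglongrightarrow> d\<^sup>2"
      using lim by (rule tendsto_power)
    then have "\<forall>\<^sub>F n in sequentially. (norm (x n))\<^sup>2 < d\<^sup>2 + e\<^sup>2 / 4"
      using \<open>0 < e\<close> by (intro order_tendstoD) auto
    then obtain M where M: "\<And>n. n \<ge> M \<Longrightarrow> (norm (x n))\<^sup>2 < d\<^sup>2 + e\<^sup>2 / 4"
      by (auto simp: eventually_sequentially)
    have "dist (x m) (x n) < e" if "m \<ge> M" "n \<ge> M" for m n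
    proof -
      have "(norm (x m - x n))\<^sup>2 < e\<^sup>2"
        using para[of m n] M[OF that(1)] M[OF that(2)] by linarith
      then show ?thesis
        using \<open>0 < e\<close> by (simp add: dist_norm power2_less_imp_less)
    qed
    then show "\<exists>M. \<forall>m\<ge>M. \<forall>n\<ge>M. dist (x m) (x n) < e"
      by blast
  qed
  then obtain z where z: "x \<longlonglongrightarrow> z"
    by (auto simp: Cauchy_convergent_iff convergent_def)
  have "z \<in> S"
    using S(1) xS z by (rule closed_sequentially)
  moreover have "norm z = d"
    using tendsto_norm[OF z] lim LIMSEQ_unique by blast
  ultimately show ?thesis
    using d_le by blast
qed

text \<open>The vector of least norm on the hyperplane \<open>f = 1\<close> is orthogonal to the
  kernel of \<open>f\<close>; divided by its squared norm it represents \<open>f\<close>.\<close>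

lemma riesz_representation:
  fixes f :: "'a::complex_hilbert \<Rightarrow> complex"
  assumes f: "bounded_linear f" and fC: "\<And>c x. f (c *\<^sub>C x) = c * f x"
  shows "\<exists>z. \<forall>x. f x = cinner x z"
proof (cases "\<forall>x. f x = 0")
  case True
  then show ?thesis
    by (intro exI[of _ 0]) simp
next
  case False
  interpret bounded_linear f
    by (rule f)
  obtain u where u: "f u \<noteq> 0"
    using False by blast
  have "closed (f -` {1})"
    by (intro continuous_closed_vimage) (simp_all add: linear_continuous_at f)
  moreover have "inverse (f u) *\<^sub>C u \<in> f -` {1}"
    using u by (simp add: fC)
  ultimately have "\<exists>z\<in>f -` {1}. \<forall>x\<in>f -` {1}. norm z \<le> norm x"
    by (intro minimal_norm_exists) (auto simp: scaleR add scaleR_conv_of_real)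
  then obtain z where fz: "f z = 1" and z_min: "\<And>x. f x = 1 \<Longrightarrow> norm z \<le> norm x"
    by auto
  have "z \<noteq> 0"
    using fz zero by auto
  have orth: "cinner y z = 0" if "f y = 0" for y
  proof (cases "y = 0")
    case False
    \<comment> \<open>Adding \<open>c *\<^sub>C y\<close> removes the component of \<open>z\<close>
      along \<open>y\<close> and lowers the squared norm by
      \<open>(cmod (cinner z y))\<^sup>2 / (norm y)\<^sup>2\<close>; minimality of \<open>z\<close>
      forces this drop to be zero.\<close>
    define c where "c = - (cinner z y / of_real ((norm y)\<^sup>2))"
    have "norm z \<le> norm (z + c *\<^sub>C y)"
      by (rule z_min) (simp add: add fC that fz)
    then have "(norm z)\<^sup>2 \<le> (norm (z + c *\<^sub>C y))\<^sup>2"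
      by (intro power_mono) auto
    moreover have "cinner z (c *\<^sub>C y) = - of_real ((cmod (cinner z y))\<^sup>2 / (norm y)\<^sup>2)"
      unfolding c_def cinner_scaleC_right of_real_divide complex_norm_square by (simp add: mult.commute)
    moreover have "(norm (c *\<^sub>C y))\<^sup>2 = (cmod (cinner z y))\<^sup>2 / (norm y)\<^sup>2"
      using False
      by (simp add: c_def norm_scaleC norm_divide norm_mult power_mult_distrib power_divide power2_eq_square)
    ultimately have "(cmod (cinner z y))\<^sup>2 / (norm y)\<^sup>2 \<le> 0"
      by (simp add: norm_add_sq)
    then have "cinner z y = 0"
      using False by (simp add: divide_le_0_iff)
    then show ?thesis
      by (subst cinner_commute) simp
  qed simp
  have "f x = cinner x (inverse (of_real ((norm z)\<^sup>2)) *\<^sub>C z)" for x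
  proof -
    have "cinner (x - f x *\<^sub>C z) z = 0"
      by (rule orth) (simp add: diff fC fz)
    then show ?thesis
      using \<open>z \<noteq> 0\<close>
      by (simp add: cinner_diff_left cinner_scaleC_left cinner_scaleC_right cinner_self field_simps)
  qed
  then show ?thesis
    by blast
qed

text \<open>\<open>op_adjoint\<close> is a definite description. Riesz gives its value at each
  \<open>y\<close>; the resulting map must be shown to be bounded and linear before the description
  is known to denote anything.\<close>

lemma cinner_op_adjoint:
  fixes A :: "'h::complex_hilbert operator"
  assumes A: "complex_linear A"
  shows "cinner (blinfun_apply A x) y = cinner x (blinfun_apply (op_adjoint A) y)"
proof -
  have "\<exists>z. \<forall>x. cinner (blinfun_apply A x) y = cinner x z" for y
  proof (rule riesz_representation)
    show "bounded_linear (\<lambda>x. cinner (blinfun_apply A x) y)"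
      by (rule bounded_linear_compose[OF bounded_linear_cinner_left]) (rule blinfun.bounded_linear_right)
    show "cinner (blinfun_apply A (c *\<^sub>C x)) y = c * cinner (blinfun_apply A x) y" for c x
      using A by (simp add: complex_linear_def cinner_scaleC_left)
  qed
  then obtain B where B: "\<And>x y. cinner (blinfun_apply A x) y = cinner x (B y)"
    by metis
  have "bounded_linear B"
  proof (rule bounded_linear_intro[where K = "norm A"])
    show "B (x + y) = B x + B y" for x y
      by (rule cinner_ext) (simp add: cinner_add_right B[symmetric])
    show "B (r *\<^sub>R x) = r *\<^sub>R B x" for r x
      by (rule cinner_ext) (simp add: scaleR_scaleC cinner_scaleC_right B[symmetric])
    show "norm (B y) \<le> norm y * norm A" for y
    proof (cases "B y = 0")
      case False
      have "(norm (B y))\<^sup>2 = cmod (cinner (blinfun_apply A (B y)) y)"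
        by (simp add: B cinner_self norm_power)
      also have "\<dots> \<le> norm A * norm (B y) * norm y"
        by (meson cauchy_schwarz norm_blinfun mult_right_mono norm_ge_zero order_trans)
      finally show ?thesis
        using False by (simp add: power2_eq_square mult_ac)
    qed simp
  qed
  then have appB: "blinfun_apply (Blinfun B) = B"
    by (rule bounded_linear_Blinfun_apply)
  have "\<forall>x y. cinner (blinfun_apply A x) y = cinner x (blinfun_apply (op_adjoint A) y)"
    unfolding op_adjoint_def
  proof (rule theI)
    show "\<forall>x y. cinner (blinfun_apply A x) y = cinner x (blinfun_apply (Blinfun B) y)"
      by (simp add: appB B)
    show "C = Blinfun B"
      if "\<forall>x y. cinner (blinfun_apply A x) y = cinner x (blinfun_apply C y)" for C
      by (rule blinfun_eqI, rule cinner_ext) (simp add: appB B[symmetric] that)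
  qed
  then show ?thesis
    by blast
qed

lemma complex_linear_op_adjoint:
  assumes "complex_linear A"
  shows "complex_linear (op_adjoint A)"
  unfolding complex_linear_def
proof (intro allI cinner_ext)
  show "cinner z (blinfun_apply (op_adjoint A) (c *\<^sub>C x))
      = cinner z (c *\<^sub>C blinfun_apply (op_adjoint A) x)" for c x z
    by (simp add: cinner_op_adjoint[OF assms, symmetric] cinner_scaleC_right)
qed

lemma norm_op_adjoint_le:
  assumes "complex_linear A"
  shows "norm (op_adjoint A) \<le> norm A"
proof (rule norm_blinfun_bound)
  fix y
  let ?B = "blinfun_apply (op_adjoint A)"
  show "norm (?B y) \<le> norm A * norm y"
  proof (cases "?B y = 0")
    case False
    have "(norm (?B y))\<^sup>2 = cmod (cinner (blinfun_apply A (?B y)) y)"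
      by (simp add: cinner_op_adjoint[OF assms] cinner_self norm_power)
    also have "\<dots> \<le> norm A * norm (?B y) * norm y"
      by (meson cauchy_schwarz norm_blinfun mult_right_mono norm_ge_zero order_trans)
    finally show ?thesis
      using False by (simp add: power2_eq_square mult_ac)
  qed simp
qed simp

lemma norm_op_adjoint:
  assumes A: "complex_linear A"
  shows "norm (op_adjoint A) = norm A"
proof -
  have "op_adjoint (op_adjoint A) = A"
  proof (rule blinfun_eqI, rule cinner_ext)
    show "cinner z (blinfun_apply (op_adjoint (op_adjoint A)) x) = cinner z (blinfun_apply A x)" for x z
      by (metis A cinner_op_adjoint complex_linear_op_adjoint cinner_commute)
  qed
  then show ?thesis
    using norm_op_adjoint_le[OF A] norm_op_adjoint_le[OF complex_linear_op_adjoint[OF A]] by simp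
qed

lemma complex_linear_compose:
  "complex_linear A \<Longrightarrow> complex_linear B \<Longrightarrow> complex_linear (A o\<^sub>L B)"
  by (simp add: complex_linear_def)

subsection \<open>The Hilbert space of square summable families\<close>

text \<open>Square summable families get a type of their own so that it can be made an instance of
  \<open>complex_hilbert\<close>, which brings adjoints and the operator norm along.\<close>

typedef 'a ell2 = "{f :: 'a \<Rightarrow> complex. (\<lambda>x. (cmod (f x))\<^sup>2) summable_on UNIV}"
  morphisms ell2_apply Abs_ell2
  by (rule exI[of _ "\<lambda>_. 0"]) simp

setup_lifting type_definition_ell2

lemma ell2_eqI: "(\<And>x. ell2_apply f x = ell2_apply g x) \<Longrightarrow> f = g"
  by (simp add: ell2_apply_inject[symmetric] fun_eq_iff)

lemma ell2_summable: "(\<lambda>x. (cmod (ell2_apply f x))\<^sup>2) summable_on A"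
  by (rule summable_on_subset_banach[of _ UNIV]) (use ell2_apply[of f] in auto)

lemma L2_set_power2: "(L2_set f A)\<^sup>2 = (\<Sum>x\<in>A. (f x)\<^sup>2)"
  by (simp add: L2_set_def sum_nonneg)

text \<open>Estimates on infinite families are reduced throughout to uniform bounds on finite index
  sets, where \<open>L2_set\<close> obeys the triangle inequality.\<close>

lemma square_summableI:
  assumes "\<And>F. finite F \<Longrightarrow> L2_set (\<lambda>x. cmod (f x)) F \<le> B"
  shows "(\<lambda>x. (cmod (f x))\<^sup>2) summable_on UNIV"
proof (rule nonneg_bdd_above_summable_on)
  have "(\<Sum>x\<in>F. (cmod (f x))\<^sup>2) \<le> B\<^sup>2" if "finite F" for F
    using power_mono[OF assms[OF that] L2_set_nonneg, of 2] by (simp add: L2_set_power2)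
  then show "bdd_above (sum (\<lambda>x. (cmod (f x))\<^sup>2) ` {F. F \<subseteq> UNIV \<and> finite F})"
    by (intro bdd_aboveI2[of _ _ "B\<^sup>2"]) auto
qed simp

lemma L2_set_le_sqrt_infsum:
  assumes "(\<lambda>x. (cmod (f x))\<^sup>2) summable_on UNIV" "finite F"
  shows "L2_set (\<lambda>x. cmod (f x)) F \<le> sqrt (\<Sum>\<^sub>\<infinity>x. (cmod (f x))\<^sup>2)"
  unfolding L2_set_def using assms by (intro real_sqrt_le_mono finite_sum_le_infsum) auto

lemma sqrt_infsum_le:
  assumes "(\<lambda>x. (cmod (f x))\<^sup>2) summable_on UNIV"
    and B: "\<And>F. finite F \<Longrightarrow> L2_set (\<lambda>x. cmod (f x)) F \<le> B"
  shows "sqrt (\<Sum>\<^sub>\<infinity>x. (cmod (f x))\<^sup>2) \<le> B"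
proof (rule real_le_lsqrt)
  show "0 \<le> B"
    using B[of "{}"] by simp
  show "(\<Sum>\<^sub>\<infinity>x. (cmod (f x))\<^sup>2) \<le> B\<^sup>2"
  proof (rule infsum_le_finite_sums[OF assms(1)])
    fix F :: "'a set"
    assume "finite F"
    then show "(\<Sum>x\<in>F. (cmod (f x))\<^sup>2) \<le> B\<^sup>2"
      using power_mono[OF B L2_set_nonneg, of F 2] by (simp add: L2_set_power2)
  qed
qed

lemma L2_set_cmod_add:
  "L2_set (\<lambda>x. cmod (f x + g x)) F \<le> L2_set (\<lambda>x. cmod (f x)) F + L2_set (\<lambda>x. cmod (g x)) F"
  by (rule order_trans[OF L2_set_mono L2_set_triangle_ineq]) (simp_all add: norm_triangle_ineq)

lemma square_summable_add:
  assumes "(\<lambda>x. (cmod (f x))\<^sup>2) summable_on UNIV" "(\<lambda>x. (cmod (g x))\<^sup>2) summable_on UNIV"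
  shows "(\<lambda>x. (cmod (f x + g x))\<^sup>2) summable_on UNIV"
  by (rule square_summableI, rule order_trans[OF L2_set_cmod_add], rule add_mono)
    (rule L2_set_le_sqrt_infsum, (rule assms | assumption)+)+

lemma square_summable_scale:
  "(\<lambda>x. (cmod (f x))\<^sup>2) summable_on UNIV \<Longrightarrow> (\<lambda>x. (cmod (c * f x))\<^sup>2) summable_on UNIV"
  by (simp add: norm_mult power_mult_distrib summable_on_cmult_right)

lemma square_summable_mult_cnj:
  assumes "(\<lambda>x. (cmod (f x))\<^sup>2) summable_on UNIV" "(\<lambda>x. (cmod (g x))\<^sup>2) summable_on UNIV"
  shows "(\<lambda>x. f x * cnj (g x)) summable_on UNIV"
proof (rule abs_summable_summable, rule summable_on_comparison_test[OF summable_on_add[OF assms]])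
  show "norm (f x * cnj (g x)) \<le> (cmod (f x))\<^sup>2 + (cmod (g x))\<^sup>2" for x
  proof -
    have "0 \<le> cmod (f x) * cmod (g x)"
      by simp
    then show ?thesis
      using sum_squares_bound[of "cmod (f x)" "cmod (g x)"] unfolding norm_mult complex_mod_cnj by linarith
  qed
qed simp

instantiation ell2 :: (type) real_normed_vector
begin

lift_definition zero_ell2 :: "'a ell2" is "\<lambda>_. 0"
  by simp

lift_definition plus_ell2 :: "'a ell2 \<Rightarrow> 'a ell2 \<Rightarrow> 'a ell2" is "\<lambda>f g x. f x + g x"
  by (rule square_summable_add)

lift_definition uminus_ell2 :: "'a ell2 \<Rightarrow> 'a ell2" is "\<lambda>f x. - f x"
  by simp

definition minus_ell2 :: "'a ell2 \<Rightarrow> 'a ell2 \<Rightarrow> 'a ell2" where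
  "minus_ell2 f g = f + - g"

lift_definition scaleR_ell2 :: "real \<Rightarrow> 'a ell2 \<Rightarrow> 'a ell2" is "\<lambda>r f x. complex_of_real r * f x"
  by (rule square_summable_scale)

lift_definition norm_ell2 :: "'a ell2 \<Rightarrow> real" is "\<lambda>f. sqrt (\<Sum>\<^sub>\<infinity>x. (cmod (f x))\<^sup>2)" .

definition dist_ell2 :: "'a ell2 \<Rightarrow> 'a ell2 \<Rightarrow> real" where
  "dist_ell2 f g = norm (f - g)"

definition sgn_ell2 :: "'a ell2 \<Rightarrow> 'a ell2" where
  "sgn_ell2 f = inverse (norm f) *\<^sub>R f"

definition uniformity_ell2 :: "('a ell2 \<times> 'a ell2) filter" where
  "uniformity_ell2 = (INF e\<in>{0 <..}. principal {(x, y). dist x y < e})"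

definition open_ell2 :: "'a ell2 set \<Rightarrow> bool" where
  "open_ell2 U = (\<forall>x\<in>U. \<forall>\<^sub>F (x', y) in uniformity. x' = x \<longrightarrow> y \<in> U)"

instance
proof
  fix f g h :: "'a ell2" and r s :: real
  show "f + g + h = f + (g + h)" "f + g = g + f" "0 + f = f" "- f + f = 0"
    "r *\<^sub>R (f + g) = r *\<^sub>R f + r *\<^sub>R g" "(r + s) *\<^sub>R f = r *\<^sub>R f + s *\<^sub>R f"
    "r *\<^sub>R s *\<^sub>R f = (r * s) *\<^sub>R f" "1 *\<^sub>R f = f"
    by (transfer, simp add: algebra_simps fun_eq_iff)+
  show "f - g = f + - g" "dist f g = norm (f - g)" "sgn f = inverse (norm f) *\<^sub>R f"
    by (simp_all add: minus_ell2_def dist_ell2_def sgn_ell2_def)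
  show "uniformity = (INF e\<in>{0 <..}. principal {(x :: 'a ell2, y). dist x y < e})"
    by (rule uniformity_ell2_def)
  show "open U = (\<forall>x\<in>U. \<forall>\<^sub>F (x', y) in uniformity. x' = x \<longrightarrow> y \<in> U)" for U :: "'a ell2 set"
    by (rule open_ell2_def)
  show "(norm f = 0) = (f = 0)"
  proof
    assume f: "norm f = 0"
    have "ell2_apply f x = 0" for x
    proof -
      have "L2_set (\<lambda>x. cmod (ell2_apply f x)) {x} \<le> norm f"
        unfolding norm_ell2.rep_eq by (intro L2_set_le_sqrt_infsum ell2_summable) simp
      with f show ?thesis
        by simp
    qed
    then show "f = 0"
      by (intro ell2_eqI) (simp add: zero_ell2.rep_eq)
  qed (simp add: norm_ell2.rep_eq zero_ell2.rep_eq)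
  show "norm (f + g) \<le> norm f + norm g"
    unfolding norm_ell2.rep_eq[of "f + g"] plus_ell2.rep_eq
  proof (rule sqrt_infsum_le)
    show "L2_set (\<lambda>x. cmod (ell2_apply f x + ell2_apply g x)) F \<le> norm f + norm g"
      if "finite F" for F
      unfolding norm_ell2.rep_eq using that
      by (intro order_trans[OF L2_set_cmod_add] add_mono L2_set_le_sqrt_infsum ell2_summable)
  qed (intro square_summable_add ell2_summable)
  show "norm (r *\<^sub>R f) = \<bar>r\<bar> * norm f"
    by (simp add: norm_ell2.rep_eq scaleR_ell2.rep_eq norm_mult power_mult_distrib
        infsum_cmult_right' real_sqrt_mult)
qed

end

lemma minus_ell2_apply: "ell2_apply (f - g) x = ell2_apply f x - ell2_apply g x"
  by (simp only: minus_ell2_def plus_ell2.rep_eq uminus_ell2.rep_eq) simp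

lemma L2_set_le_norm_ell2:
  "finite F \<Longrightarrow> L2_set (\<lambda>x. cmod (ell2_apply f x)) F \<le> norm f"
  unfolding norm_ell2.rep_eq by (rule L2_set_le_sqrt_infsum[OF ell2_summable])

lemma norm_ell2_le:
  "(\<And>F. finite F \<Longrightarrow> L2_set (\<lambda>x. cmod (ell2_apply f x)) F \<le> B) \<Longrightarrow> norm f \<le> B"
  unfolding norm_ell2.rep_eq by (rule sqrt_infsum_le[OF ell2_summable])

lemma cmod_ell2_apply_le: "cmod (ell2_apply f x) \<le> norm f"
  using L2_set_le_norm_ell2[of "{x}" f] by simp

text \<open>The coordinates converge, and the Cauchy estimate passes to the limit on each finite set
  of coordinates. In \<open>tail\<close> the index \<open>N\<close> is chosen before the finite set
  \<open>F\<close>, since only a bound uniform in \<open>F\<close> controls the norm.\<close>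

lemma Cauchy_convergent_ell2:
  fixes X :: "nat \<Rightarrow> 'a ell2"
  assumes X: "Cauchy X"
  shows "convergent X"
proof -
  have "Cauchy (\<lambda>n. ell2_apply (X n) x)" for x
  proof (rule metric_CauchyI)
    fix e :: real
    assume "0 < e"
    then obtain M where M: "\<And>m n. m \<ge> M \<Longrightarrow> n \<ge> M \<Longrightarrow> dist (X m) (X n) < e"
      using X metric_CauchyD by blast
    have "dist (ell2_apply (X m) x) (ell2_apply (X n) x) \<le> dist (X m) (X n)" for m n
      using cmod_ell2_apply_le[of "X m - X n" x] by (simp add: dist_norm minus_ell2_apply)
    with M show "\<exists>M. \<forall>m\<ge>M. \<forall>n\<ge>M. dist (ell2_apply (X m) x) (ell2_apply (X n) x) < e"
      by (meson order_le_less_trans)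
  qed
  then have "\<exists>l. (\<lambda>n. ell2_apply (X n) x) \<longlonglongrightarrow> l" for x
    by (simp add: Cauchy_convergent_iff convergent_def)
  then obtain l where l: "\<And>x. (\<lambda>n. ell2_apply (X n) x) \<longlonglongrightarrow> l x"
    by metis
  have tail: "\<exists>N. \<forall>n\<ge>N. \<forall>F. finite F \<longrightarrow> L2_set (\<lambda>x. cmod (l x - ell2_apply (X n) x)) F \<le> e"
    if "0 < e" for e
  proof -
    obtain N where N: "\<And>m n. m \<ge> N \<Longrightarrow> n \<ge> N \<Longrightarrow> dist (X m) (X n) < e"
      using X \<open>0 < e\<close> metric_CauchyD by blast
    have "L2_set (\<lambda>x. cmod (l x - ell2_apply (X n) x)) F \<le> e" if "finite F" "n \<ge> N" for F n
    proof (rule tendsto_upperbound)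
      show "(\<lambda>m. L2_set (\<lambda>x. cmod (ell2_apply (X m) x - ell2_apply (X n) x)) F)
          \<longlonglongrightarrow> L2_set (\<lambda>x. cmod (l x - ell2_apply (X n) x)) F"
        unfolding L2_set_def by (intro tendsto_intros l)
      show "\<forall>\<^sub>F m in sequentially. L2_set (\<lambda>x. cmod (ell2_apply (X m) x - ell2_apply (X n) x)) F \<le> e"
        using eventually_ge_at_top[of N]
      proof eventually_elim
        case (elim m)
        then show ?case
          using L2_set_le_norm_ell2[OF that(1), of "X m - X n"] N[OF elim that(2)]
          by (simp add: minus_ell2_apply dist_norm)
      qed
    qed simp
    then show ?thesis
      by blast
  qed
  obtain N where N: "\<And>F. finite F \<Longrightarrow> L2_set (\<lambda>x. cmod (l x - ell2_apply (X N) x)) F \<le> 1"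
    using tail[of 1] by auto
  have "(\<lambda>x. (cmod ((l x - ell2_apply (X N) x) + ell2_apply (X N) x))\<^sup>2) summable_on UNIV"
    by (intro square_summable_add ell2_summable square_summableI[OF N])
  then have "l \<in> {f. (\<lambda>x. (cmod (f x))\<^sup>2) summable_on UNIV}"
    by simp
  then have appL: "ell2_apply (Abs_ell2 l) = l"
    by (rule Abs_ell2_inverse)
  have "X \<longlonglongrightarrow> Abs_ell2 l"
  proof (rule metric_LIMSEQ_I)
    fix e :: real
    assume "0 < e"
    then obtain N where N: "\<And>n F. n \<ge> N \<Longrightarrow> finite F \<Longrightarrow>
        L2_set (\<lambda>x. cmod (l x - ell2_apply (X n) x)) F \<le> e / 2"
      using tail[of "e / 2"] by auto
    have "dist (X n) (Abs_ell2 l) < e" if "n \<ge> N" for n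
    proof -
      have "norm (Abs_ell2 l - X n) \<le> e / 2"
        by (rule norm_ell2_le) (unfold minus_ell2_apply appL, rule N[OF that])
      then show ?thesis
        using \<open>0 < e\<close> by (simp add: dist_norm norm_minus_commute)
    qed
    then show "\<exists>N. \<forall>n\<ge>N. dist (X n) (Abs_ell2 l) < e"
      by blast
  qed
  then show ?thesis
    by (rule convergentI)
qed

instantiation ell2 :: (type) complex_hilbert
begin

lift_definition scaleC_ell2 :: "complex \<Rightarrow> 'a ell2 \<Rightarrow> 'a ell2" is "\<lambda>c f x. c * f x"
  by (rule square_summable_scale)

lift_definition cinner_ell2 :: "'a ell2 \<Rightarrow> 'a ell2 \<Rightarrow> complex" is
  "\<lambda>f g. \<Sum>\<^sub>\<infinity>x. f x * cnj (g x)" .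

instance
proof
  fix f g h :: "'a ell2" and c d :: complex and r :: real
  show "c *\<^sub>C (f + g) = c *\<^sub>C f + c *\<^sub>C g" "(c + d) *\<^sub>C f = c *\<^sub>C f + d *\<^sub>C f"
    "c *\<^sub>C d *\<^sub>C f = (c * d) *\<^sub>C f" "1 *\<^sub>C f = f" "r *\<^sub>R f = complex_of_real r *\<^sub>C f"
    by (transfer, simp add: algebra_simps fun_eq_iff)+
  show "cinner f g = cnj (cinner g f)"
    unfolding cinner_ell2.rep_eq infsum_cnj[symmetric] by (simp add: mult.commute)
  show "cinner (f + g) h = cinner f h + cinner g h"
    unfolding cinner_ell2.rep_eq plus_ell2.rep_eq distrib_right
    by (intro infsum_add square_summable_mult_cnj ell2_summable)
  show "cinner (c *\<^sub>C f) g = c * cinner f g"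
    unfolding cinner_ell2.rep_eq scaleC_ell2.rep_eq mult.assoc by (rule infsum_cmult_right')
  have "cinner f f = of_real (\<Sum>\<^sub>\<infinity>x. (cmod (ell2_apply f x))\<^sup>2)"
    unfolding cinner_ell2.rep_eq complex_norm_square[symmetric]
    by (intro infsumI has_sum_of_real has_sum_infsum ell2_summable)
  then show "norm f = sqrt (Re (cinner f f))"
    by (simp add: norm_ell2.rep_eq)
  show "convergent X" if "Cauchy X" for X :: "nat \<Rightarrow> 'a ell2"
    using that by (rule Cauchy_convergent_ell2)
qed

end

lemmas ell2_simps = zero_ell2.rep_eq plus_ell2.rep_eq minus_ell2_apply uminus_ell2.rep_eq
  scaleC_ell2.rep_eq

lemma ell2_apply_sum: "ell2_apply (sum f A) x = (\<Sum>i\<in>A. ell2_apply (f i) x)"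
  by (induction A rule: infinite_finite_induct) (simp_all add: ell2_simps)

section \<open>Unit vectors and coordinate projections\<close>

lift_definition ket :: "'a \<Rightarrow> 'a ell2" is "\<lambda>x y. if y = x then 1 else 0"
  by (rule finite_nonzero_values_imp_summable_on) simp

lemma infsum_single: "infsum (\<lambda>y. if y = x then f y else 0) UNIV = f x"
proof -
  have "infsum (\<lambda>y. if y = x then f y else 0) UNIV = infsum f {x}"
    by (rule infsum_cong_neutral) auto
  then show ?thesis
    by simp
qed

lemma cinner_ket: "cinner f (ket x) = ell2_apply f x"
  using infsum_single[of x "ell2_apply f"]
  by (simp add: cinner_ell2.rep_eq ket.rep_eq if_distrib cong: if_cong)

lemma bounded_linear_ell2_apply: "bounded_linear (\<lambda>f. ell2_apply f x)"
  using bounded_linear_cinner_left[of "ket x"] by (simp add: cinner_ket)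

lemma norm_ket: "norm (ket x) = 1"
proof -
  have "complex_of_real ((norm (ket x))\<^sup>2) = 1"
    by (simp only: cinner_self[symmetric] cinner_ket) (simp add: ket.rep_eq)
  then show ?thesis
    by (simp only: of_real_eq_1_iff power2_eq_1_iff) (use norm_ge_zero[of "ket x"] in linarith)
qed

lift_definition restr_ell2 :: "'a set \<Rightarrow> 'a ell2 \<Rightarrow> 'a ell2" is "\<lambda>S f x. if x \<in> S then f x else 0"
proof -
  fix S :: "'a set" and f :: "'a \<Rightarrow> complex"
  assume "(\<lambda>x. (cmod (f x))\<^sup>2) summable_on UNIV"
  then show "(\<lambda>x. (cmod (if x \<in> S then f x else 0))\<^sup>2) summable_on UNIV"
    by (rule summable_on_comparison_test) auto
qed

lemma norm_restr_ell2_sq: "(norm (restr_ell2 S f))\<^sup>2 = (\<Sum>\<^sub>\<infinity>x\<in>S. (cmod (ell2_apply f x))\<^sup>2)"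
proof -
  have "(\<Sum>\<^sub>\<infinity>x. (cmod (if x \<in> S then ell2_apply f x else 0))\<^sup>2) = (\<Sum>\<^sub>\<infinity>x\<in>S. (cmod (ell2_apply f x))\<^sup>2)"
    by (rule infsum_cong_neutral) auto
  then show ?thesis
    by (simp add: norm_ell2.rep_eq restr_ell2.rep_eq infsum_nonneg)
qed

lemma norm_ell2_sq: "(norm f)\<^sup>2 = (\<Sum>\<^sub>\<infinity>x. (cmod (ell2_apply f x))\<^sup>2)"
  by (simp add: norm_ell2.rep_eq infsum_nonneg)

lemma norm_restr_ell2_le: "norm (restr_ell2 S f) \<le> norm f"
proof (rule norm_ell2_le)
  fix F :: "'a set"
  assume "finite F"
  have "L2_set (\<lambda>x. cmod (ell2_apply (restr_ell2 S f) x)) F \<le> L2_set (\<lambda>x. cmod (ell2_apply f x)) F"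
    by (rule L2_set_mono) (auto simp: restr_ell2.rep_eq)
  then show "L2_set (\<lambda>x. cmod (ell2_apply (restr_ell2 S f) x)) F \<le> norm f"
    using L2_set_le_norm_ell2[OF \<open>finite F\<close>] by (rule order_trans)
qed

lift_definition proj_ell2 :: "'a set \<Rightarrow> 'a ell2 operator" is restr_ell2
proof (rule bounded_linear_intro[where K = 1])
  show "norm (restr_ell2 S f) \<le> norm f * 1" for S and f :: "'a ell2"
    by (simp add: norm_restr_ell2_le)
qed (rule ell2_eqI, simp add: restr_ell2.rep_eq ell2_simps scaleR_scaleC)+

lemma proj_ell2_apply:
  "ell2_apply (blinfun_apply (proj_ell2 S) f) x = (if x \<in> S then ell2_apply f x else 0)"
  by (simp add: proj_ell2.rep_eq restr_ell2.rep_eq)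

lemma norm_proj_ell2_sq:
  "(norm (blinfun_apply (proj_ell2 S) f))\<^sup>2 = (\<Sum>\<^sub>\<infinity>x\<in>S. (cmod (ell2_apply f x))\<^sup>2)"
  by (simp add: proj_ell2.rep_eq norm_restr_ell2_sq)

lemma norm_proj_ell2_le: "norm (blinfun_apply (proj_ell2 S) f) \<le> norm f"
  by (simp add: proj_ell2.rep_eq norm_restr_ell2_le)

lemma complex_linear_proj_ell2: "complex_linear (proj_ell2 S)"
  unfolding complex_linear_def by (auto intro!: ell2_eqI simp: proj_ell2_apply ell2_simps)

lemma cinner_proj_ell2: "cinner (blinfun_apply (proj_ell2 S) f) g = cinner f (blinfun_apply (proj_ell2 S) g)"
  unfolding cinner_ell2.rep_eq by (rule infsum_cong) (simp add: proj_ell2_apply)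

lemma proj_ell2_finite:
  assumes "finite F"
  shows "blinfun_apply (proj_ell2 F) f = (\<Sum>x\<in>F. ell2_apply f x *\<^sub>C ket x)"
  using assms
  by (intro ell2_eqI) (auto simp: proj_ell2_apply ell2_apply_sum ell2_simps ket.rep_eq if_distrib cong: if_cong)

text \<open>By Pythagoras the squared distance of \<open>f\<close> to its projection is the total
  sum of squares minus the sum over \<open>F\<close>.\<close>

lemma proj_ell2_tendsto:
  "((\<lambda>F. blinfun_apply (proj_ell2 F) f) \<longlongrightarrow> f) (finite_subsets_at_top UNIV)"
proof -
  have "((\<lambda>F. (norm f)\<^sup>2 - (\<Sum>x\<in>F. (cmod (ell2_apply f x))\<^sup>2)) \<longlongrightarrow> (norm f)\<^sup>2 - (norm f)\<^sup>2)
      (finite_subsets_at_top UNIV)"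
    unfolding norm_ell2_sq by (intro tendsto_intros infsum_tendsto ell2_summable)
  then have "((\<lambda>F. (norm f)\<^sup>2 - (\<Sum>x\<in>F. (cmod (ell2_apply f x))\<^sup>2)) \<longlongrightarrow> 0) (finite_subsets_at_top UNIV)"
    by simp
  moreover have "\<forall>\<^sub>F F in finite_subsets_at_top UNIV. (norm f)\<^sup>2 - (\<Sum>x\<in>F. (cmod (ell2_apply f x))\<^sup>2)
      = (norm (blinfun_apply (proj_ell2 F) f - f))\<^sup>2"
    using eventually_finite_subsets_at_top_weakI
  proof (rule eventually_mono)
    fix F :: "'a set"
    assume F: "finite F"
    let ?P = "blinfun_apply (proj_ell2 F)"
    have "cinner (?P f) (?P f) = cinner (?P f) f"
      unfolding cinner_ell2.rep_eq by (rule infsum_cong) (simp add: proj_ell2_apply)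
    then have "Re (cinner (?P f) f) = (norm (?P f))\<^sup>2"
      by (metis Re_complex_of_real cinner_self)
    then show "(norm f)\<^sup>2 - (\<Sum>x\<in>F. (cmod (ell2_apply f x))\<^sup>2) = (norm (?P f - f))\<^sup>2"
      using F norm_proj_ell2_sq[of F f] by (simp add: norm_diff_sq)
  qed auto
  ultimately have "((\<lambda>F. (norm (blinfun_apply (proj_ell2 F) f - f))\<^sup>2) \<longlongrightarrow> 0) (finite_subsets_at_top UNIV)"
    by (rule Lim_transform_eventually)
  then have "((\<lambda>F. norm (blinfun_apply (proj_ell2 F) f - f)) \<longlongrightarrow> 0) (finite_subsets_at_top UNIV)"
    using tendsto_real_sqrt[of _ 0] by fastforce
  then show ?thesis
    by (simp add: tendsto_norm_zero_iff flip: LIM_zero_iff[of _ f])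
qed

text \<open>Finite combinations are dense. Agreement is required on complex combinations and not
  just on each \<open>ket x\<close>, because \<open>bounded_linear\<close> asserts real linearity
  only.\<close>

lemma ell2_continuous_eqI:
  fixes A B :: "'a ell2 \<Rightarrow> 'b::real_normed_vector"
  assumes A: "bounded_linear A" and B: "bounded_linear B"
    and eq: "\<And>F p. finite F \<Longrightarrow> A (\<Sum>x\<in>F. p x *\<^sub>C ket x) = B (\<Sum>x\<in>F. p x *\<^sub>C ket x)"
  shows "A f = B f"
proof -
  have "((\<lambda>F. A (blinfun_apply (proj_ell2 F) f)) \<longlongrightarrow> A f) (finite_subsets_at_top UNIV)"
    by (rule bounded_linear.tendsto[OF A proj_ell2_tendsto])
  moreover have "((\<lambda>F. B (blinfun_apply (proj_ell2 F) f)) \<longlongrightarrow> B f) (finite_subsets_at_top UNIV)"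
    by (rule bounded_linear.tendsto[OF B proj_ell2_tendsto])
  then have "((\<lambda>F. A (blinfun_apply (proj_ell2 F) f)) \<longlongrightarrow> B f) (finite_subsets_at_top UNIV)"
    by (rule Lim_transform_eventually)
      (auto intro!: eventually_finite_subsets_at_top_weakI simp: proj_ell2_finite eq)
  ultimately show ?thesis
    by (intro tendsto_unique) auto
qed

text \<open>The operator is obtained as the adjoint of \<open>h \<mapsto> (\<langle>h, w x\<rangle>)\<^sub>x\<close>, whose values are square
  summable by duality.\<close>

lemma ell2_operator_exists:
  fixes w :: "'a \<Rightarrow> 'a ell2"
  assumes w: "\<And>F p. finite F \<Longrightarrow> norm (\<Sum>x\<in>F. p x *\<^sub>C w x) \<le> B * L2_set (\<lambda>x. cmod (p x)) F"
  shows "\<exists>T. complex_linear T \<and> (\<forall>x. blinfun_apply T (ket x) = w x)"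
proof -
  have L2: "L2_set (\<lambda>x. cmod (cinner h (w x))) F \<le> norm h * B" if "finite F" for F h
  proof -
    let ?L = "L2_set (\<lambda>x. cmod (cinner h (w x))) F"
    \<comment> \<open>The coefficients are the pairings themselves, so that
      \<open>cinner h ?g\<close> equals the square of \<open>?L\<close> and one factor
      \<open>?L\<close> can be cancelled at the end.\<close>
    let ?g = "\<Sum>x\<in>F. cinner h (w x) *\<^sub>C w x"
    have "complex_of_real (?L\<^sup>2) = cinner h ?g"
      by (simp only: L2_set_power2 of_real_sum complex_norm_square cinner_sum_right cinner_scaleC_right mult.commute)
    then have "?L\<^sup>2 = cmod (cinner h ?g)"
      by (metis norm_of_real abs_of_nonneg zero_le_power2)
    also have "\<dots> \<le> norm h * norm ?g"
      by (rule cauchy_schwarz)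
    also have "\<dots> \<le> norm h * (B * ?L)"
      by (intro mult_left_mono w that) simp
    finally have "?L * ?L \<le> (norm h * B) * ?L"
      by (simp add: power2_eq_square mult.assoc)
    moreover have "0 \<le> B"
    proof -
      have "0 \<le> norm (w undefined)"
        by simp
      also have "\<dots> \<le> B"
        using w[of "{undefined}" "\<lambda>_. 1"] by (simp add: scaleC_one)
      finally show ?thesis .
    qed
    ultimately show ?thesis
      by (cases "?L = 0") (auto simp: mult_le_cancel_right L2_set_nonneg order_less_le)
  qed
  define S where "S h = Abs_ell2 (\<lambda>x. cinner h (w x))" for h
  have S: "ell2_apply (S h) x = cinner h (w x)" for h x
    unfolding S_def by (subst Abs_ell2_inverse) (auto intro: square_summableI L2)
  have "bounded_linear S"
  proof (rule bounded_linear_intro[where K = B])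
    show "norm (S h) \<le> norm h * B" for h
      by (rule norm_ell2_le) (simp add: S L2)
  qed (rule ell2_eqI, simp add: S ell2_simps scaleR_scaleC cinner_add_left cinner_scaleC_left)+
  then have appS: "blinfun_apply (Blinfun S) = S"
    by (rule bounded_linear_Blinfun_apply)
  have lin: "complex_linear (Blinfun S)"
    unfolding complex_linear_def appS
    by (intro allI ell2_eqI) (simp add: S ell2_simps cinner_scaleC_left)
  have "blinfun_apply (op_adjoint (Blinfun S)) (ket x) = w x" for x
    by (rule cinner_ext) (simp add: cinner_op_adjoint[OF lin, symmetric] appS cinner_ket S)
  then show ?thesis
    using complex_linear_op_adjoint[OF lin] by blast
qed

subsection \<open>Essential norms on square summable families\<close>

text \<open>Puts the operator norm into the shape of \<open>H2_op_norm\<close>, a supremum over the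
  closed unit ball.\<close>

lemma norm_blinfun_eq_SUP:
  "norm A = (SUP x\<in>cball 0 1. norm (blinfun_apply A x))"
proof (rule antisym)
  have bdd: "bdd_above ((\<lambda>x. norm (blinfun_apply A x)) ` cball 0 1)"
  proof (rule bdd_aboveI2[where M = "norm A"])
    show "norm (blinfun_apply A x) \<le> norm A" if "x \<in> cball 0 1" for x
      using that norm_blinfun[of A x] mult_left_le[of "norm x" "norm A"] by simp
  qed
  show "norm A \<le> (SUP x\<in>cball 0 1. norm (blinfun_apply A x))"
  proof (rule norm_blinfun_bound)
    have "norm (blinfun_apply A 0) \<le> (SUP x\<in>cball 0 1. norm (blinfun_apply A x))"
      by (rule cSUP_upper2[OF bdd, of 0]) auto
    then show "0 \<le> (SUP x\<in>cball 0 1. norm (blinfun_apply A x))"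
      by simp
    show "norm (blinfun_apply A x) \<le> (SUP x\<in>cball 0 1. norm (blinfun_apply A x)) * norm x" for x
    proof (cases "x = 0")
      case False
      have "norm (blinfun_apply A (x /\<^sub>R norm x)) \<le> (SUP x\<in>cball 0 1. norm (blinfun_apply A x))"
        by (rule cSUP_upper[OF _ bdd]) (use False in simp)
      then show ?thesis
        using False by (simp add: blinfun.scaleR_right divide_simps mult.commute)
    qed simp
  qed
  show "(SUP x\<in>cball 0 1. norm (blinfun_apply A x)) \<le> norm A"
  proof (rule cSUP_least)
    show "norm (blinfun_apply A x) \<le> norm A" if "x \<in> cball 0 1" for x
      using that norm_blinfun[of A x] mult_left_le[of "norm x" "norm A"] by simp
  qed simp
qed

lemma op_adjoint_compose:
  assumes "complex_linear A" "complex_linear B"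
  shows "op_adjoint (A o\<^sub>L B) = op_adjoint B o\<^sub>L op_adjoint A"
proof (rule blinfun_eqI, rule cinner_ext)
  show "cinner z (blinfun_apply (op_adjoint (A o\<^sub>L B)) x)
      = cinner z (blinfun_apply (op_adjoint B o\<^sub>L op_adjoint A) x)" for x z
    using assms
    by (simp add: cinner_op_adjoint[symmetric] complex_linear_compose)
qed

lemma op_adjoint_proj_ell2: "op_adjoint (proj_ell2 S) = proj_ell2 S"
  by (rule blinfun_eqI, rule cinner_ext)
    (simp add: cinner_op_adjoint[OF complex_linear_proj_ell2, symmetric] cinner_proj_ell2)

lemma infsum_tail_eq_norm:
  fixes T :: "'a ell2 operator"
  assumes T: "complex_linear T"
  shows "(\<Sum>\<^sub>\<infinity>x\<in>S. (cmod (cinner f (blinfun_apply T (ket x))))\<^sup>2)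
    = (norm (blinfun_apply (proj_ell2 S) (blinfun_apply (op_adjoint T) f)))\<^sup>2"
proof -
  have "cmod (cinner f (blinfun_apply T (ket x)))
      = cmod (ell2_apply (blinfun_apply (op_adjoint T) f) x)" for x
    by (metis cinner_commute cinner_ket cinner_op_adjoint[OF T] complex_mod_cnj)
  then show ?thesis
    by (simp only: norm_proj_ell2_sq)
qed

lemma SUP_tail_eq_norm:
  fixes T :: "'a ell2 operator"
  assumes T: "complex_linear T"
  shows "(SUP f\<in>cball 0 1. sqrt (\<Sum>\<^sub>\<infinity>x\<in>S. (cmod (cinner f (blinfun_apply T (ket x))))\<^sup>2))
    = norm (T o\<^sub>L proj_ell2 S)"
proof -
  have "sqrt (\<Sum>\<^sub>\<infinity>x\<in>S. (cmod (cinner f (blinfun_apply T (ket x))))\<^sup>2)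
      = norm (blinfun_apply (op_adjoint (T o\<^sub>L proj_ell2 S)) f)" for f
    by (simp add: infsum_tail_eq_norm[OF T] op_adjoint_compose T complex_linear_proj_ell2
        op_adjoint_proj_ell2)
  then have "(SUP f\<in>cball 0 1. sqrt (\<Sum>\<^sub>\<infinity>x\<in>S. (cmod (cinner f (blinfun_apply T (ket x))))\<^sup>2))
      = norm (op_adjoint (T o\<^sub>L proj_ell2 S))"
    unfolding norm_blinfun_eq_SUP[of "op_adjoint _"] by simp
  then show ?thesis
    by (simp add: norm_op_adjoint complex_linear_compose T complex_linear_proj_ell2)
qed

text \<open>The formula for the essential norm has a root and the compactness criterion has none;
  this relates the two suprema. Boundedness is assumed because a real \<open>SUP\<close> over an
  unbounded set is unspecified.\<close>

lemma SUP_square: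
  fixes g :: "'a \<Rightarrow> real"
  assumes S: "S \<noteq> {}" and g: "\<And>x. 0 \<le> g x" and bdd: "bdd_above (g ` S)"
  shows "(SUP x\<in>S. (g x)\<^sup>2) = (SUP x\<in>S. g x)\<^sup>2"
proof (rule antisym)
  have le: "g x \<le> (SUP x\<in>S. g x)" if "x \<in> S" for x
    using that bdd by (rule cSUP_upper)
  then have sq: "(g x)\<^sup>2 \<le> (SUP x\<in>S. g x)\<^sup>2" if "x \<in> S" for x
    using that by (intro power_mono g)
  then show "(SUP x\<in>S. (g x)\<^sup>2) \<le> (SUP x\<in>S. g x)\<^sup>2"
    using S by (intro cSUP_least)
  have bdd2: "bdd_above ((\<lambda>x. (g x)\<^sup>2) ` S)"
    using sq by (rule bdd_aboveI2)
  have "g x \<le> sqrt (SUP x\<in>S. (g x)\<^sup>2)" if "x \<in> S" for x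
    using that by (intro real_le_rsqrt cSUP_upper[OF _ bdd2])
  then have "(SUP x\<in>S. g x) \<le> sqrt (SUP x\<in>S. (g x)\<^sup>2)"
    using S by (intro cSUP_least)
  moreover obtain x where "x \<in> S"
    using S by blast
  then have "0 \<le> (SUP x\<in>S. g x)" "0 \<le> (SUP x\<in>S. (g x)\<^sup>2)"
    using g le cSUP_upper[OF _ bdd2] by (meson order_trans zero_le_power2)+
  ultimately show "(SUP x\<in>S. g x)\<^sup>2 \<le> (SUP x\<in>S. (g x)\<^sup>2)"
    using power_mono[of "SUP x\<in>S. g x" "sqrt (SUP x\<in>S. (g x)\<^sup>2)" 2] by simp
qed

lemma SUP_tail_sq_eq_norm:
  fixes T :: "'a ell2 operator"
  assumes T: "complex_linear T"
  shows "(SUP f\<in>cball 0 1. \<Sum>\<^sub>\<infinity>x\<in>S. (cmod (cinner f (blinfun_apply T (ket x))))\<^sup>2)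
    = (norm (T o\<^sub>L proj_ell2 S))\<^sup>2"
proof -
  let ?g = "\<lambda>f. norm (blinfun_apply (proj_ell2 S) (blinfun_apply (op_adjoint T) f))"
  have "bdd_above (?g ` cball 0 1)"
  proof (rule bdd_aboveI2)
    fix f :: "'a ell2"
    assume "f \<in> cball 0 1"
    then have "norm (op_adjoint T) * norm f \<le> norm (op_adjoint T)"
      by (intro mult_left_le) auto
    then show "?g f \<le> norm (op_adjoint T)"
      by (meson norm_proj_ell2_le norm_blinfun order_trans)
  qed
  then have "(SUP f\<in>cball 0 1. (?g f)\<^sup>2) = (SUP f\<in>cball 0 1. ?g f)\<^sup>2"
    by (intro SUP_square) auto
  then show ?thesis
    using SUP_tail_eq_norm[OF T, of S] by (simp add: infsum_tail_eq_norm[OF T])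
qed

text \<open>Parallel to \<open>H2_compact_op\<close>, so that a homeomorphism of the two spaces
  carries one notion into the other.\<close>

definition compact_operator :: "'a::complex_hilbert operator \<Rightarrow> bool" where
  "compact_operator K \<longleftrightarrow> complex_linear K \<and> compact (closure (blinfun_apply K ` cball 0 1))"

lemma compact_operator_finite_net:
  assumes "compact_operator K" "0 < e"
  shows "\<exists>N. finite N \<and> blinfun_apply K ` cball 0 1 \<subseteq> (\<Union>y\<in>N. ball y e)"
  using assms closure_subset unfolding compact_operator_def compact_eq_totally_bounded
  by (meson order_trans)

lemma proj_ell2_compl_tendsto:
  assumes "filterlim S (finite_subsets_at_top UNIV) sequentially"
  shows "(\<lambda>k. blinfun_apply (proj_ell2 (- S k)) f) \<longlonglongrightarrow> 0"
proof -
  have "(\<lambda>k. f - blinfun_apply (proj_ell2 (S k)) f) \<longlonglongrightarrow> f - f"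
    by (intro tendsto_diff tendsto_const filterlim_compose[OF proj_ell2_tendsto assms])
  moreover have "f - blinfun_apply (proj_ell2 (S k)) f = blinfun_apply (proj_ell2 (- S k)) f" for k
    by (rule ell2_eqI) (simp add: ell2_simps proj_ell2_apply)
  ultimately show ?thesis
    by simp
qed

text \<open>Finitely many \<open>y\<close> approximate the image of the unit ball, and the pairing of
  \<open>K (proj_ell2 (- S k) f)\<close> with each of them is at most the norm of
  \<open>proj_ell2 (- S k) (op_adjoint K y)\<close>.\<close>

lemma compact_operator_tail:
  fixes K :: "'a ell2 operator"
  assumes K: "compact_operator K" and S: "filterlim S (finite_subsets_at_top UNIV) sequentially"
  shows "(\<lambda>k. norm (K o\<^sub>L proj_ell2 (- S k))) \<longlonglongrightarrow> 0"
proof -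
  have lin: "complex_linear K"
    using K by (simp add: compact_operator_def)
  let ?Q = "\<lambda>k. blinfun_apply (proj_ell2 (- S k))"
  show "(\<lambda>k. norm (K o\<^sub>L proj_ell2 (- S k))) \<longlonglongrightarrow> 0"
  proof (rule LIMSEQ_I)
    fix r :: real
    assume "0 < r"
    \<comment> \<open>Chosen to make \<open>(norm K + 1) * e\<close> equal to
      \<open>(r / 2)\<^sup>2\<close>. The part \<open>norm K * e\<close> pays for replacing
      \<open>?g\<close> by a net point in the pairing, the remaining \<open>e\<close> for the
      pairing with that point.\<close>
    define e where "e = r\<^sup>2 / (4 * (norm K + 1))"
    have e_aux: "c * (r\<^sup>2 / (4 * c)) = (r / 2)\<^sup>2" if "c \<noteq> 0" for c
      using that by (simp add: power_divide)
    have nK: "0 < norm K + 1"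
      using norm_ge_zero[of K] by linarith
    then have "0 < e"
      using \<open>0 < r\<close> by (simp add: e_def)
    obtain N where N: "finite N" "blinfun_apply K ` cball 0 1 \<subseteq> (\<Union>y\<in>N. ball y e)"
      using compact_operator_finite_net[OF K \<open>0 < e\<close>] by blast
    have "\<forall>\<^sub>F k in sequentially. \<forall>y\<in>N. norm (?Q k (blinfun_apply (op_adjoint K) y)) < e"
    proof (rule eventually_ball_finite[OF N(1)], rule ballI)
      fix y
      have "(\<lambda>k. norm (?Q k (blinfun_apply (op_adjoint K) y))) \<longlonglongrightarrow> 0"
        by (rule tendsto_norm_zero, rule proj_ell2_compl_tendsto[OF S])
      then show "\<forall>\<^sub>F k in sequentially. norm (?Q k (blinfun_apply (op_adjoint K) y)) < e"
        using \<open>0 < e\<close> by (rule order_tendstoD)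
    qed
    then obtain k0 where k0: "\<And>k y. k \<ge> k0 \<Longrightarrow> y \<in> N \<Longrightarrow> norm (?Q k (blinfun_apply (op_adjoint K) y)) < e"
      by (auto simp: eventually_sequentially)
    have "norm (K o\<^sub>L proj_ell2 (- S k)) < r" if "k \<ge> k0" for k
    proof -
      have "norm (blinfun_apply (K o\<^sub>L proj_ell2 (- S k)) f) \<le> r / 2" if f: "f \<in> cball 0 1" for f
      proof -
        let ?g = "blinfun_apply K (?Q k f)"
        have g1: "norm (?Q k f) \<le> 1"
          using f norm_proj_ell2_le[of "- S k" f] by simp
        then obtain y where y: "y \<in> N" "norm (?g - y) < e"
          using N(2) by (force simp: dist_norm norm_minus_commute)
        have "norm ?g \<le> norm K"
          using norm_blinfun[of K "?Q k f"] mult_left_le[OF g1, of "norm K"] by simp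
        have "complex_of_real ((norm ?g)\<^sup>2) = cinner ?g (?g - y) + cinner ?g y"
          by (simp only: cinner_self[symmetric] cinner_diff_right) simp
        then have "(norm ?g)\<^sup>2 \<le> cmod (cinner ?g (?g - y)) + cmod (cinner ?g y)"
          by (metis norm_of_real abs_of_nonneg zero_le_power2 norm_triangle_ineq)
        moreover have "cmod (cinner ?g (?g - y)) \<le> norm K * e"
          using cauchy_schwarz[of ?g "?g - y"] mult_mono[OF \<open>norm ?g \<le> norm K\<close> less_imp_le[OF y(2)]]
          by simp
        moreover have "cmod (cinner ?g y) \<le> e"
        proof -
          have "cinner ?g y = cinner f (?Q k (blinfun_apply (op_adjoint K) y))"
            by (simp add: cinner_op_adjoint[OF lin] cinner_proj_ell2)
          moreover have "cmod (cinner f (?Q k (blinfun_apply (op_adjoint K) y))) \<le> 1 * e"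
            by (rule order_trans[OF cauchy_schwarz])
              (intro mult_mono less_imp_le[OF k0[OF \<open>k \<ge> k0\<close> y(1)]], use f in auto)
          ultimately show ?thesis
            by simp
        qed
        ultimately have "(norm ?g)\<^sup>2 \<le> (norm K + 1) * e"
          by (simp add: algebra_simps)
        also have "\<dots> = (r / 2)\<^sup>2"
          unfolding e_def by (rule e_aux) (use nK in linarith)
        finally have "norm ?g \<le> r / 2"
          by (rule power2_le_imp_le) (use \<open>0 < r\<close> in simp)
        then show ?thesis
          by simp
      qed
      then have "norm (K o\<^sub>L proj_ell2 (- S k)) \<le> r / 2"
        unfolding norm_blinfun_eq_SUP[of "_ o\<^sub>L _"] by (intro cSUP_least) auto
      then show ?thesis
        using \<open>0 < r\<close> by simp
    qed
    then show "\<exists>k0. \<forall>k\<ge>k0. norm (norm (K o\<^sub>L proj_ell2 (- S k)) - 0) < r"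
      by auto
  qed
qed

text \<open>On the unit ball every coordinate has modulus at most \<open>1\<close>, so the image
  lies in a finite sum of compact discs, one in the direction of each
  \<open>T (ket x)\<close>.\<close>

lemma compact_operator_proj_finite:
  fixes T :: "'a ell2 operator"
  assumes T: "complex_linear T" and F: "finite F"
  shows "compact_operator (T o\<^sub>L proj_ell2 F)"
proof -
  have "\<exists>C. compact C \<and>
      (\<forall>p. (\<forall>x\<in>F. cmod (p x) \<le> 1) \<longrightarrow> (\<Sum>x\<in>F. p x *\<^sub>C blinfun_apply T (ket x)) \<in> C)"
    using F
  proof (induction F)
    case empty
    show ?case
      by (rule exI[of _ "{0}"]) simp
  next
    case (insert x F)
    then obtain C where C: "compact C"
      "\<And>p. \<forall>x\<in>F. cmod (p x) \<le> 1 \<Longrightarrow> (\<Sum>x\<in>F. p x *\<^sub>C blinfun_apply T (ket x)) \<in> C"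
      by blast
    let ?L = "(\<lambda>c. c *\<^sub>C blinfun_apply T (ket x)) ` cball 0 1"
    have "compact ?L"
      by (intro compact_continuous_image linear_continuous_on bounded_linear_scaleC_left) simp_all
    then have "compact {a + b |a b. a \<in> ?L \<and> b \<in> C}"
      using C(1) by (rule compact_sums)
    moreover have "(\<Sum>x\<in>insert x F. p x *\<^sub>C blinfun_apply T (ket x)) \<in> {a + b |a b. a \<in> ?L \<and> b \<in> C}"
      if p: "\<forall>x\<in>insert x F. cmod (p x) \<le> 1" for p
    proof -
      have "p x *\<^sub>C blinfun_apply T (ket x) \<in> ?L"
        using p by auto
      moreover have "(\<Sum>x\<in>F. p x *\<^sub>C blinfun_apply T (ket x)) \<in> C"
        using p by (intro C(2)) simp
      ultimately show ?thesis
        unfolding sum.insert[OF insert.hyps] by blast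
    qed
    ultimately show ?case
      by blast
  qed
  then obtain C where C: "compact C"
    "\<And>p. \<forall>x\<in>F. cmod (p x) \<le> 1 \<Longrightarrow> (\<Sum>x\<in>F. p x *\<^sub>C blinfun_apply T (ket x)) \<in> C"
    by blast
  have "blinfun_apply (T o\<^sub>L proj_ell2 F) f \<in> C" if "f \<in> cball 0 1" for f
  proof -
    have "blinfun_apply (T o\<^sub>L proj_ell2 F) f = (\<Sum>x\<in>F. ell2_apply f x *\<^sub>C blinfun_apply T (ket x))"
      using T by (simp add: proj_ell2_finite[OF F] blinfun.sum_right complex_linear_def)
    moreover have "cmod (ell2_apply f x) \<le> 1" for x
      using that cmod_ell2_apply_le[of f x] by simp
    ultimately show ?thesis
      using C(2) by simp
  qed
  then have "closure (blinfun_apply (T o\<^sub>L proj_ell2 F) ` cball 0 1) \<subseteq> C"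
    by (intro closure_minimal compact_imp_closed C(1)) auto
  then have "compact (closure (blinfun_apply (T o\<^sub>L proj_ell2 F) ` cball 0 1))"
    using C(1) by (metis compact_Int_closed closed_closure inf.absorb_iff2)
  then show ?thesis
    unfolding compact_operator_def by (simp add: T complex_linear_compose complex_linear_proj_ell2)
qed

text \<open>A finite net for the image under a nearby \<open>K k\<close> serves for \<open>T\<close>
  as well. The three thirds of \<open>e\<close> pay for the net, for the distance of
  \<open>T\<close> to \<open>K k\<close>, and for passing to the closure.\<close>

lemma compact_operator_limit:
  fixes T :: "'a::complex_hilbert operator"
  assumes T: "complex_linear T"
    and K: "\<And>k. compact_operator (K k)" "(\<lambda>k. norm (T - K k)) \<longlonglongrightarrow> 0"
  shows "compact_operator T"
proof -
  have net: "\<exists>N. finite N \<and> closure (blinfun_apply T ` cball 0 1) \<subseteq> (\<Union>y\<in>N. ball y e)" if "0 < e" for e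
  proof -
    have "\<forall>\<^sub>F k in sequentially. norm (T - K k) < e / 3"
      using K(2) by (rule order_tendstoD) (use that in simp)
    then obtain k where k: "norm (T - K k) < e / 3"
      by (auto simp: eventually_sequentially)
    obtain N where N: "finite N" "blinfun_apply (K k) ` cball 0 1 \<subseteq> (\<Union>y\<in>N. ball y (e / 3))"
      using compact_operator_finite_net[OF K(1), of "e / 3" k] \<open>0 < e\<close> by auto
    have "z \<in> (\<Union>y\<in>N. ball y e)" if z: "z \<in> closure (blinfun_apply T ` cball 0 1)" for z
    proof -
      obtain x where x: "x \<in> cball 0 1" "dist (blinfun_apply T x) z < e / 3"
        using z \<open>0 < e\<close> unfolding closure_approachable by (metis (no_types, lifting) imageE zero_less_divide_iff zero_less_numeral)
      obtain y where y: "y \<in> N" "dist y (blinfun_apply (K k) x) < e / 3"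
        using N(2) x(1) by fastforce
      have "dist (blinfun_apply (K k) x) (blinfun_apply T x) \<le> norm (T - K k)"
        using norm_blinfun[of "T - K k" x] mult_left_le[of "norm x" "norm (T - K k)"] x(1)
        by (simp add: dist_norm norm_minus_commute minus_blinfun.rep_eq)
      then have "dist y z < e"
        using k x(2) y(2) dist_triangle[of y z "blinfun_apply (K k) x"]
          dist_triangle[of "blinfun_apply (K k) x" z "blinfun_apply T x"] by linarith
      then show ?thesis
        using y(1) by auto
    qed
    then show ?thesis
      using N(1) by blast
  qed
  have "complete (closure (blinfun_apply T ` cball 0 1))"
    by (simp add: complete_eq_closed)
  with net have "compact (closure (blinfun_apply T ` cball 0 1))"
    unfolding compact_eq_totally_bounded by blast
  then show ?thesis
    using T by (simp add: compact_operator_def)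
qed

theorem essential_norm_ell2:
  fixes T :: "'a ell2 operator"
  assumes T: "complex_linear T"
    and S: "\<And>k. finite (S k)" "filterlim S (finite_subsets_at_top UNIV) sequentially"
  shows "(\<lambda>k. norm (T o\<^sub>L proj_ell2 (- S k))) \<longlonglongrightarrow> (INF K\<in>Collect compact_operator. norm (T - K))"
    and "compact_operator T \<longleftrightarrow> (\<lambda>k. norm (T o\<^sub>L proj_ell2 (- S k))) \<longlonglongrightarrow> 0"
proof -
  let ?E = "INF K\<in>Collect compact_operator. norm (T - K)"
  have split: "T - (T o\<^sub>L proj_ell2 (S k)) = T o\<^sub>L proj_ell2 (- S k)" for k
  proof (rule blinfun_eqI)
    fix f :: "'a ell2"
    have "f - blinfun_apply (proj_ell2 (S k)) f = blinfun_apply (proj_ell2 (- S k)) f"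
      by (rule ell2_eqI) (simp add: ell2_simps proj_ell2_apply)
    then show "blinfun_apply (T - (T o\<^sub>L proj_ell2 (S k))) f = blinfun_apply (T o\<^sub>L proj_ell2 (- S k)) f"
      by (metis blinfun.diff_right blinfun_apply_blinfun_compose minus_blinfun.rep_eq)
  qed
  have compact_S: "compact_operator (T o\<^sub>L proj_ell2 (S k))" for k
    by (intro compact_operator_proj_finite T S)
  have bdd: "bdd_below ((\<lambda>K. norm (T - K)) ` Collect compact_operator)"
    by (rule bdd_belowI2[of _ 0]) simp
  have lower: "?E \<le> norm (T o\<^sub>L proj_ell2 (- S k))" for k
    unfolding split[symmetric] using compact_S bdd by (intro cINF_lower) auto
  have upper: "norm (T o\<^sub>L proj_ell2 (- S k)) \<le> norm (T - K) + norm (K o\<^sub>L proj_ell2 (- S k))" for K k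
  proof -
    have "T o\<^sub>L proj_ell2 (- S k) = ((T - K) o\<^sub>L proj_ell2 (- S k)) + (K o\<^sub>L proj_ell2 (- S k))"
      by (rule blinfun_eqI) (simp add: minus_blinfun.rep_eq plus_blinfun.rep_eq)
    moreover have "norm ((T - K) o\<^sub>L proj_ell2 (- S k)) \<le> norm (T - K)"
    proof (rule norm_blinfun_bound)
      show "norm (blinfun_apply ((T - K) o\<^sub>L proj_ell2 (- S k)) f) \<le> norm (T - K) * norm f" for f
        using norm_blinfun[of "T - K" "blinfun_apply (proj_ell2 (- S k)) f"]
          mult_left_mono[OF norm_proj_ell2_le[of "- S k" f], of "norm (T - K)"] by simp
    qed simp
    ultimately show ?thesis
      using norm_triangle_ineq[of "(T - K) o\<^sub>L proj_ell2 (- S k)" "K o\<^sub>L proj_ell2 (- S k)"] by simp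
  qed
  show lim: "(\<lambda>k. norm (T o\<^sub>L proj_ell2 (- S k))) \<longlonglongrightarrow> ?E"
  proof (rule order_tendstoI)
    fix a
    assume "a < ?E"
    then show "\<forall>\<^sub>F k in sequentially. a < norm (T o\<^sub>L proj_ell2 (- S k))"
      using lower by (simp add: less_le_trans)
  next
    fix a
    assume "?E < a"
    then obtain K where K: "compact_operator K" "norm (T - K) < a"
      using cINF_less_iff[OF _ bdd, of a] compact_S by auto
    have "\<forall>\<^sub>F k in sequentially. norm (K o\<^sub>L proj_ell2 (- S k)) < a - norm (T - K)"
      using compact_operator_tail[OF K(1) S(2)] by (rule order_tendstoD) (use K(2) in simp)
    then show "\<forall>\<^sub>F k in sequentially. norm (T o\<^sub>L proj_ell2 (- S k)) < a"
      by eventually_elim (use upper[of _ K] in \<open>smt (verit)\<close>)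
  qed
  \<comment> \<open>If the tails vanish, \<open>T\<close> is the norm limit of the finite rank
    operators \<open>T o\<^sub>L proj_ell2 (S k)\<close>; conversely the tails of any compact
    operator vanish.\<close>
  show "compact_operator T \<longleftrightarrow> (\<lambda>k. norm (T o\<^sub>L proj_ell2 (- S k))) \<longlonglongrightarrow> 0"
  proof
    assume "(\<lambda>k. norm (T o\<^sub>L proj_ell2 (- S k))) \<longlonglongrightarrow> 0"
    then show "compact_operator T"
      by (intro compact_operator_limit[OF T compact_S]) (simp add: split)
  qed (rule compact_operator_tail[OF _ S(2)])
qed

subsection \<open>Evaluation of power series on the noncommutative ball\<close>

lemma sum_words_Cons:
  fixes g :: "'n::finite list \<Rightarrow> 'b::comm_monoid_add"
  assumes "finite S"
  shows "sum g {i # \<alpha> |i \<alpha>. \<alpha> \<in> S} = (\<Sum>i\<in>UNIV. \<Sum>\<alpha>\<in>S. g (i # \<alpha>))"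
proof -
  have "(\<Sum>i\<in>UNIV. \<Sum>\<alpha>\<in>S. g (i # \<alpha>)) = (\<Sum>(i, \<alpha>)\<in>UNIV \<times> S. g (i # \<alpha>))"
    by (rule sum.cartesian_product)
  also have "\<dots> = sum g {i # \<alpha> |i \<alpha>. \<alpha> \<in> S}"
    by (rule sum.reindex_bij_witness[where i = "\<lambda>\<beta>. (hd \<beta>, tl \<beta>)" and j = "\<lambda>(i, \<alpha>). i # \<alpha>"]) auto
  finally show ?thesis ..
qed

lemma finite_words_eq: "finite {\<alpha> :: 'n::finite list. length \<alpha> = k}"
  using finite_lists_length_eq[of "UNIV :: 'n set" k] by simp

lemma finite_words_less: "finite {\<alpha> :: 'n::finite list. length \<alpha> < k}"
  by (rule finite_subset[OF _ finite_lists_length_le[of "UNIV :: 'n set" k]]) auto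

lemma finite_words_le: "finite {\<alpha> :: 'n::finite list. length \<alpha> \<le> k}"
  using finite_lists_length_le[of "UNIV :: 'n set" k] by simp

lemma sum_words_Suc:
  fixes g :: "'n::finite list \<Rightarrow> 'b::comm_monoid_add"
  shows "(\<Sum>\<alpha> | length \<alpha> = Suc k. g \<alpha>) = (\<Sum>i\<in>UNIV. \<Sum>\<alpha> | length \<alpha> = k. g (i # \<alpha>))"
proof -
  have "{\<alpha> :: 'n list. length \<alpha> = Suc k} = {i # \<alpha> |i \<alpha>. \<alpha> \<in> {\<alpha>. length \<alpha> = k}}"
    by (auto simp: length_Suc_conv)
  then show ?thesis
    by (simp only: sum_words_Cons[OF finite_words_eq])
qed

lemma sum_words_less_Suc:
  fixes g :: "'n::finite list \<Rightarrow> 'b::comm_monoid_add"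
  shows "(\<Sum>\<alpha> | length \<alpha> < Suc k. g \<alpha>) = g [] + (\<Sum>i\<in>UNIV. \<Sum>\<alpha> | length \<alpha> < k. g (i # \<alpha>))"
proof -
  have "{\<alpha> :: 'n list. length \<alpha> < Suc k} = insert [] {i # \<alpha> |i \<alpha>. \<alpha> \<in> {\<alpha>. length \<alpha> < k}}"
  proof (rule set_eqI)
    show "\<alpha> \<in> {\<alpha> :: 'n list. length \<alpha> < Suc k} \<longleftrightarrow> \<alpha> \<in> insert [] {i # \<alpha> |i \<alpha>. \<alpha> \<in> {\<alpha>. length \<alpha> < k}}" for \<alpha>
      by (cases \<alpha>) auto
  qed
  moreover have "finite {i # \<alpha> |i \<alpha>. \<alpha> \<in> {\<alpha> :: 'n list. length \<alpha> < k}}"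
    by (rule finite_subset[OF _ finite_words_less[of "Suc k"]]) auto
  ultimately show ?thesis
    by (simp only: sum_words_Cons[OF finite_words_less] sum.insert) (simp add: sum_words_Cons[OF finite_words_less, symmetric])
qed

lemma sum_words_by_length:
  fixes g :: "'n::finite list \<Rightarrow> 'b::comm_monoid_add"
  shows "(\<Sum>j<k. \<Sum>\<alpha> | length \<alpha> = j. g \<alpha>) = (\<Sum>\<alpha> | length \<alpha> < k. g \<alpha>)"
proof -
  have "(\<Sum>j<k. \<Sum>\<alpha> | \<alpha> \<in> {\<alpha>. length \<alpha> < k} \<and> length \<alpha> = j. g \<alpha>) = (\<Sum>\<alpha> | length \<alpha> < k. g \<alpha>)"
    by (rule sum.group) (auto simp: finite_words_less)
  moreover have "{\<alpha> \<in> {\<alpha> :: 'n list. length \<alpha> < k}. length \<alpha> = j} = {\<alpha>. length \<alpha> = j}" if "j < k" for j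
    using that by auto
  ultimately show ?thesis
    by simp
qed

lemma filterlim_words_less:
  "filterlim (\<lambda>k. {\<alpha> :: 'n::finite list. length \<alpha> < k}) (finite_subsets_at_top UNIV) sequentially"
  unfolding filterlim_finite_subsets_at_top
proof (intro allI impI)
  fix F :: "'n list set"
  assume F: "finite F \<and> F \<subseteq> UNIV"
  show "\<forall>\<^sub>F k in sequentially. finite {\<alpha> :: 'n list. length \<alpha> < k} \<and> F \<subseteq> {\<alpha>. length \<alpha> < k}
      \<and> {\<alpha> :: 'n list. length \<alpha> < k} \<subseteq> UNIV"
    using eventually_gt_at_top[of "Max (length ` F)"]
  proof eventually_elim
    case (elim k)
    have "length \<alpha> < k" if "\<alpha> \<in> F" for \<alpha>
    proof -
      have "length \<alpha> \<le> Max (length ` F)"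
        using F that by (intro Max_ge) auto
      then show ?thesis
        using elim by linarith
    qed
    then show ?case
      by (auto simp: finite_words_less)
  qed
qed

lemma mult_self_le_imp_le:
  fixes a b :: real
  assumes "a * a \<le> a * b" "0 \<le> a" "0 \<le> b"
  shows "a \<le> b"
proof (cases "a = 0")
  case False
  with assms(2) have "0 < a"
    by linarith
  with assms(1) show ?thesis
    by (simp only: mult_le_cancel_left_pos)
qed (use assms in simp)

lemma square_eq_cmod: "complex_of_real (r\<^sup>2) = z \<Longrightarrow> r\<^sup>2 = cmod z"
  by (metis norm_of_real abs_of_nonneg zero_le_power2)

text \<open>The row \<open>(X\<^sub>1, \<dots>, X\<^sub>n)\<close>, as an operator from the direct
  sum of \<open>n\<close> copies of the space, has norm at most \<rho>. Phrasing it with tuples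
  avoids forming the direct sum.\<close>

definition row_bound :: "('n::finite \<Rightarrow> 'h::complex_hilbert operator) \<Rightarrow> real \<Rightarrow> bool" where
  "row_bound X \<rho> \<longleftrightarrow>
     (\<forall>x. norm (\<Sum>i\<in>UNIV. blinfun_apply (X i) (x i)) \<le> \<rho> * L2_set (\<lambda>i. norm (x i)) UNIV)"

lemma row_boundD:
  "row_bound X \<rho> \<Longrightarrow>
    norm (\<Sum>i\<in>UNIV. blinfun_apply (X i) (x i)) \<le> \<rho> * L2_set (\<lambda>i. norm (x i)) UNIV"
  by (simp add: row_bound_def)

text \<open>Together with \<open>nc_ballD\<close> this is the identity
  \<open>norm (R o\<^sub>L op_adjoint R) = (norm R)\<^sup>2\<close> for the row operator
  \<open>R\<close>, with the adjoint column written out in components.\<close>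

lemma nc_ballI:
  fixes X :: "'n::finite \<Rightarrow> 'h::complex_hilbert operator"
  assumes lin: "\<And>i. complex_linear (X i)" and row: "row_bound X \<rho>" and \<rho>: "0 \<le> \<rho>" "\<rho> < 1"
  shows "X \<in> nc_ball"
proof -
  let ?R = "\<Sum>i\<in>UNIV. X i o\<^sub>L op_adjoint (X i)"
  have "norm ?R \<le> \<rho>\<^sup>2"
  proof (rule norm_blinfun_bound)
    fix y
    let ?z = "blinfun_apply ?R y"
    let ?L = "L2_set (\<lambda>i. norm (blinfun_apply (op_adjoint (X i)) y)) UNIV"
    have z: "?z = (\<Sum>i\<in>UNIV. blinfun_apply (X i) (blinfun_apply (op_adjoint (X i)) y))"
      by (simp add: blinfun.sum_left)
    have "complex_of_real (?L\<^sup>2) = cinner ?z y"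
      by (simp only: z L2_set_power2 cinner_sum_left cinner_op_adjoint[OF lin] of_real_sum cinner_self)
    then have "?L\<^sup>2 = cmod (cinner ?z y)"
      by (rule square_eq_cmod)
    then have L: "?L\<^sup>2 \<le> norm ?z * norm y"
      by (simp add: cauchy_schwarz)
    have "norm ?z \<le> \<rho> * ?L"
      unfolding z by (rule row_boundD[OF row])
    then have "(norm ?z)\<^sup>2 \<le> \<rho>\<^sup>2 * ?L\<^sup>2"
      using power_mono[of "norm ?z" "\<rho> * ?L" 2] by (simp add: power_mult_distrib)
    also have "\<dots> \<le> \<rho>\<^sup>2 * (norm ?z * norm y)"
      by (intro mult_left_mono L) simp
    finally have "norm ?z * norm ?z \<le> norm ?z * (\<rho>\<^sup>2 * norm y)"
      by (simp add: power2_eq_square mult_ac)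
    then show "norm ?z \<le> \<rho>\<^sup>2 * norm y"
      by (rule mult_self_le_imp_le) simp_all
  qed simp
  moreover have "\<rho>\<^sup>2 < 1"
    using \<rho> by (simp add: abs_square_less_1)
  ultimately show ?thesis
    by (simp add: nc_ball_def lin)
qed

lemma nc_ballD:
  fixes X :: "'n::finite \<Rightarrow> 'h::complex_hilbert operator"
  assumes X: "X \<in> nc_ball"
  shows "complex_linear (X i)" and "\<exists>\<rho>. 0 < \<rho> \<and> \<rho> < 1 \<and> row_bound X \<rho>"
proof -
  let ?R = "\<Sum>i\<in>UNIV. X i o\<^sub>L op_adjoint (X i)"
  have lin: "\<And>i. complex_linear (X i)" and R: "sqrt (norm ?R) < 1"
    using X by (simp_all add: nc_ball_def)
  show "complex_linear (X i)"
    by (rule lin)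
  \<comment> \<open>The lower bound \<open>1/2\<close> keeps \<rho> positive when the row vanishes,
    as powers of \<rho> occur later as denominators.\<close>
  define \<rho> where "\<rho> = max (sqrt (norm ?R)) (1/2)"
  have \<rho>: "0 < \<rho>" "\<rho> < 1" "sqrt (norm ?R) \<le> \<rho>"
    using R by (auto simp: \<rho>_def)
  have "row_bound X \<rho>"
    unfolding row_bound_def
  proof (rule allI)
    fix x
    let ?z = "\<Sum>i\<in>UNIV. blinfun_apply (X i) (x i)"
    let ?L = "L2_set (\<lambda>i. norm (blinfun_apply (op_adjoint (X i)) ?z)) UNIV"
    have "complex_of_real (?L\<^sup>2) = cinner (blinfun_apply ?R ?z) ?z"
      by (simp only: L2_set_power2 blinfun.sum_left cinner_sum_left of_real_sum cinner_self[symmetric]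
          blinfun_apply_blinfun_compose cinner_op_adjoint[OF lin])
    then have "?L\<^sup>2 = cmod (cinner (blinfun_apply ?R ?z) ?z)"
      by (rule square_eq_cmod)
    also have "\<dots> \<le> norm ?R * norm ?z * norm ?z"
      by (meson cauchy_schwarz norm_blinfun mult_right_mono norm_ge_zero order_trans)
    also have "\<dots> = (sqrt (norm ?R) * norm ?z)\<^sup>2"
      by (simp add: power_mult_distrib) (simp add: power2_eq_square)
    finally have "?L \<le> sqrt (norm ?R) * norm ?z"
      by (rule power2_le_imp_le) simp
    also have "\<dots> \<le> \<rho> * norm ?z"
      by (intro mult_right_mono \<rho>) simp
    finally have L: "?L \<le> \<rho> * norm ?z" .
    have "(norm ?z)\<^sup>2 = cmod (cinner ?z ?z)"
      by (simp add: cinner_self norm_power)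
    also have "\<dots> \<le> (\<Sum>i\<in>UNIV. \<bar>norm (x i)\<bar> * \<bar>norm (blinfun_apply (op_adjoint (X i)) ?z)\<bar>)"
      unfolding cinner_sum_left cinner_op_adjoint[OF lin]
      by (rule order_trans[OF norm_sum sum_mono]) (simp add: cauchy_schwarz)
    also have "\<dots> \<le> L2_set (\<lambda>i. norm (x i)) UNIV * ?L"
      by (rule L2_set_mult_ineq)
    also have "\<dots> \<le> L2_set (\<lambda>i. norm (x i)) UNIV * (\<rho> * norm ?z)"
      by (intro mult_left_mono L) (simp add: L2_set_nonneg)
    finally have "norm ?z * norm ?z \<le> norm ?z * (\<rho> * L2_set (\<lambda>i. norm (x i)) UNIV)"
      by (simp add: power2_eq_square mult_ac)
    then show "norm ?z \<le> \<rho> * L2_set (\<lambda>i. norm (x i)) UNIV"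
      by (rule mult_self_le_imp_le) (use \<rho>(1) in \<open>simp_all add: L2_set_nonneg\<close>)
  qed
  with \<rho> show "\<exists>\<rho>. 0 < \<rho> \<and> \<rho> < 1 \<and> row_bound X \<rho>"
    by blast
qed

lemma zero_in_nc_ball: "(\<lambda>_. 0) \<in> nc_ball"
  by (rule nc_ballI[where \<rho> = 0]) (simp_all add: complex_linear_def row_bound_def)

lemma complex_linear_word_prod:
  "(\<And>i. complex_linear (X i)) \<Longrightarrow> complex_linear (word_prod X \<alpha>)"
  by (induction \<alpha>) (simp_all add: complex_linear_compose, simp add: complex_linear_def)

lemma word_prod_append: "word_prod X (\<alpha> @ \<beta>) = word_prod X \<alpha> o\<^sub>L word_prod X \<beta>"
  by (induction \<alpha>) (auto intro: blinfun_eqI)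

text \<open>Peeling off the first letter costs one factor \<rho>, irrespective of the number of
  words. Hence square summable coefficients give a geometrically dominated series.\<close>

lemma row_bound_words:
  fixes X :: "'n::finite \<Rightarrow> 'h::complex_hilbert operator"
  assumes row: "row_bound X \<rho>" and \<rho>: "0 \<le> \<rho>"
  shows "norm (\<Sum>\<alpha> | length \<alpha> = k. blinfun_apply (word_prod X \<alpha>) (x \<alpha>))
    \<le> \<rho> ^ k * L2_set (\<lambda>\<alpha>. norm (x \<alpha>)) {\<alpha>. length \<alpha> = k}"
proof (induction k arbitrary: x)
  case 0
  show ?case
    by (simp add: L2_set_def)
next
  case (Suc k)
  let ?W = "{\<alpha> :: 'n list. length \<alpha> = k}"
  have split: "(\<Sum>\<alpha> | length \<alpha> = Suc k. blinfun_apply (word_prod X \<alpha>) (x \<alpha>))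
      = (\<Sum>i\<in>UNIV. blinfun_apply (X i) (\<Sum>\<alpha>\<in>?W. blinfun_apply (word_prod X \<alpha>) (x (i # \<alpha>))))"
    by (simp add: sum_words_Suc blinfun.sum_right)
  have "norm (\<Sum>\<alpha> | length \<alpha> = Suc k. blinfun_apply (word_prod X \<alpha>) (x \<alpha>))
      \<le> \<rho> * L2_set (\<lambda>i. norm (\<Sum>\<alpha>\<in>?W. blinfun_apply (word_prod X \<alpha>) (x (i # \<alpha>)))) UNIV"
    unfolding split by (rule row_boundD[OF row])
  also have "\<dots> \<le> \<rho> * L2_set (\<lambda>i. \<rho> ^ k * L2_set (\<lambda>\<alpha>. norm (x (i # \<alpha>))) ?W) UNIV"
    by (intro mult_left_mono L2_set_mono Suc \<rho>) simp
  also have "\<dots> = \<rho> ^ Suc k * L2_set (\<lambda>i. L2_set (\<lambda>\<alpha>. norm (x (i # \<alpha>))) ?W) UNIV"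
    by (subst L2_set_right_distrib[symmetric]) (simp_all add: \<rho>)
  also have "L2_set (\<lambda>i. L2_set (\<lambda>\<alpha>. norm (x (i # \<alpha>))) ?W) UNIV
      = L2_set (\<lambda>\<alpha>. norm (x \<alpha>)) {\<alpha>. length \<alpha> = Suc k}"
    by (simp only: L2_set_def[of _ UNIV] L2_set_power2) (simp only: L2_set_def sum_words_Suc)
  finally show ?case .
qed

section \<open>Homogeneous parts and evaluation at points of the ball\<close>

definition hom_part :: "('n list \<Rightarrow> complex) \<Rightarrow> nat \<Rightarrow> ('n::finite \<Rightarrow> 'h::complex_hilbert operator) \<Rightarrow> 'h operator" where
  "hom_part a k X = (\<Sum>\<alpha> | length \<alpha> = k. op_scaleC (a \<alpha>) (word_prod X \<alpha>))"

definition free_eval :: "('n list \<Rightarrow> complex) \<Rightarrow> ('n::finite \<Rightarrow> 'h::complex_hilbert operator) \<Rightarrow> 'h operator" where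
  "free_eval a X = (\<Sum>k. hom_part a k X)"

lemma norm_hom_part_le:
  assumes lin: "\<And>i. complex_linear (X i)" and row: "row_bound X \<rho>" and \<rho>: "0 \<le> \<rho>"
  shows "norm (hom_part a k X) \<le> \<rho> ^ k * L2_set (\<lambda>\<alpha>. cmod (a \<alpha>)) {\<alpha>. length \<alpha> = k}"
proof (rule norm_blinfun_bound)
  show "0 \<le> \<rho> ^ k * L2_set (\<lambda>\<alpha>. cmod (a \<alpha>)) {\<alpha>. length \<alpha> = k}"
    using \<rho> by (simp add: L2_set_nonneg)
  fix x
  have expand: "blinfun_apply (hom_part a k X) x = (\<Sum>\<alpha> | length \<alpha> = k. blinfun_apply (word_prod X \<alpha>) (a \<alpha> *\<^sub>C x))"
    using complex_linear_word_prod[of X, OF lin]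
    by (simp add: hom_part_def blinfun.sum_left op_scaleC.rep_eq complex_linear_def)
  have "norm (blinfun_apply (hom_part a k X) x)
      \<le> \<rho> ^ k * L2_set (\<lambda>\<alpha>. norm (a \<alpha> *\<^sub>C x)) {\<alpha>. length \<alpha> = k}"
    unfolding expand by (rule row_bound_words[OF row \<rho>])
  also have "L2_set (\<lambda>\<alpha>. norm (a \<alpha> *\<^sub>C x)) {\<alpha>. length \<alpha> = k}
      = L2_set (\<lambda>\<alpha>. cmod (a \<alpha>)) {\<alpha>. length \<alpha> = k} * norm x"
    by (simp add: norm_scaleC L2_set_left_distrib)
  finally show "norm (blinfun_apply (hom_part a k X) x)
      \<le> \<rho> ^ k * L2_set (\<lambda>\<alpha>. cmod (a \<alpha>)) {\<alpha>. length \<alpha> = k} * norm x"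
    by (simp add: mult.assoc)
qed

lemma norm_hom_part_ell2_le:
  assumes "\<And>i. complex_linear (X i)" "row_bound X \<rho>" "0 \<le> \<rho>"
  shows "norm (hom_part (ell2_apply c) k X) \<le> norm c * \<rho> ^ k"
proof -
  have "norm (hom_part (ell2_apply c) k X)
      \<le> \<rho> ^ k * L2_set (\<lambda>\<alpha>. cmod (ell2_apply c \<alpha>)) {\<alpha>. length \<alpha> = k}"
    by (rule norm_hom_part_le) (use assms in auto)
  also have "\<dots> \<le> \<rho> ^ k * norm c"
    by (intro mult_left_mono L2_set_le_norm_ell2 finite_words_eq) (simp add: assms(3))
  finally show ?thesis
    by (simp add: mult.commute)
qed

lemma summable_hom_part:
  assumes "X \<in> nc_ball"
  shows "summable (\<lambda>k. hom_part (ell2_apply c) k X)"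
proof -
  obtain \<rho> where \<rho>: "0 < \<rho>" "\<rho> < 1" "row_bound X \<rho>"
    using nc_ballD(2)[OF assms] by blast
  have "summable (\<lambda>k. norm c * \<rho> ^ k)"
    using \<rho> by (intro summable_mult summable_geometric) simp
  then show ?thesis
  proof (rule summable_comparison_test'[where N = 0])
    show "norm (hom_part (ell2_apply c) k X) \<le> norm c * \<rho> ^ k" for k
      by (rule norm_hom_part_ell2_le[OF nc_ballD(1)[OF assms] \<rho>(3)]) (use \<rho> in simp)
  qed
qed

lemma free_eval_sums:
  "X \<in> nc_ball \<Longrightarrow> (\<lambda>k. hom_part (ell2_apply c) k X) sums free_eval (ell2_apply c) X"
  unfolding free_eval_def by (intro summable_sums summable_hom_part)

lemma op_scaleC_add_left: "op_scaleC (c + d) A = op_scaleC c A + op_scaleC d A"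
  by (rule blinfun_eqI) (simp add: op_scaleC.rep_eq plus_blinfun.rep_eq scaleC_add_left)

lemma op_scaleC_scaleC: "op_scaleC c (op_scaleC d A) = op_scaleC (c * d) A"
  by (rule blinfun_eqI) (simp add: op_scaleC.rep_eq scaleC_scaleC)

lemma op_scaleC_one [simp]: "op_scaleC 1 A = A"
  by (rule blinfun_eqI) (simp add: op_scaleC.rep_eq scaleC_one)

lemma op_scaleC_zero_left [simp]: "op_scaleC 0 A = 0"
  by (rule blinfun_eqI) (simp add: op_scaleC.rep_eq)

lemma op_scaleC_of_real: "op_scaleC (of_real r) A = r *\<^sub>R A"
  by (rule blinfun_eqI) (simp add: op_scaleC.rep_eq scaleR_scaleC scaleR_blinfun.rep_eq)

lemma bounded_linear_op_scaleC: "bounded_linear (op_scaleC c :: 'a::complex_hilbert operator \<Rightarrow> _)"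
proof (rule bounded_linear_intro[where K = "cmod c"])
  show "norm (op_scaleC c A) \<le> norm A * cmod c" for A :: "'a operator"
  proof (rule norm_blinfun_bound)
    show "norm (blinfun_apply (op_scaleC c A) x) \<le> norm A * cmod c * norm x" for x
      using mult_left_mono[OF norm_blinfun[of A x], of "cmod c"]
      by (simp add: op_scaleC.rep_eq norm_scaleC mult_ac)
  qed simp
qed (rule blinfun_eqI, simp add: op_scaleC.rep_eq plus_blinfun.rep_eq scaleC_add_right
    scaleR_blinfun.rep_eq scaleR_scaleC scaleC_scaleC mult.commute)+

lemma hom_part_add: "hom_part (\<lambda>\<alpha>. a \<alpha> + b \<alpha>) k X = hom_part a k X + hom_part b k X"
  by (simp add: hom_part_def op_scaleC_add_left sum.distrib)

lemma hom_part_scale: "hom_part (\<lambda>\<alpha>. c * a \<alpha>) k X = op_scaleC c (hom_part a k X)"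
  by (simp add: hom_part_def op_scaleC_scaleC linear_sum[OF bounded_linear.linear[OF bounded_linear_op_scaleC]])

lemma free_eval_scaleC:
  assumes "X \<in> nc_ball"
  shows "free_eval (ell2_apply (c *\<^sub>C f)) X = op_scaleC c (free_eval (ell2_apply f) X)"
proof -
  have "(\<lambda>k. hom_part (ell2_apply (c *\<^sub>C f)) k X) sums op_scaleC c (free_eval (ell2_apply f) X)"
    unfolding scaleC_ell2.rep_eq hom_part_scale
    by (rule bounded_linear.sums[OF bounded_linear_op_scaleC free_eval_sums[OF assms]])
  then show ?thesis
    unfolding free_eval_def by (rule sums_unique[symmetric])
qed

text \<open>Continuity of evaluation at a fixed point lets identities checked on combinations of
  monomials pass to all square summable families.\<close>

lemma bounded_linear_free_eval:
  assumes X: "X \<in> nc_ball"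
  shows "bounded_linear (\<lambda>f. free_eval (ell2_apply f) X)"
proof -
  obtain \<rho> where \<rho>: "0 < \<rho>" "\<rho> < 1" "row_bound X \<rho>"
    using nc_ballD(2)[OF X] by blast
  show ?thesis
  proof (rule bounded_linear_intro[where K = "1 / (1 - \<rho>)"])
    show "free_eval (ell2_apply (f + g)) X = free_eval (ell2_apply f) X + free_eval (ell2_apply g) X" for f g
    proof -
      have "(\<lambda>k. hom_part (ell2_apply (f + g)) k X) sums (free_eval (ell2_apply f) X + free_eval (ell2_apply g) X)"
        unfolding plus_ell2.rep_eq hom_part_add by (intro sums_add free_eval_sums X)
      then show ?thesis
        unfolding free_eval_def by (rule sums_unique[symmetric])
    qed
    show "free_eval (ell2_apply (r *\<^sub>R f)) X = r *\<^sub>R free_eval (ell2_apply f) X" for r f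
      by (simp add: scaleR_scaleC[of r f] free_eval_scaleC[OF X] op_scaleC_of_real)
    show "norm (free_eval (ell2_apply f) X) \<le> norm f * (1 / (1 - \<rho>))" for f
    proof -
      have le: "norm (hom_part (ell2_apply f) k X) \<le> norm f * \<rho> ^ k" for k
        by (rule norm_hom_part_ell2_le[OF nc_ballD(1)[OF X] \<rho>(3)]) (use \<rho> in simp)
      have "(\<lambda>k. norm f * \<rho> ^ k) sums (norm f * (1 / (1 - \<rho>)))"
        using \<rho> by (intro sums_mult geometric_sums) simp
      then show ?thesis
        unfolding free_eval_def
        using norm_suminf_le[of "\<lambda>k. hom_part (ell2_apply f) k X" "\<lambda>k. norm f * \<rho> ^ k"] le
        by (metis sums_iff)
    qed
  qed
qed

definition h2_fun :: "'n list ell2 \<Rightarrow> ('n::finite, 'h::complex_hilbert) ball_fun" where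
  "h2_fun c = (\<lambda>X. if X \<in> nc_ball then free_eval (ell2_apply c) X else 0)"

lemma has_free_expansion_h2_fun:
  fixes c :: "'n::finite list ell2"
  shows "has_free_expansion (h2_fun c :: ('n, 'h::complex_hilbert) ball_fun) (ell2_apply c)"
  unfolding has_free_expansion_def
proof (intro conjI ballI allI impI)
  let ?s = "\<lambda>k. root (2 * k) (\<Sum>\<alpha> | length \<alpha> = k. (cmod (ell2_apply c \<alpha>))\<^sup>2)"
  \<comment> \<open>Bounds the sum of squares over every length. The summand \<open>1\<close> makes
    it positive also for \<open>c = 0\<close>, since the roots of a positive constant tend to
    \<open>1\<close>.\<close>
  define M where "M = (norm c)\<^sup>2 + 1"
  have root_le: "?s k \<le> root (2 * k) M" if "0 < k" for k
  proof -
    have "(\<Sum>\<alpha> | length \<alpha> = k. (cmod (ell2_apply c \<alpha>))\<^sup>2) \<le> (norm c)\<^sup>2"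
      using power_mono[OF L2_set_le_norm_ell2[OF finite_words_eq] L2_set_nonneg, of c k 2]
      by (simp add: L2_set_power2)
    then show ?thesis
      using that by (intro real_root_le_mono) (simp_all add: M_def)
  qed
  have "\<forall>\<^sub>F k in sequentially. ereal (?s k) \<le> ereal (root (2 * k) M)"
    unfolding ereal_less_eq by (rule eventually_mono[OF eventually_gt_at_top[of 0]]) (rule root_le)
  then have "limsup (\<lambda>k. ereal (?s k)) \<le> limsup (\<lambda>k. ereal (root (2 * k) M))"
    by (rule Limsup_mono)
  also have "limsup (\<lambda>k. ereal (root (2 * k) M)) = 1"
  proof (rule lim_imp_Limsup)
    have "filterlim (\<lambda>k::nat. 2 * k) sequentially sequentially"
      by (rule filterlim_subseq) (simp add: strict_mono_def)
    moreover have "(\<lambda>n. root n M) \<longlonglongrightarrow> 1"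
      by (rule LIMSEQ_root_const) (simp add: M_def add_nonneg_pos)
    ultimately have "(\<lambda>k. root (2 * k) M) \<longlonglongrightarrow> 1"
      by (rule filterlim_compose[rotated])
    then show "(\<lambda>k. ereal (root (2 * k) M)) \<longlonglongrightarrow> 1"
      by (simp add: one_ereal_def)
  qed simp
  finally show "limsup (\<lambda>k. ereal (?s k)) \<le> 1" .
  show "(\<lambda>k. \<Sum>\<alpha> | length \<alpha> = k. op_scaleC (ell2_apply c \<alpha>) (word_prod X \<alpha>)) sums h2_fun c X"
    if "X \<in> nc_ball" for X :: "'n \<Rightarrow> 'h operator"
    using free_eval_sums[OF that, of c] that by (simp add: hom_part_def h2_fun_def)
qed (simp add: h2_fun_def)

subsection \<open>Truncated creation operators\<close>

definition orthonormal_on :: "('a \<Rightarrow> 'h::complex_hilbert) \<Rightarrow> 'a set \<Rightarrow> bool" where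
  "orthonormal_on e A \<longleftrightarrow> (\<forall>x\<in>A. \<forall>y\<in>A. cinner (e x) (e y) = (if x = y then 1 else 0))"

lemma orthonormal_onD:
  "orthonormal_on e A \<Longrightarrow> x \<in> A \<Longrightarrow> y \<in> A \<Longrightarrow> cinner (e x) (e y) = (if x = y then 1 else 0)"
  by (simp add: orthonormal_on_def)

lemma orthonormal_on_subset: "orthonormal_on e A \<Longrightarrow> B \<subseteq> A \<Longrightarrow> orthonormal_on e B"
  unfolding orthonormal_on_def by blast

text \<open>Gram-Schmidt: infinite dimension provides at each step a vector outside the span of
  those already chosen.\<close>

lemma orthonormal_exists:
  assumes inf: "infinite_dimensional TYPE('h::complex_hilbert)" and "finite A"
  shows "\<exists>e :: 'a \<Rightarrow> 'h. orthonormal_on e A"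
  using assms(2)
proof (induction A)
  case (insert x A)
  then obtain e :: "'a \<Rightarrow> 'h" where e: "orthonormal_on e A"
    by blast
  obtain v where v: "v \<notin> complex_vector.span (e ` A)"
    using inf insert.hyps(1) unfolding infinite_dimensional_def by blast
  define u where "u = v - (\<Sum>y\<in>A. cinner v (e y) *\<^sub>C e y)"
  have "(\<Sum>y\<in>A. cinner v (e y) *\<^sub>C e y) \<in> complex_vector.span (e ` A)"
    by (intro complex_vector.span_sum complex_vector.span_scale complex_vector.span_base) simp
  with v have "u \<noteq> 0"
    by (auto simp: u_def)
  have orth: "cinner u (e y) = 0" if "y \<in> A" for y
    using insert.hyps(1) that
    by (simp add: u_def cinner_diff_left cinner_sum_left cinner_scaleC_left orthonormal_onD[OF e]
        if_distrib sum.delta' cong: if_cong)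
  define z where "z = inverse (of_real (norm u)) *\<^sub>C u"
  have "norm z = 1"
    using \<open>u \<noteq> 0\<close> by (simp add: z_def norm_scaleC norm_inverse)
  then have zz: "cinner z z = 1"
    by (simp add: cinner_self)
  have ze: "cinner z (e y) = 0" if "y \<in> A" for y
    using orth[OF that] by (simp add: z_def cinner_scaleC_left)
  have ez: "cinner (e y) z = 0" if "y \<in> A" for y
    using ze[OF that] by (subst cinner_commute) simp
  have "orthonormal_on (e(x := z)) (insert x A)"
    unfolding orthonormal_on_def using insert.hyps(2) zz ze ez orthonormal_onD[OF e] by auto
  then show ?case
    by blast
qed (simp add: orthonormal_on_def)

lemma cinner_sum_orthonormal:
  assumes "finite F" "orthonormal_on e F" "y \<in> F"
  shows "cinner (\<Sum>x\<in>F. p x *\<^sub>C e x) (e y) = p y"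
  using assms
  by (simp add: cinner_sum_left cinner_scaleC_left orthonormal_onD[OF assms(2)] if_distrib sum.delta'
      cong: if_cong)

lemma norm_sum_orthonormal:
  assumes "finite F" "orthonormal_on e F"
  shows "norm (\<Sum>x\<in>F. p x *\<^sub>C e x) = L2_set (\<lambda>x. cmod (p x)) F"
proof -
  let ?s = "\<Sum>x\<in>F. p x *\<^sub>C e x"
  have "complex_of_real ((norm ?s)\<^sup>2) = cinner ?s ?s"
    by (simp only: cinner_self)
  also have "\<dots> = (\<Sum>y\<in>F. cnj (p y) * cinner ?s (e y))"
    by (simp only: cinner_sum_right cinner_scaleC_right)
  also have "\<dots> = (\<Sum>y\<in>F. of_real ((cmod (p y))\<^sup>2))"
    by (rule sum.cong[OF refl])
      (simp only: cinner_sum_orthonormal[OF assms] complex_norm_square mult.commute)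
  also have "\<dots> = of_real ((L2_set (\<lambda>x. cmod (p x)) F)\<^sup>2)"
    by (simp only: L2_set_power2 of_real_sum)
  finally have "(norm ?s)\<^sup>2 = (L2_set (\<lambda>x. cmod (p x)) F)\<^sup>2"
    by (simp only: of_real_eq_iff)
  then show ?thesis
    by (simp only: power2_eq_iff_nonneg norm_ge_zero L2_set_nonneg)
qed

lemma bessel:
  assumes "finite F" "orthonormal_on e F"
  shows "L2_set (\<lambda>y. cmod (cinner x (e y))) F \<le> norm x"
proof -
  let ?L = "L2_set (\<lambda>y. cmod (cinner x (e y))) F"
  let ?s = "\<Sum>y\<in>F. cinner x (e y) *\<^sub>C e y"
  have "complex_of_real (?L\<^sup>2) = cinner x ?s"
    by (simp only: L2_set_power2 of_real_sum complex_norm_square cinner_sum_right cinner_scaleC_right mult.commute)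
  then have "?L\<^sup>2 = cmod (cinner x ?s)"
    by (rule square_eq_cmod)
  also have "\<dots> \<le> norm x * norm ?s"
    by (rule cauchy_schwarz)
  also have "norm ?s = ?L"
    by (rule norm_sum_orthonormal[OF assms])
  finally have "?L * ?L \<le> ?L * norm x"
    by (simp add: power2_eq_square mult.commute)
  then show ?thesis
    by (rule mult_self_le_imp_le) (simp_all add: L2_set_nonneg)
qed

text \<open>Scaled left creation operators of the full Fock space, compressed to words of length at
  most \<open>m\<close>: for \<open>e\<close> orthonormal on these words, those of length exactly
  \<open>m\<close> are sent to \<open>0\<close>, and so is the orthogonal complement of all of
  them.\<close>

definition trunc_shift :: "nat \<Rightarrow> real \<Rightarrow> ('n list \<Rightarrow> 'h) \<Rightarrow> 'n::finite \<Rightarrow> 'h::complex_hilbert operator" where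
  "trunc_shift m r e i =
     Blinfun (\<lambda>x. \<Sum>\<alpha> | length \<alpha> < m. (of_real r * cinner x (e \<alpha>)) *\<^sub>C e (i # \<alpha>))"

lemma trunc_shift_apply:
  "blinfun_apply (trunc_shift m r e i) x
    = (\<Sum>\<alpha> | length \<alpha> < m. (of_real r * cinner x (e \<alpha>)) *\<^sub>C e (i # \<alpha>))"
  unfolding trunc_shift_def
  by (subst bounded_linear_Blinfun_apply)
    (intro bounded_linear_sum bounded_linear_compose[OF bounded_linear_scaleC_left]
      bounded_linear_const_mult bounded_linear_cinner_left, rule refl)

lemma complex_linear_trunc_shift: "complex_linear (trunc_shift m r e i)"
  by (simp add: complex_linear_def trunc_shift_apply cinner_scaleC_left complex_vector.scale_sum_right
      scaleC_scaleC mult_ac)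

text \<open>A nonempty word determines its first letter and the rest, so the ranges for different
  letters are orthogonal and squared norms add up; Bessel's inequality bounds each of them.\<close>

lemma row_bound_trunc_shift:
  fixes e :: "'n::finite list \<Rightarrow> 'h::complex_hilbert"
  assumes e: "orthonormal_on e {\<alpha>. length \<alpha> \<le> m}" and r: "0 \<le> r"
  shows "row_bound (trunc_shift m r e) r"
  unfolding row_bound_def
proof (rule allI)
  fix x :: "'n \<Rightarrow> 'h"
  let ?S = "{\<alpha> :: 'n list. length \<alpha> < m}"
  let ?W = "{i # \<alpha> |i \<alpha>. \<alpha> \<in> ?S}"
  let ?q = "\<lambda>\<beta>. of_real r * cinner (x (hd \<beta>)) (e (tl \<beta>))"
  have W: "?W \<subseteq> {\<alpha>. length \<alpha> \<le> m}"
    by auto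
  have expand: "(\<Sum>i\<in>UNIV. blinfun_apply (trunc_shift m r e i) (x i)) = (\<Sum>\<beta>\<in>?W. ?q \<beta> *\<^sub>C e \<beta>)"
    by (simp only: sum_words_Cons[OF finite_words_less] trunc_shift_apply list.sel)
  have "norm (\<Sum>\<beta>\<in>?W. ?q \<beta> *\<^sub>C e \<beta>) = L2_set (\<lambda>\<beta>. cmod (?q \<beta>)) ?W"
    by (intro norm_sum_orthonormal orthonormal_on_subset[OF e W] finite_subset[OF W finite_words_le])
  also have "\<dots> = L2_set (\<lambda>i. L2_set (\<lambda>\<alpha>. r * cmod (cinner (x i) (e \<alpha>))) ?S) UNIV"
    using r
    by (simp only: L2_set_def[of _ UNIV] L2_set_power2)
      (simp only: L2_set_def sum_words_Cons[OF finite_words_less] list.sel norm_mult norm_of_real abs_of_nonneg)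
  also have "\<dots> = r * L2_set (\<lambda>i. L2_set (\<lambda>\<alpha>. cmod (cinner (x i) (e \<alpha>))) ?S) UNIV"
    by (simp only: L2_set_right_distrib[OF r])
  also have "\<dots> \<le> r * L2_set (\<lambda>i. norm (x i)) UNIV"
    by (intro mult_left_mono r L2_set_mono bessel orthonormal_on_subset[OF e] finite_words_less)
      (auto simp: L2_set_nonneg)
  finally show "norm (\<Sum>i\<in>UNIV. blinfun_apply (trunc_shift m r e i) (x i)) \<le> r * L2_set (\<lambda>i. norm (x i)) UNIV"
    by (simp only: expand)
qed

lemma trunc_shift_in_nc_ball:
  assumes "orthonormal_on e {\<alpha>. length \<alpha> \<le> m}" "0 \<le> r" "r < 1"
  shows "trunc_shift m r e \<in> nc_ball"
  using complex_linear_trunc_shift row_bound_trunc_shift[OF assms(1,2)] assms(2,3) by (rule nc_ballI)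

lemma word_prod_trunc_shift:
  fixes e :: "'n::finite list \<Rightarrow> 'h::complex_hilbert"
  assumes e: "orthonormal_on e {\<alpha>. length \<alpha> \<le> m}" and \<delta>: "length \<delta> \<le> m"
  shows "blinfun_apply (word_prod (trunc_shift m r e) \<beta>) (e \<delta>)
    = (if length \<beta> + length \<delta> \<le> m then of_real (r ^ length \<beta>) *\<^sub>C e (\<beta> @ \<delta>) else 0)"
proof (induction \<beta>)
  case Nil
  then show ?case
    using \<delta> by (simp add: scaleC_one)
next
  case (Cons i \<beta>)
  have shift: "blinfun_apply (trunc_shift m r e i) (e \<gamma>) = (if length \<gamma> < m then of_real r *\<^sub>C e (i # \<gamma>) else 0)"
    if "length \<gamma> \<le> m" for \<gamma>
  proof -
    have "blinfun_apply (trunc_shift m r e i) (e \<gamma>)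
        = (\<Sum>\<alpha> | length \<alpha> < m. if \<gamma> = \<alpha> then of_real r *\<^sub>C e (i # \<alpha>) else 0)"
      unfolding trunc_shift_apply
      by (rule sum.cong[OF refl]) (use that orthonormal_onD[OF e] in auto)
    then show ?thesis
      by (simp add: finite_words_less sum.delta')
  qed
  show ?case
  proof (cases "length \<beta> + length \<delta> \<le> m")
    case True
    then have "blinfun_apply (word_prod (trunc_shift m r e) (i # \<beta>)) (e \<delta>)
        = of_real (r ^ length \<beta>) *\<^sub>C blinfun_apply (trunc_shift m r e i) (e (\<beta> @ \<delta>))"
      using complex_linear_trunc_shift[of m r e i] by (simp add: Cons.IH complex_linear_def)
    then show ?thesis
      using True shift[of "\<beta> @ \<delta>"] by (auto simp: scaleC_scaleC mult.commute)
  qed (simp add: Cons.IH)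
qed

text \<open>Matrix entries at the shifts recover coefficients. The sum on the right has at most one
  term, the prefix left after removing \<delta> from the end of \<gamma>; writing it as a sum
  includes the case that \<delta> is no suffix of \<gamma>.\<close>

lemma free_expansion_trunc_shift:
  fixes f :: "('n::finite, 'h::complex_hilbert) ball_fun"
  assumes f: "has_free_expansion f a" and e: "orthonormal_on e {\<alpha>. length \<alpha> \<le> m}"
    and r: "0 \<le> r" "r < 1" and len: "length \<delta> \<le> m" "length \<gamma> \<le> m"
  shows "cinner (blinfun_apply (f (trunc_shift m r e)) (e \<delta>)) (e \<gamma>)
    = (\<Sum>\<beta> | \<beta> @ \<delta> = \<gamma>. a \<beta> * of_real (r ^ length \<beta>))"
proof -
  let ?V = "trunc_shift m r e"
  let ?g = "\<lambda>\<beta>. if \<beta> @ \<delta> = \<gamma> then a \<beta> * of_real (r ^ length \<beta>) else 0"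
  have "(\<lambda>k. hom_part a k ?V) sums f ?V"
    using f trunc_shift_in_nc_ball[OF e r] by (simp add: has_free_expansion_def hom_part_def)
  then have "(\<lambda>k. cinner (blinfun_apply (hom_part a k ?V) (e \<delta>)) (e \<gamma>))
      sums cinner (blinfun_apply (f ?V) (e \<delta>)) (e \<gamma>)"
    by (intro bounded_linear.sums[OF bounded_linear_cinner_left]
        bounded_linear.sums[OF blinfun.bounded_linear_left])
  moreover have "cinner (blinfun_apply (hom_part a k ?V) (e \<delta>)) (e \<gamma>) = (\<Sum>\<beta> | length \<beta> = k. ?g \<beta>)" for k
  proof -
    have "cinner (blinfun_apply (word_prod ?V \<beta>) (e \<delta>)) (e \<gamma>) = (if \<beta> @ \<delta> = \<gamma> then of_real (r ^ length \<beta>) else 0)"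
      for \<beta>
      using len orthonormal_onD[OF e, of "\<beta> @ \<delta>" \<gamma>]
      by (auto simp: word_prod_trunc_shift[OF e] cinner_scaleC_left)
    then have "cinner (blinfun_apply (hom_part a k ?V) (e \<delta>)) (e \<gamma>)
        = (\<Sum>\<beta> | length \<beta> = k. a \<beta> * (if \<beta> @ \<delta> = \<gamma> then of_real (r ^ length \<beta>) else 0))"
      by (simp only: hom_part_def blinfun.sum_left op_scaleC.rep_eq cinner_sum_left cinner_scaleC_left)
    then show ?thesis
      by (simp add: if_distrib cong: if_cong)
  qed
  moreover have "(\<lambda>k. \<Sum>\<beta> | length \<beta> = k. ?g \<beta>) sums (\<Sum>k<Suc m. \<Sum>\<beta> | length \<beta> = k. ?g \<beta>)"
  proof (rule sums_finite)
    show "(\<Sum>\<beta> | length \<beta> = k. ?g \<beta>) = 0" if "k \<notin> {..<Suc m}" for k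
      by (rule sum.neutral) (use that len in auto)
  qed simp
  ultimately have "cinner (blinfun_apply (f ?V) (e \<delta>)) (e \<gamma>) = (\<Sum>k<Suc m. \<Sum>\<beta> | length \<beta> = k. ?g \<beta>)"
    by (simp only: sums_unique2)
  also have "\<dots> = (\<Sum>\<beta> | length \<beta> < Suc m. ?g \<beta>)"
    by (rule sum_words_by_length)
  also have "\<dots> = (\<Sum>\<beta> | length \<beta> < Suc m \<and> \<beta> @ \<delta> = \<gamma>. a \<beta> * of_real (r ^ length \<beta>))"
    using sum.inter_filter[OF finite_words_less[of "Suc m"], of "\<lambda>\<beta>. a \<beta> * of_real (r ^ length \<beta>)" "\<lambda>\<beta>. \<beta> @ \<delta> = \<gamma>"]
    by simp
  also have "{\<beta> :: 'n list. length \<beta> < Suc m \<and> \<beta> @ \<delta> = \<gamma>} = {\<beta>. \<beta> @ \<delta> = \<gamma>}"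
    using len by auto
  finally show ?thesis .
qed

lemma has_free_expansion_unique:
  fixes f :: "('n::finite, 'h::complex_hilbert) ball_fun"
  assumes inf: "infinite_dimensional TYPE('h)"
    and f: "has_free_expansion f a" "has_free_expansion f b"
  shows "a = b"
proof (rule ext)
  fix \<gamma> :: "'n list"
  obtain e :: "'n list \<Rightarrow> 'h" where e: "orthonormal_on e {\<alpha>. length \<alpha> \<le> length \<gamma>}"
    using orthonormal_exists[OF inf finite_words_le] by blast
  \<comment> \<open>With the empty word for \<delta> the prefix is \<gamma> itself. Any
    \<open>r\<close> strictly between \<open>0\<close> and \<open>1\<close> would do, as the power
    of \<open>r\<close> has only to be nonzero and known.\<close>
  have "cinner (blinfun_apply (f (trunc_shift (length \<gamma>) (1/2) e)) (e [])) (e \<gamma>) = c \<gamma> * of_real ((1/2) ^ length \<gamma>)"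
    if "has_free_expansion f c" for c
    using free_expansion_trunc_shift[OF that e, of "1/2" "[]" \<gamma>] by simp
  from this[OF f(1)] this[OF f(2)] show "a \<gamma> = b \<gamma>"
    by simp
qed

lemma free_coeff_eq:
  fixes f :: "('n::finite, 'h::complex_hilbert) ball_fun"
  assumes inf: "infinite_dimensional TYPE('h)" and f: "has_free_expansion f a"
  shows "free_coeff f = a"
  unfolding free_coeff_def using f has_free_expansion_unique[OF inf _ f] by (rule the_equality)

subsection \<open>Multiplication by the components of a self-map\<close>

text \<open>The row of values of a self-map is contractive at the truncated creation operators scaled
  by \<open>r\<close>; the estimate on coefficients is its limit as \<open>r\<close> tends to \<open>1\<close>.\<close>

lemma self_map_coeff_contraction:
  fixes \<phi> :: "'n::finite \<Rightarrow> ('n, 'h::complex_hilbert) ball_fun"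
  assumes inf: "infinite_dimensional TYPE('h)"
    and maps: "\<forall>X\<in>nc_ball. (\<lambda>i. \<phi> i X) \<in> nc_ball"
    and a: "\<And>i. has_free_expansion (\<phi> i) (a i)"
    and FG: "finite F" "finite G"
  shows "L2_set (\<lambda>\<gamma>. cmod (\<Sum>i\<in>UNIV. \<Sum>\<delta>\<in>F. p i \<delta> * (\<Sum>\<beta> | \<beta> @ \<delta> = \<gamma>. a i \<beta>))) G
    \<le> L2_set (\<lambda>i. L2_set (\<lambda>\<delta>. cmod (p i \<delta>)) F) UNIV"
proof -
  \<comment> \<open>Long enough for the truncation to be invisible to all words of \<open>F\<close>
    and \<open>G\<close>; \<open>insert 0\<close> provides for empty sets.\<close>
  define m where "m = Max (insert 0 (length ` (F \<union> G)))"
  have "length \<alpha> \<le> m" if "\<alpha> \<in> F \<union> G" for \<alpha>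
    unfolding m_def by (rule Max_ge) (use FG that in auto)
  then have F: "F \<subseteq> {\<alpha>. length \<alpha> \<le> m}" and G: "G \<subseteq> {\<alpha>. length \<alpha> \<le> m}"
    by auto
  obtain e :: "'n list \<Rightarrow> 'h" where e: "orthonormal_on e {\<alpha>. length \<alpha> \<le> m}"
    using orthonormal_exists[OF inf finite_words_le] by blast
  define x where "x i = (\<Sum>\<delta>\<in>F. p i \<delta> *\<^sub>C e \<delta>)" for i
  have norm_x: "norm (x i) = L2_set (\<lambda>\<delta>. cmod (p i \<delta>)) F" for i
    unfolding x_def by (intro norm_sum_orthonormal FG orthonormal_on_subset[OF e F])
  let ?c = "\<lambda>r \<gamma>. \<Sum>i\<in>UNIV. \<Sum>\<delta>\<in>F. p i \<delta> * (\<Sum>\<beta> | \<beta> @ \<delta> = \<gamma>. a i \<beta> * of_real (r ^ length \<beta>))"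
  have bound: "L2_set (\<lambda>\<gamma>. cmod (?c r \<gamma>)) G \<le> L2_set (\<lambda>i. norm (x i)) UNIV"
    if r: "0 \<le> r" "r < 1" for r
  proof -
    define V where "V = trunc_shift m r e"
    have "V \<in> nc_ball"
      unfolding V_def by (rule trunc_shift_in_nc_ball[OF e r])
    with maps have \<phi>V: "(\<lambda>i. \<phi> i V) \<in> nc_ball"
      by blast
    then obtain \<rho> where \<rho>: "0 < \<rho>" "\<rho> < 1" "row_bound (\<lambda>i. \<phi> i V) \<rho>"
      using nc_ballD(2) by blast
    let ?y = "\<Sum>i\<in>UNIV. blinfun_apply (\<phi> i V) (x i)"
    have "cinner ?y (e \<gamma>) = ?c r \<gamma>" if "\<gamma> \<in> G" for \<gamma>
    proof -
      have "cinner (blinfun_apply (\<phi> i V) (p i \<delta> *\<^sub>C e \<delta>)) (e \<gamma>)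
          = p i \<delta> * (\<Sum>\<beta> | \<beta> @ \<delta> = \<gamma>. a i \<beta> * of_real (r ^ length \<beta>))" if "\<delta> \<in> F" for i \<delta>
      proof -
        have "blinfun_apply (\<phi> i V) (p i \<delta> *\<^sub>C e \<delta>) = p i \<delta> *\<^sub>C blinfun_apply (\<phi> i V) (e \<delta>)"
          using nc_ballD(1)[OF \<phi>V, of i] by (simp add: complex_linear_def)
        moreover have "cinner (blinfun_apply (\<phi> i V) (e \<delta>)) (e \<gamma>)
            = (\<Sum>\<beta> | \<beta> @ \<delta> = \<gamma>. a i \<beta> * of_real (r ^ length \<beta>))"
          unfolding V_def using F G \<open>\<gamma> \<in> G\<close> \<open>\<delta> \<in> F\<close> by (intro free_expansion_trunc_shift a e r) auto
        ultimately show ?thesis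
          by (simp only: cinner_scaleC_left)
      qed
      then show ?thesis
        by (simp add: x_def blinfun.sum_right cinner_sum_left)
    qed
    then have "L2_set (\<lambda>\<gamma>. cmod (?c r \<gamma>)) G = L2_set (\<lambda>\<gamma>. cmod (cinner ?y (e \<gamma>))) G"
      by (intro L2_set_cong) simp_all
    also have "\<dots> \<le> norm ?y"
      by (intro bessel FG orthonormal_on_subset[OF e G])
    also have "\<dots> \<le> \<rho> * L2_set (\<lambda>i. norm (x i)) UNIV"
      by (rule row_boundD[OF \<rho>(3)])
    also have "\<dots> \<le> 1 * L2_set (\<lambda>i. norm (x i)) UNIV"
      using \<rho>(2) by (intro mult_right_mono) (simp_all add: L2_set_nonneg)
    finally show ?thesis
      by simp
  qed
  have "((\<lambda>r. L2_set (\<lambda>\<gamma>. cmod (?c r \<gamma>)) G) \<longlongrightarrow> L2_set (\<lambda>\<gamma>. cmod (?c 1 \<gamma>)) G) (at_left 1)"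
    unfolding L2_set_def by (intro tendsto_intros)
  then have "L2_set (\<lambda>\<gamma>. cmod (?c 1 \<gamma>)) G \<le> L2_set (\<lambda>i. norm (x i)) UNIV"
  proof (rule tendsto_upperbound)
    have "\<forall>\<^sub>F r in at_left 1. r \<in> {0<..<1::real}"
      by (rule eventually_at_leftI[of 0]) simp_all
    then show "\<forall>\<^sub>F r in at_left 1. L2_set (\<lambda>\<gamma>. cmod (?c r \<gamma>)) G \<le> L2_set (\<lambda>i. norm (x i)) UNIV"
      by (rule eventually_mono) (rule bound, auto)
  qed simp
  then show ?thesis
    by (simp add: norm_x)
qed

text \<open>\<open>M i\<close> is left multiplication by \<open>\<phi> i\<close> in terms of
  coefficients, that is, convolution with \<open>a i\<close>. Its columns are square summable and
  its bound is \<open>1\<close> by the contraction estimate on finite families.\<close>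

lemma multipliers_exist:
  fixes \<phi> :: "'n::finite \<Rightarrow> ('n, 'h::complex_hilbert) ball_fun"
  assumes inf: "infinite_dimensional TYPE('h)"
    and maps: "\<forall>X\<in>nc_ball. (\<lambda>i. \<phi> i X) \<in> nc_ball"
    and a: "\<And>i. has_free_expansion (\<phi> i) (a i)"
  shows "\<exists>M :: 'n \<Rightarrow> 'n list ell2 operator. (\<forall>i. complex_linear (M i)) \<and>
    (\<forall>i \<delta> \<gamma>. ell2_apply (blinfun_apply (M i) (ket \<delta>)) \<gamma> = (\<Sum>\<beta> | \<beta> @ \<delta> = \<gamma>. a i \<beta>)) \<and> row_bound M 1"
proof -
  note contr = self_map_coeff_contraction[where \<phi> = \<phi> and a = a, OF inf maps a]
  \<comment> \<open>A row with one nonzero entry: each multiplier has to exist as a bounded operator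
    before the bound on the whole row can be stated.\<close>
  have single: "L2_set (\<lambda>\<gamma>. cmod (\<Sum>\<delta>\<in>F. p \<delta> * (\<Sum>\<beta> | \<beta> @ \<delta> = \<gamma>. a i \<beta>))) G
      \<le> L2_set (\<lambda>\<delta>. cmod (p \<delta>)) F" if "finite F" "finite G" for F G p i
  proof -
    have sum_single: "(\<Sum>j\<in>UNIV. if j = i then f j else 0) = f i" for f :: "'n \<Rightarrow> 'b::comm_monoid_add"
      by simp
    have "(\<Sum>j\<in>UNIV. \<Sum>\<delta>\<in>F. (if j = i then p \<delta> else 0) * (\<Sum>\<beta> | \<beta> @ \<delta> = \<gamma>. a j \<beta>))
        = (\<Sum>j\<in>UNIV. if j = i then \<Sum>\<delta>\<in>F. p \<delta> * (\<Sum>\<beta> | \<beta> @ \<delta> = \<gamma>. a j \<beta>) else 0)" for \<gamma>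
      by (rule sum.cong[OF refl]) simp
    then have lhs: "(\<Sum>j\<in>UNIV. \<Sum>\<delta>\<in>F. (if j = i then p \<delta> else 0) * (\<Sum>\<beta> | \<beta> @ \<delta> = \<gamma>. a j \<beta>))
        = (\<Sum>\<delta>\<in>F. p \<delta> * (\<Sum>\<beta> | \<beta> @ \<delta> = \<gamma>. a i \<beta>))" for \<gamma>
      by (simp only: sum_single)
    have "(\<Sum>j\<in>UNIV. (L2_set (\<lambda>\<delta>. cmod (if j = i then p \<delta> else 0)) F)\<^sup>2)
        = (\<Sum>j\<in>UNIV. if j = i then (L2_set (\<lambda>\<delta>. cmod (p \<delta>)) F)\<^sup>2 else 0)"
      by (rule sum.cong[OF refl]) (simp add: L2_set_def)
    then have rhs: "L2_set (\<lambda>j. L2_set (\<lambda>\<delta>. cmod (if j = i then p \<delta> else 0)) F) UNIV = L2_set (\<lambda>\<delta>. cmod (p \<delta>)) F"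
      by (simp only: L2_set_def[of _ UNIV] sum_single) (simp add: L2_set_nonneg)
    show ?thesis
      using contr[OF that, of "\<lambda>j \<delta>. if j = i then p \<delta> else 0"] by (simp only: lhs rhs)
  qed
  define W where "W i \<delta> = Abs_ell2 (\<lambda>\<gamma>. \<Sum>\<beta> | \<beta> @ \<delta> = \<gamma>. a i \<beta>)" for i \<delta>
  have W: "ell2_apply (W i \<delta>) \<gamma> = (\<Sum>\<beta> | \<beta> @ \<delta> = \<gamma>. a i \<beta>)" for i \<delta> \<gamma>
  proof -
    have "(\<lambda>\<gamma>. (cmod (\<Sum>\<beta> | \<beta> @ \<delta> = \<gamma>. a i \<beta>))\<^sup>2) summable_on UNIV"
    proof (rule square_summableI[where B = 1])
      show "L2_set (\<lambda>\<gamma>. cmod (\<Sum>\<beta> | \<beta> @ \<delta> = \<gamma>. a i \<beta>)) G \<le> 1" if "finite G" for G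
        using single[of "{\<delta>}" G "\<lambda>_. 1" i] that by simp
    qed
    then show ?thesis
      unfolding W_def by (subst Abs_ell2_inverse) auto
  qed
  have "\<exists>T. complex_linear T \<and> (\<forall>\<delta>. blinfun_apply T (ket \<delta>) = W i \<delta>)" for i
  proof (rule ell2_operator_exists[where B = 1])
    fix F :: "'n list set" and p
    assume "finite F"
    then show "norm (\<Sum>\<delta>\<in>F. p \<delta> *\<^sub>C W i \<delta>) \<le> 1 * L2_set (\<lambda>\<delta>. cmod (p \<delta>)) F"
      by (intro norm_ell2_le) (simp add: ell2_apply_sum ell2_simps W single)
  qed
  then obtain M where lin: "\<And>i. complex_linear (M i)" and M: "\<And>i \<delta>. blinfun_apply (M i) (ket \<delta>) = W i \<delta>"
    by metis
  have "row_bound M 1"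
    unfolding row_bound_def
  proof (rule allI)
    fix g :: "'n \<Rightarrow> 'n list ell2"
    \<comment> \<open>All components are cut down to the same finite set, to which the finite
      estimate applies; continuity gives the limit.\<close>
    let ?P = "\<lambda>F i. blinfun_apply (proj_ell2 F) (g i)"
    have "((\<lambda>F. norm (\<Sum>i\<in>UNIV. blinfun_apply (M i) (?P F i))) \<longlongrightarrow> norm (\<Sum>i\<in>UNIV. blinfun_apply (M i) (g i)))
        (finite_subsets_at_top UNIV)"
      by (intro tendsto_norm tendsto_sum bounded_linear.tendsto[OF blinfun.bounded_linear_right] proj_ell2_tendsto)
    moreover have "\<forall>\<^sub>F F in finite_subsets_at_top UNIV.
        norm (\<Sum>i\<in>UNIV. blinfun_apply (M i) (?P F i)) \<le> 1 * L2_set (\<lambda>i. norm (g i)) UNIV"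
    proof (rule eventually_finite_subsets_at_top_weakI)
      fix F :: "'n list set"
      assume F: "finite F"
      have expand: "blinfun_apply (M i) (?P F i) = (\<Sum>\<delta>\<in>F. ell2_apply (g i) \<delta> *\<^sub>C W i \<delta>)" for i
        using lin[of i] by (simp add: proj_ell2_finite[OF F] blinfun.sum_right M complex_linear_def)
      have "norm (\<Sum>i\<in>UNIV. blinfun_apply (M i) (?P F i)) \<le> L2_set (\<lambda>i. L2_set (\<lambda>\<delta>. cmod (ell2_apply (g i) \<delta>)) F) UNIV"
        unfolding expand by (rule norm_ell2_le) (simp add: ell2_apply_sum ell2_simps W contr F)
      also have "\<dots> \<le> L2_set (\<lambda>i. norm (g i)) UNIV"
        by (intro L2_set_mono L2_set_le_norm_ell2 F) (simp add: L2_set_nonneg)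
      finally show "norm (\<Sum>i\<in>UNIV. blinfun_apply (M i) (?P F i)) \<le> 1 * L2_set (\<lambda>i. norm (g i)) UNIV"
        by simp
    qed
    ultimately show "norm (\<Sum>i\<in>UNIV. blinfun_apply (M i) (g i)) \<le> 1 * L2_set (\<lambda>i. norm (g i)) UNIV"
      by (intro tendsto_upperbound) auto
  qed
  with lin M W show ?thesis
    by metis
qed

text \<open>Only coefficients occur here, so the norm estimates are carried out without reference to
  points of the ball; \<open>free_eval_M\<close> and \<open>free_eval_word_vec\<close> make the
  connection.\<close>

locale free_multipliers =
  fixes M :: "'n::finite \<Rightarrow> 'n list ell2 operator" and a :: "'n \<Rightarrow> 'n list \<Rightarrow> complex"
  assumes linear_M: "complex_linear (M i)"
    and M_ket: "ell2_apply (blinfun_apply (M i) (ket \<delta>)) \<gamma> = (\<Sum>\<beta> | \<beta> @ \<delta> = \<gamma>. a i \<beta>)"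
    and row_bound_M: "row_bound M 1"
begin

text \<open>Right multiplication by the monomial \<delta> raises every degree by
  \<open>length \<delta>\<close>. This turns the expansion of the product into a shifted copy of the
  one for the multiplier.\<close>

lemma hom_part_M_ket_shift:
  "hom_part (ell2_apply (blinfun_apply (M i) (ket \<delta>))) (k + length \<delta>) X
    = hom_part (a i) k X o\<^sub>L word_prod X \<delta>"
proof -
  have fin: "finite {\<beta> :: 'n list. \<beta> @ \<delta> = \<gamma>}" for \<gamma>
    by (rule finite_subset[OF _ finite_words_le[of "length \<gamma>"]]) auto
  have "hom_part (ell2_apply (blinfun_apply (M i) (ket \<delta>))) (k + length \<delta>) X
      = (\<Sum>\<gamma> | length \<gamma> = k + length \<delta>. \<Sum>\<beta> | \<beta> @ \<delta> = \<gamma>. op_scaleC (a i \<beta>) (word_prod X \<gamma>))"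
    unfolding hom_part_def M_ket
  proof (rule sum.cong[OF refl])
    fix \<gamma>
    show "op_scaleC (\<Sum>\<beta> | \<beta> @ \<delta> = \<gamma>. a i \<beta>) (word_prod X \<gamma>)
        = (\<Sum>\<beta> | \<beta> @ \<delta> = \<gamma>. op_scaleC (a i \<beta>) (word_prod X \<gamma>))"
      using fin[of \<gamma>] by (induction rule: finite_induct) (simp_all add: op_scaleC_add_left)
  qed
  also have "\<dots> = (\<Sum>(\<gamma>, \<beta>)\<in>(SIGMA \<gamma>:{\<gamma>. length \<gamma> = k + length \<delta>}. {\<beta>. \<beta> @ \<delta> = \<gamma>}).
      op_scaleC (a i \<beta>) (word_prod X \<gamma>))"
    by (rule sum.Sigma) (simp_all add: finite_words_eq fin)
  also have "\<dots> = (\<Sum>\<beta> | length \<beta> = k. op_scaleC (a i \<beta>) (word_prod X (\<beta> @ \<delta>)))"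
    by (rule sum.reindex_bij_witness[where i = "\<lambda>\<beta>. (\<beta> @ \<delta>, \<beta>)" and j = snd]) auto
  also have "\<dots> = hom_part (a i) k X o\<^sub>L word_prod X \<delta>"
    by (rule blinfun_eqI) (simp add: hom_part_def word_prod_append blinfun.sum_left op_scaleC.rep_eq)
  finally show ?thesis .
qed

lemma hom_part_M_ket_less:
  assumes "k < length \<delta>"
  shows "hom_part (ell2_apply (blinfun_apply (M i) (ket \<delta>))) k X = 0"
  unfolding hom_part_def
proof (rule sum.neutral, rule ballI)
  fix \<gamma> :: "'n list"
  assume "\<gamma> \<in> {\<gamma>. length \<gamma> = k}"
  then have "{\<beta>. \<beta> @ \<delta> = \<gamma>} = {}"
    using assms by auto
  then show "op_scaleC (ell2_apply (blinfun_apply (M i) (ket \<delta>)) \<gamma>) (word_prod X \<gamma>) = 0"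
    by (simp add: M_ket)
qed

lemma hom_part_ket: "hom_part (ell2_apply (ket \<delta>)) k X = (if k = length \<delta> then word_prod X \<delta> else 0)"
proof -
  have "hom_part (ell2_apply (ket \<delta>)) k X = (\<Sum>\<alpha> | length \<alpha> = k. if \<alpha> = \<delta> then word_prod X \<alpha> else 0)"
    unfolding hom_part_def by (rule sum.cong) (simp_all add: ket.rep_eq)
  then show ?thesis
    by (simp add: finite_words_eq)
qed

lemma free_eval_ket: "free_eval (ell2_apply (ket \<delta>)) X = word_prod X \<delta>"
  unfolding free_eval_def hom_part_ket
  by (subst suminf_finite[of "{length \<delta>}"]) auto

text \<open>Verified for monomials \<open>g\<close> and extended by continuity of both sides in
  \<open>g\<close>, so that no product of two infinite series has to be rearranged.\<close>

lemma free_eval_M: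
  assumes f: "has_free_expansion f (a i)" and X: "X \<in> nc_ball" and lin: "complex_linear (f X)"
  shows "f X o\<^sub>L free_eval (ell2_apply g) X = free_eval (ell2_apply (blinfun_apply (M i) g)) X"
proof -
  let ?E = "\<lambda>g. free_eval (ell2_apply g) X"
  have lin1: "bounded_linear (\<lambda>g. f X o\<^sub>L ?E g)"
    by (rule bounded_linear_compose[OF bounded_bilinear.bounded_linear_right[OF bounded_bilinear_blinfun_compose]
        bounded_linear_free_eval[OF X]])
  have lin2: "bounded_linear (\<lambda>g. ?E (blinfun_apply (M i) g))"
    by (rule bounded_linear_compose[OF bounded_linear_free_eval[OF X] blinfun.bounded_linear_right])
  have ket: "f X o\<^sub>L ?E (ket \<delta>) = ?E (blinfun_apply (M i) (ket \<delta>))" for \<delta>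
  proof -
    have "(\<lambda>k. hom_part (a i) k X) sums f X"
      using f X by (simp add: has_free_expansion_def hom_part_def)
    then have "(\<lambda>k. hom_part (a i) k X o\<^sub>L word_prod X \<delta>) sums (f X o\<^sub>L word_prod X \<delta>)"
      by (rule bounded_linear.sums[OF bounded_bilinear.bounded_linear_left[OF bounded_bilinear_blinfun_compose]])
    then have "(\<lambda>k. hom_part (ell2_apply (blinfun_apply (M i) (ket \<delta>))) (k + length \<delta>) X) sums (f X o\<^sub>L word_prod X \<delta>)"
      by (simp only: hom_part_M_ket_shift)
    \<comment> \<open>Degrees below \<open>length \<delta>\<close> contribute nothing, so undoing
      the shift does not change the sum.\<close>
    then have "(\<lambda>k. hom_part (ell2_apply (blinfun_apply (M i) (ket \<delta>))) k X) sums (f X o\<^sub>L word_prod X \<delta>)"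
      by (subst (asm) sums_zero_iff_shift) (simp_all add: hom_part_M_ket_less)
    then show ?thesis
      unfolding free_eval_ket by (simp add: free_eval_def sums_iff)
  qed
  show ?thesis
  proof (rule ell2_continuous_eqI[OF lin1 lin2])
    fix F :: "'n list set" and p
    have "f X o\<^sub>L ?E (p \<delta> *\<^sub>C ket \<delta>) = ?E (blinfun_apply (M i) (p \<delta> *\<^sub>C ket \<delta>))" for \<delta>
    proof -
      have "f X o\<^sub>L ?E (p \<delta> *\<^sub>C ket \<delta>) = op_scaleC (p \<delta>) (f X o\<^sub>L ?E (ket \<delta>))"
        using lin by (intro blinfun_eqI) (simp add: free_eval_scaleC[OF X] op_scaleC.rep_eq complex_linear_def)
      moreover have "?E (blinfun_apply (M i) (p \<delta> *\<^sub>C ket \<delta>)) = op_scaleC (p \<delta>) (?E (blinfun_apply (M i) (ket \<delta>)))"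
        using linear_M[of i] by (simp add: complex_linear_def free_eval_scaleC[OF X])
      ultimately show ?thesis
        by (simp only: ket)
    qed
    then show "f X o\<^sub>L ?E (\<Sum>\<delta>\<in>F. p \<delta> *\<^sub>C ket \<delta>) = ?E (blinfun_apply (M i) (\<Sum>\<delta>\<in>F. p \<delta> *\<^sub>C ket \<delta>))"
      by (simp only: linear_sum[OF bounded_linear.linear[OF lin1]] linear_sum[OF bounded_linear.linear[OF lin2]])
  qed
qed

text \<open>The coefficients of \<open>\<phi>\<^sub>\<alpha>\<close>: multipliers applied
  successively to \<open>ket []\<close>, which stands for the constant function
  \<open>1\<close>.\<close>

definition word_vec :: "'n list \<Rightarrow> 'n list ell2" where
  "word_vec \<alpha> = blinfun_apply (word_prod M \<alpha>) (ket [])"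

lemma word_vec_Cons: "word_vec (i # \<alpha>) = blinfun_apply (M i) (word_vec \<alpha>)"
  by (simp add: word_vec_def)

lemma free_eval_word_vec:
  assumes \<phi>: "\<And>i. has_free_expansion (\<phi> i) (a i)" and X: "X \<in> nc_ball"
    and lin: "\<And>i. complex_linear (\<phi> i X)"
  shows "free_eval (ell2_apply (word_vec \<alpha>)) X = word_prod (\<lambda>i. \<phi> i X) \<alpha>"
proof (induction \<alpha>)
  case Nil
  show ?case
    by (simp add: word_vec_def free_eval_ket)
next
  case (Cons i \<alpha>)
  show ?case
    unfolding word_vec_Cons free_eval_M[OF \<phi> X lin, symmetric] Cons.IH by simp
qed

text \<open>The empty word has only the trivial factorisation, so constant terms multiply.
  Consequently the constant term of \<open>\<phi>\<^sub>\<alpha>\<close> is the monomial \<alpha>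
  evaluated at the scalars \<open>a i []\<close>.\<close>

lemma M_apply_Nil: "ell2_apply (blinfun_apply (M i) g) [] = a i [] * ell2_apply g []"
proof (rule ell2_continuous_eqI)
  show "bounded_linear (\<lambda>g. ell2_apply (blinfun_apply (M i) g) [])"
    by (rule bounded_linear_compose[OF bounded_linear_ell2_apply blinfun.bounded_linear_right])
  show "bounded_linear (\<lambda>g. a i [] * ell2_apply g [])"
    by (intro bounded_linear_const_mult bounded_linear_ell2_apply)
  have "ell2_apply (blinfun_apply (M i) (ket \<delta>)) [] = a i [] * ell2_apply (ket \<delta>) []" for \<delta>
  proof (cases "\<delta> = []")
    case False
    then have "{\<beta> :: 'n list. \<beta> @ \<delta> = []} = {}"
      by auto
    then show ?thesis
      unfolding M_ket using False by (simp add: ket.rep_eq)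
  qed (simp add: M_ket ket.rep_eq)
  then show "ell2_apply (blinfun_apply (M i) (\<Sum>\<delta>\<in>F. p \<delta> *\<^sub>C ket \<delta>)) []
      = a i [] * ell2_apply (\<Sum>\<delta>\<in>F. p \<delta> *\<^sub>C ket \<delta>) []" for F p
    using linear_M[of i]
    by (simp add: blinfun.sum_right complex_linear_def ell2_apply_sum ell2_simps sum_distrib_left mult.left_commute)
qed

lemma word_vec_Nil: "ell2_apply (word_vec \<alpha>) [] = (\<Prod>i\<leftarrow>\<alpha>. a i [])"
  by (induction \<alpha>) (simp_all add: word_vec_Cons M_apply_Nil, simp add: word_vec_def ket.rep_eq)

text \<open>The power on the right, multiplied out letter by letter, runs through all words of
  length \<open>k\<close>; the constant terms thus decay geometrically once the base is below
  \<open>1\<close>.\<close>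

lemma sum_words_prod_sq:
  "(\<Sum>\<alpha> | length \<alpha> = k. (cmod (\<Prod>i\<leftarrow>\<alpha>. a i []))\<^sup>2) = (\<Sum>i\<in>UNIV. (cmod (a i []))\<^sup>2) ^ k"
  by (induction k)
    (simp_all add: sum_words_Suc norm_mult power_mult_distrib sum_distrib_right flip: sum_distrib_left)

end

subsection \<open>Boundedness of composition operators\<close>

lemma sum_geometric_le:
  fixes \<rho> :: real
  assumes "0 < \<rho>" "\<rho> < 1"
  shows "(\<Sum>k<d. \<rho> ^ k) \<le> 1 / (1 - \<rho>)"
proof -
  have "(\<Sum>k<d. \<rho> ^ k) \<le> (\<Sum>k. \<rho> ^ k)"
    using assms by (intro sum_le_suminf) (simp_all add: summable_geometric)
  then show ?thesis
    using assms by (simp add: suminf_geometric)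
qed

text \<open>The scalars \<open>a i []\<close> are the coordinates of \<open>\<phi>(0)\<close>, and
  \<rho> bounds its Euclidean norm.\<close>

locale free_multipliers_strict = free_multipliers +
  fixes \<rho> :: real
  assumes \<rho>: "0 < \<rho>" "\<rho> < 1" and const_le: "(\<Sum>i\<in>UNIV. (cmod (a i []))\<^sup>2) \<le> \<rho>\<^sup>2"
begin

text \<open>Cauchy-Schwarz with the weights \<open>\<rho> ^ length \<alpha>\<close>.\<close>

lemma constant_term_bound:
  "(cmod (\<Sum>\<alpha> | length \<alpha> < d. p \<alpha> * (\<Prod>i\<leftarrow>\<alpha>. a i [])))\<^sup>2
    \<le> 1 / (1 - \<rho>) * (\<Sum>\<alpha> | length \<alpha> < d. \<rho> ^ length \<alpha> * (cmod (p \<alpha>))\<^sup>2)"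
proof -
  let ?W = "{\<alpha> :: 'a list. length \<alpha> < d}"
  let ?l = "\<lambda>\<alpha>. cmod (\<Prod>i\<leftarrow>\<alpha>. a i [])"
  let ?f = "\<lambda>\<alpha>. sqrt \<rho> ^ length \<alpha> * cmod (p \<alpha>)"
  let ?g = "\<lambda>\<alpha>. ?l \<alpha> / sqrt \<rho> ^ length \<alpha>"
  have sq: "(sqrt \<rho> ^ k)\<^sup>2 = \<rho> ^ k" for k
    using \<rho>(1) by (simp flip: power_mult add: mult.commute[of k 2]) (simp add: power_mult)
  have "cmod (\<Sum>\<alpha>\<in>?W. p \<alpha> * (\<Prod>i\<leftarrow>\<alpha>. a i [])) \<le> (\<Sum>\<alpha>\<in>?W. \<bar>?f \<alpha>\<bar> * \<bar>?g \<alpha>\<bar>)"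
    by (rule order_trans[OF norm_sum sum_mono]) (use \<rho>(1) in \<open>simp add: norm_mult\<close>)
  also have "\<dots> \<le> L2_set ?f ?W * L2_set ?g ?W"
    by (rule L2_set_mult_ineq)
  finally have "(cmod (\<Sum>\<alpha>\<in>?W. p \<alpha> * (\<Prod>i\<leftarrow>\<alpha>. a i [])))\<^sup>2 \<le> (L2_set ?f ?W * L2_set ?g ?W)\<^sup>2"
    by (intro power_mono) auto
  also have "\<dots> = (L2_set ?g ?W)\<^sup>2 * (L2_set ?f ?W)\<^sup>2"
    by (simp only: power_mult_distrib mult.commute)
  also have "(L2_set ?f ?W)\<^sup>2 = (\<Sum>\<alpha>\<in>?W. \<rho> ^ length \<alpha> * (cmod (p \<alpha>))\<^sup>2)"
    by (simp only: L2_set_power2 power_mult_distrib sq)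
  also have "(L2_set ?g ?W)\<^sup>2 * (\<Sum>\<alpha>\<in>?W. \<rho> ^ length \<alpha> * (cmod (p \<alpha>))\<^sup>2)
      \<le> 1 / (1 - \<rho>) * (\<Sum>\<alpha>\<in>?W. \<rho> ^ length \<alpha> * (cmod (p \<alpha>))\<^sup>2)"
  proof (rule mult_right_mono)
    have "(L2_set ?g ?W)\<^sup>2 = (\<Sum>k<d. \<Sum>\<alpha> | length \<alpha> = k. (?l \<alpha>)\<^sup>2 / \<rho> ^ length \<alpha>)"
      by (simp only: L2_set_power2 power_divide sq sum_words_by_length)
    also have "\<dots> = (\<Sum>k<d. (\<Sum>\<alpha> | length \<alpha> = k. (?l \<alpha>)\<^sup>2) / \<rho> ^ k)"
      by (simp add: sum_divide_distrib)
    \<comment> \<open>The constant terms of words of length \<open>k\<close> have sum of squares at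
      most \<open>\<rho> ^ (2 * k)\<close>; dividing by the weight uses up half of the
      exponent.\<close>
    also have "\<dots> \<le> (\<Sum>k<d. \<rho> ^ k)"
    proof (rule sum_mono)
      fix k
      have "(\<Sum>i\<in>UNIV. (cmod (a i []))\<^sup>2) ^ k \<le> (\<rho>\<^sup>2) ^ k"
        by (intro power_mono const_le) (simp add: sum_nonneg)
      also have "\<dots> = \<rho> ^ k * \<rho> ^ k"
        by (simp add: power2_eq_square power_mult_distrib)
      finally show "(\<Sum>\<alpha> | length \<alpha> = k. (?l \<alpha>)\<^sup>2) / \<rho> ^ k \<le> \<rho> ^ k"
        using \<rho>(1) unfolding sum_words_prod_sq by (simp add: divide_le_eq)
    qed
    also have "\<dots> \<le> 1 / (1 - \<rho>)"
      by (rule sum_geometric_le[OF \<rho>])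
    finally show "(L2_set ?g ?W)\<^sup>2 \<le> 1 / (1 - \<rho>)" .
  qed (use \<rho>(1) in \<open>simp add: sum_nonneg\<close>)
  finally show ?thesis .
qed

text \<open>Split off the constant term: with \<open>v = \<Sum>i. M i (v\<^sub>i)\<close> one has
  \<open>\<parallel>c *\<^sub>C ket [] + v\<parallel>\<^sup>2 = \<bar>c\<bar>\<^sup>2 + 2 Re (c * cnj (v [])) + \<parallel>v\<parallel>\<^sup>2 \<le> \<bar>c + v []\<bar>\<^sup>2 + \<Sum>i. \<parallel>v\<^sub>i\<parallel>\<^sup>2\<close>, and
  \<open>c + v []\<close> is the value at \<open>0\<close> of the composition.\<close>

lemma norm_sum_word_vec_weighted:
  "(norm (\<Sum>\<alpha> | length \<alpha> < d. p \<alpha> *\<^sub>C word_vec \<alpha>))\<^sup>2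
    \<le> 1 / (1 - \<rho>) * (\<Sum>\<alpha> | length \<alpha> < d. (\<Sum>k<Suc (length \<alpha>). \<rho> ^ k) * (cmod (p \<alpha>))\<^sup>2)"
proof (induction d arbitrary: p)
  case (Suc d)
  let ?A = "1 / (1 - \<rho>)"
  let ?W = "{\<alpha> :: 'a list. length \<alpha> < d}"
  let ?w = "\<lambda>n. \<Sum>k<n. \<rho> ^ k"
  define v where "v i = (\<Sum>\<alpha>\<in>?W. p (i # \<alpha>) *\<^sub>C word_vec \<alpha>)" for i
  define u where "u = (\<Sum>i\<in>UNIV. blinfun_apply (M i) (v i))"
  let ?s = "\<Sum>\<alpha> | length \<alpha> < Suc d. p \<alpha> *\<^sub>C word_vec \<alpha>"
  have s: "?s = p [] *\<^sub>C ket [] + u"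
    using linear_M
    by (simp add: sum_words_less_Suc u_def v_def word_vec_Cons blinfun.sum_right complex_linear_def)
      (simp add: word_vec_def)
  have "p [] + ell2_apply u [] = ell2_apply ?s []"
    unfolding s by (simp add: ell2_simps ket.rep_eq)
  also have "\<dots> = (\<Sum>\<alpha> | length \<alpha> < Suc d. p \<alpha> * (\<Prod>i\<leftarrow>\<alpha>. a i []))"
    by (simp only: ell2_apply_sum ell2_simps word_vec_Nil)
  finally have const: "(cmod (p [] + ell2_apply u []))\<^sup>2
      \<le> ?A * (\<Sum>\<alpha> | length \<alpha> < Suc d. \<rho> ^ length \<alpha> * (cmod (p \<alpha>))\<^sup>2)"
    using constant_term_bound[of p "Suc d"] by simp
  have "norm u \<le> L2_set (\<lambda>i. norm (v i)) UNIV"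
    unfolding u_def using row_boundD[OF row_bound_M, of v] by simp
  then have "(norm u)\<^sup>2 \<le> (\<Sum>i\<in>UNIV. (norm (v i))\<^sup>2)"
    using power_mono[of "norm u" "L2_set (\<lambda>i. norm (v i)) UNIV" 2] by (simp add: L2_set_power2)
  also have "\<dots> \<le> (\<Sum>i\<in>UNIV. ?A * (\<Sum>\<alpha>\<in>?W. ?w (Suc (length \<alpha>)) * (cmod (p (i # \<alpha>)))\<^sup>2))"
    unfolding v_def by (intro sum_mono Suc.IH)
  \<comment> \<open>Prefixing a letter turns \<open>Suc (length \<alpha>)\<close> into the length of
    the new word, and the empty word enters with weight \<open>?w 0 = 0\<close>. The missing last
    power of \<rho> is supplied by the constant term.\<close>
  also have "\<dots> = ?A * (\<Sum>\<alpha> | length \<alpha> < Suc d. ?w (length \<alpha>) * (cmod (p \<alpha>))\<^sup>2)"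
    unfolding sum_words_less_Suc by (simp add: sum_distrib_left)
  finally have u: "(norm u)\<^sup>2 \<le> ?A * (\<Sum>\<alpha> | length \<alpha> < Suc d. ?w (length \<alpha>) * (cmod (p \<alpha>))\<^sup>2)" .
  have "cinner (p [] *\<^sub>C ket []) u = p [] * cnj (ell2_apply u [])"
    using cinner_commute[of "ket []" u] by (simp add: cinner_scaleC_left cinner_ket)
  then have "(norm ?s)\<^sup>2 = (cmod (p []))\<^sup>2 + 2 * Re (p [] * cnj (ell2_apply u [])) + (norm u)\<^sup>2"
    unfolding s norm_add_sq by (simp add: norm_scaleC norm_ket)
  also have "\<dots> \<le> (cmod (p [] + ell2_apply u []))\<^sup>2 + (norm u)\<^sup>2"
    unfolding cmod_power2 by (simp add: power2_eq_square algebra_simps)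
  also have "\<dots> \<le> ?A * (\<Sum>\<alpha> | length \<alpha> < Suc d. \<rho> ^ length \<alpha> * (cmod (p \<alpha>))\<^sup>2)
      + ?A * (\<Sum>\<alpha> | length \<alpha> < Suc d. ?w (length \<alpha>) * (cmod (p \<alpha>))\<^sup>2)"
    by (intro add_mono const u)
  also have "\<dots> = ?A * (\<Sum>\<alpha> | length \<alpha> < Suc d. ?w (Suc (length \<alpha>)) * (cmod (p \<alpha>))\<^sup>2)"
    by (simp only: distrib_left[symmetric] sum.distrib[symmetric] distrib_right[symmetric] sum.lessThan_Suc add.commute)
  finally show ?case .
qed simp

text \<open>Padding \<open>p\<close> with zeros reduces an arbitrary finite set to all words below
  some length, where every weight is at most \<open>1 / (1 - \<rho>)\<close>.\<close>

lemma norm_sum_word_vec_le: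
  assumes "finite F"
  shows "norm (\<Sum>\<alpha>\<in>F. p \<alpha> *\<^sub>C word_vec \<alpha>) \<le> 1 / (1 - \<rho>) * L2_set (\<lambda>\<alpha>. cmod (p \<alpha>)) F"
proof -
  let ?A = "1 / (1 - \<rho>)"
  define d where "d = Suc (Max (insert 0 (length ` F)))"
  have len: "length \<alpha> < d" if "\<alpha> \<in> F" for \<alpha>
    unfolding d_def less_Suc_eq_le by (rule Max_ge) (use assms that in auto)
  let ?W = "{\<alpha> :: 'a list. length \<alpha> < d}"
  let ?q = "\<lambda>\<alpha>. if \<alpha> \<in> F then p \<alpha> else 0"
  have sum_q: "(\<Sum>\<alpha>\<in>?W. f \<alpha> (?q \<alpha>)) = (\<Sum>\<alpha>\<in>F. f \<alpha> (p \<alpha>))" if "\<And>\<alpha>. f \<alpha> 0 = 0"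
    for f :: "'a list \<Rightarrow> complex \<Rightarrow> 'b::comm_monoid_add"
    by (rule sum.mono_neutral_cong_right) (use len that in \<open>auto simp: finite_words_less\<close>)
  have "(norm (\<Sum>\<alpha>\<in>F. p \<alpha> *\<^sub>C word_vec \<alpha>))\<^sup>2 = (norm (\<Sum>\<alpha>\<in>?W. ?q \<alpha> *\<^sub>C word_vec \<alpha>))\<^sup>2"
    using sum_q[of "\<lambda>\<alpha> c. c *\<^sub>C word_vec \<alpha>"] by simp
  also have "\<dots> \<le> ?A * (\<Sum>\<alpha>\<in>?W. (\<Sum>k<Suc (length \<alpha>). \<rho> ^ k) * (cmod (?q \<alpha>))\<^sup>2)"
    by (rule norm_sum_word_vec_weighted)
  also have "\<dots> \<le> ?A * (\<Sum>\<alpha>\<in>?W. ?A * (cmod (?q \<alpha>))\<^sup>2)"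
    using \<rho> by (intro mult_left_mono sum_mono mult_right_mono sum_geometric_le) simp_all
  also have "\<dots> = ?A * (\<Sum>\<alpha>\<in>F. ?A * (cmod (p \<alpha>))\<^sup>2)"
    using sum_q[of "\<lambda>\<alpha> c. ?A * (cmod c)\<^sup>2"] by simp
  also have "\<dots> = (?A * L2_set (\<lambda>\<alpha>. cmod (p \<alpha>)) F)\<^sup>2"
    by (simp only: power_mult_distrib L2_set_power2 sum_distrib_left[symmetric]) (simp add: power2_eq_square)
  finally show ?thesis
    by (rule power2_le_imp_le) (use \<rho> in \<open>simp add: L2_set_nonneg\<close>)
qed

lemma composition_operator_exists:
  "\<exists>T. complex_linear T \<and> (\<forall>\<alpha>. blinfun_apply T (ket \<alpha>) = word_vec \<alpha>)"
  using norm_sum_word_vec_le by (rule ell2_operator_exists)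

end

subsection \<open>The space of square summable free holomorphic functions\<close>

definition h2_vec :: "('n::finite, 'h::complex_hilbert) ball_fun \<Rightarrow> 'n list ell2" where
  "h2_vec f = Abs_ell2 (free_coeff f)"

lemma has_free_expansion_uminus:
  assumes "has_free_expansion f a"
  shows "has_free_expansion (\<lambda>X. - f X) (\<lambda>\<alpha>. - a \<alpha>)"
proof -
  have "op_scaleC (- c) A = - op_scaleC c A" for c and A :: "'b operator"
    by (rule blinfun_eqI) (simp add: op_scaleC.rep_eq uminus_blinfun.rep_eq)
  then show ?thesis
    using assms by (auto simp: has_free_expansion_def sum_negf intro: sums_minus)
qed

lemma has_free_expansion_uminus_iff:
  "has_free_expansion (\<lambda>X. - f X) a \<longleftrightarrow> has_free_expansion f (\<lambda>\<alpha>. - a \<alpha>)"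
  using has_free_expansion_uminus[of "\<lambda>X. - f X" a] has_free_expansion_uminus[of f "\<lambda>\<alpha>. - a \<alpha>"] by auto

context
  assumes inf: "infinite_dimensional TYPE('h::complex_hilbert)"
begin

lemma free_coeff_h2_fun: "free_coeff (h2_fun c :: ('n::finite, 'h) ball_fun) = ell2_apply c"
  by (rule free_coeff_eq[OF inf has_free_expansion_h2_fun])

lemma h2_vec_h2_fun: "h2_vec (h2_fun c :: ('n::finite, 'h) ball_fun) = c"
  by (simp add: h2_vec_def free_coeff_h2_fun ell2_apply_inverse)

lemma h2_fun_in_H2_ball: "(h2_fun c :: ('n::finite, 'h) ball_fun) \<in> H2_ball"
  using has_free_expansion_h2_fun[of c]
  by (auto simp: H2_ball_def free_holomorphic_def free_coeff_h2_fun ell2_summable)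

lemma ell2_apply_h2_vec:
  fixes f :: "('n::finite, 'h) ball_fun"
  assumes "f \<in> H2_ball"
  shows "ell2_apply (h2_vec f) = free_coeff f"
  using assms by (simp add: h2_vec_def H2_ball_def Abs_ell2_inverse)

lemma h2_fun_h2_vec:
  fixes f :: "('n::finite, 'h) ball_fun"
  assumes f: "f \<in> H2_ball"
  shows "h2_fun (h2_vec f) = f"
proof (rule ext)
  fix X :: "'n \<Rightarrow> 'h operator"
  obtain a where a: "has_free_expansion f a"
    using f by (auto simp: H2_ball_def free_holomorphic_def)
  then have "has_free_expansion f (free_coeff f)"
    by (simp add: free_coeff_eq[OF inf])
  then show "h2_fun (h2_vec f) X = f X"
    unfolding h2_fun_def ell2_apply_h2_vec[OF f] free_eval_def hom_part_def has_free_expansion_def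
    by (simp add: sums_iff)
qed

lemma H2_ball_eq: "(H2_ball :: ('n::finite, 'h) ball_fun set) = range h2_fun"
  using h2_fun_in_H2_ball h2_fun_h2_vec by (auto intro: range_eqI[OF sym])

lemma inj_h2_fun: "inj (h2_fun :: _ \<Rightarrow> ('n::finite, 'h) ball_fun)"
  by (rule inj_on_inverseI[where g = h2_vec]) (rule h2_vec_h2_fun)

lemma H2_norm_h2_fun: "H2_norm (h2_fun c :: ('n::finite, 'h) ball_fun) = norm c"
  by (simp add: H2_norm_def free_coeff_h2_fun norm_ell2.rep_eq)

lemma H2_inner_h2_fun: "H2_inner (h2_fun c :: ('n::finite, 'h) ball_fun) (h2_fun d) = cinner c d"
  by (simp add: H2_inner_def free_coeff_h2_fun cinner_ell2.rep_eq)

lemma h2_fun_add: "h2_fun (c + d) = (\<lambda>X. h2_fun c X + h2_fun d X)"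
  by (rule ext) (simp add: h2_fun_def linear_add[OF bounded_linear.linear[OF bounded_linear_free_eval]])

lemma h2_fun_diff: "h2_fun (c - d) = (\<lambda>X. h2_fun c X - h2_fun d X)"
  by (rule ext) (simp add: h2_fun_def linear_diff[OF bounded_linear.linear[OF bounded_linear_free_eval]])

lemma h2_fun_scaleC: "h2_fun (r *\<^sub>C c) = (\<lambda>X. op_scaleC r (h2_fun c X))"
  by (rule ext)
    (simp add: h2_fun_def free_eval_scaleC linear_0[OF bounded_linear.linear[OF bounded_linear_op_scaleC]])

lemma H2_dist_h2_fun: "H2_dist (h2_fun c :: ('n::finite, 'h) ball_fun) (h2_fun d) = dist c d"
  by (simp add: H2_dist_def h2_fun_diff[symmetric] H2_norm_h2_fun dist_norm)

lemma H2_unit_ball_eq: "(H2_unit_ball :: ('n::finite, 'h) ball_fun set) = h2_fun ` cball 0 1"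
  unfolding H2_unit_ball_def H2_ball_eq by (auto simp: H2_norm_h2_fun)

text \<open>Symmetry of the distance is required off \<^const>\<open>H2_ball\<close> as well: a function without
  expansion has the same unspecified coefficients as its negative.\<close>

lemma Metric_space_H2: "Metric_space (H2_ball :: ('n::finite, 'h) ball_fun set) H2_dist"
proof
  fix f g h :: "('n, 'h) ball_fun"
  show "0 \<le> H2_dist f g"
    by (simp add: H2_dist_def H2_norm_def infsum_nonneg)
  have "H2_norm (\<lambda>X. - u X) = H2_norm u" for u :: "('n, 'h) ball_fun"
  proof (cases "\<exists>a. has_free_expansion u a")
    case True
    then obtain a where a: "has_free_expansion u a"
      by blast
    show ?thesis
      unfolding H2_norm_def free_coeff_eq[OF inf a] free_coeff_eq[OF inf has_free_expansion_uminus[OF a]]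
      by simp
  next
    case False
    then have "free_coeff (\<lambda>X. - u X) = free_coeff u"
      by (simp add: free_coeff_def has_free_expansion_uminus_iff)
    then show ?thesis
      by (simp add: H2_norm_def)
  qed
  from this[of "\<lambda>X. f X - g X"] show "H2_dist f g = H2_dist g f"
    by (simp add: H2_dist_def)
  show "H2_dist f g = 0 \<longleftrightarrow> f = g" if "f \<in> H2_ball" "g \<in> H2_ball"
    using that inj_h2_fun unfolding H2_ball_eq by (auto simp: H2_dist_h2_fun inj_eq)
  show "H2_dist f h \<le> H2_dist f g + H2_dist g h" if "f \<in> H2_ball" "g \<in> H2_ball" "h \<in> H2_ball"
    using that unfolding H2_ball_eq by (auto simp: H2_dist_h2_fun dist_triangle)
qed

lemma openin_H2_topology:
  fixes U :: "('n::finite, 'h) ball_fun set"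
  shows "openin H2_topology U \<longleftrightarrow> U \<subseteq> H2_ball \<and> open (h2_fun -` U)"
proof -
  have "(\<forall>f. f \<in> U \<longrightarrow> (\<exists>r>0. Metric_space.mball H2_ball H2_dist f r \<subseteq> U)) \<longleftrightarrow>
      (\<forall>c. h2_fun c \<in> U \<longrightarrow> (\<exists>r>0. \<forall>d. dist d c < r \<longrightarrow> h2_fun d \<in> U))" if "U \<subseteq> H2_ball"
  proof -
    have "Metric_space.mball H2_ball H2_dist (h2_fun c) r \<subseteq> U \<longleftrightarrow> (\<forall>d. dist d c < r \<longrightarrow> h2_fun d \<in> U)" for c r
      unfolding Metric_space.mball_def[OF Metric_space_H2]
      by (auto simp: H2_ball_eq H2_dist_h2_fun dist_commute)
    moreover have "(\<forall>f. f \<in> U \<longrightarrow> P f) \<longleftrightarrow> (\<forall>c. h2_fun c \<in> U \<longrightarrow> P (h2_fun c))" for P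
      using that unfolding H2_ball_eq by blast
    ultimately show ?thesis
      by simp
  qed
  then show ?thesis
    unfolding Metric_space.openin_mtopology[OF Metric_space_H2] open_dist by auto
qed

text \<open>\<open>h2_fun\<close> is an isometry onto \<open>H2_ball\<close>, so closures and
  compactness in \<open>H2_topology\<close> can be computed in \<open>ell2\<close>.\<close>

lemma homeomorphic_map_h2_fun:
  "homeomorphic_map euclidean (H2_topology :: ('n::finite, 'h) ball_fun topology) h2_fun"
proof (rule bijective_open_imp_homeomorphic_map)
  show "continuous_map euclidean (H2_topology :: ('n, 'h) ball_fun topology) h2_fun"
    unfolding continuous_map
    by (auto simp: Metric_space.topspace_mtopology[OF Metric_space_H2] openin_H2_topology vimage_def
        h2_fun_in_H2_ball)
  show "open_map euclidean (H2_topology :: ('n, 'h) ball_fun topology) h2_fun"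
    unfolding open_map_def
    by (auto simp: openin_H2_topology inj_vimage_image_eq[OF inj_h2_fun] h2_fun_in_H2_ball)
  show "h2_fun ` topspace euclidean = topspace (H2_topology :: ('n, 'h) ball_fun topology)"
    by (simp only: Metric_space.topspace_mtopology[OF Metric_space_H2]) (simp add: H2_ball_eq)
qed (use inj_h2_fun in simp)

lemma compactin_closure_h2_fun:
  "compactin (H2_topology :: ('n::finite, 'h) ball_fun topology) (H2_topology closure_of (h2_fun ` S))
    \<longleftrightarrow> compact (closure S)"
  by (simp add: homeomorphic_map_closure_of[OF homeomorphic_map_h2_fun]
      homeomorphic_map_compactness[OF homeomorphic_map_h2_fun])

section \<open>Operators on functions and operators on coefficients\<close>

definition represents ::
  "(('n::finite, 'h) ball_fun \<Rightarrow> ('n, 'h) ball_fun) \<Rightarrow> 'n list ell2 operator \<Rightarrow> bool" where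
  "represents T' T \<longleftrightarrow> (\<forall>c. T' (h2_fun c) = h2_fun (blinfun_apply T c))"

lemma represents_image:
  "represents T' T \<Longrightarrow> T' ` H2_unit_ball = h2_fun ` (blinfun_apply T ` cball 0 1)"
  unfolding H2_unit_ball_eq by (simp add: represents_def image_image)

lemma represents_linear:
  fixes T' :: "('n::finite, 'h) ball_fun \<Rightarrow> ('n, 'h) ball_fun"
  assumes T: "represents T' T" and lin: "complex_linear T"
  shows "H2_linear T'"
proof -
  note T = T[unfolded represents_def, rule_format]
  show ?thesis
    unfolding H2_linear_def H2_ball_eq
  proof (intro conjI ballI allI)
    show "T' \<in> range h2_fun \<rightarrow> range h2_fun"
      by (auto simp: T)
    show "T' (\<lambda>X. f X + g X) = (\<lambda>X. T' f X + T' g X)"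
      if fg: "f \<in> range h2_fun" "g \<in> range h2_fun" for f g
    proof -
      obtain c d where "f = h2_fun c" "g = h2_fun d"
        using fg by blast
      then show ?thesis
        by (simp only: T h2_fun_add[symmetric] blinfun.add_right)
    qed
    show "T' (\<lambda>X. op_scaleC r (f X)) = (\<lambda>X. op_scaleC r (T' f X))" if f: "f \<in> range h2_fun" for r f
    proof -
      obtain c where "f = h2_fun c"
        using f by blast
      then show ?thesis
        using lin by (simp only: T h2_fun_scaleC[symmetric] complex_linear_def)
    qed
  qed
qed

lemma represents_compact:
  fixes T' :: "('n::finite, 'h) ball_fun \<Rightarrow> ('n, 'h) ball_fun"
  assumes "represents T' T" "complex_linear T"
  shows "H2_compact_op T' \<longleftrightarrow> compact_operator T"
  unfolding H2_compact_op_def compact_operator_def represents_image[OF assms(1)] compactin_closure_h2_fun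
  using assms(2) represents_linear[OF assms] by simp

lemma represents_op_norm:
  fixes T' K' :: "('n::finite, 'h) ball_fun \<Rightarrow> ('n, 'h) ball_fun"
  assumes "represents T' T" "represents K' K"
  shows "H2_op_norm (\<lambda>f X. T' f X - K' f X) = norm (T - K)"
proof -
  have "H2_norm (\<lambda>X. T' (h2_fun c) X - K' (h2_fun c) X) = norm (blinfun_apply (T - K) c)" for c
    using assms
    by (simp add: represents_def h2_fun_diff[symmetric] H2_norm_h2_fun minus_blinfun.rep_eq)
  then show ?thesis
    unfolding H2_op_norm_def H2_unit_ball_eq norm_blinfun_eq_SUP[of "T - K"] by (simp add: image_image)
qed

text \<open>\<open>H2_linear\<close> contains no boundedness. Here it comes from compactness: the
  closure of the image of the unit ball is compact, hence bounded, and homogeneity turns this into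
  an operator bound.\<close>

lemma H2_compact_op_represents:
  fixes K' :: "('n::finite, 'h) ball_fun \<Rightarrow> ('n, 'h) ball_fun"
  assumes K': "H2_compact_op K'"
  shows "\<exists>K. compact_operator K \<and> represents K' K"
proof -
  define K where "K c = h2_vec (K' (h2_fun c))" for c
  have lin: "H2_linear K'"
    using K' by (simp add: H2_compact_op_def)
  have "K' (h2_fun c) \<in> H2_ball" for c
    using lin by (simp add: H2_linear_def Pi_iff h2_fun_in_H2_ball)
  then have K: "K' (h2_fun c) = h2_fun (K c)" for c
    unfolding K_def by (simp add: h2_fun_h2_vec)
  have inj: "c = d" if "(h2_fun c :: ('n, 'h) ball_fun) = h2_fun d" for c d
    by (rule injD[OF inj_h2_fun that])
  have add: "K (c + d) = K c + K d" for c d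
  proof (rule inj)
    have "K' (\<lambda>X. h2_fun c X + h2_fun d X) = (\<lambda>X. K' (h2_fun c) X + K' (h2_fun d) X)"
      using lin by (simp add: H2_linear_def h2_fun_in_H2_ball)
    then show "(h2_fun (K (c + d)) :: ('n, 'h) ball_fun) = h2_fun (K c + K d)"
      by (simp only: K[symmetric] h2_fun_add)
  qed
  have scale: "K (r *\<^sub>C c) = r *\<^sub>C K c" for r c
  proof (rule inj)
    have "K' (\<lambda>X. op_scaleC r (h2_fun c X)) = (\<lambda>X. op_scaleC r (K' (h2_fun c) X))"
      using lin by (simp add: H2_linear_def h2_fun_in_H2_ball)
    then show "(h2_fun (K (r *\<^sub>C c)) :: ('n, 'h) ball_fun) = h2_fun (r *\<^sub>C K c)"
      by (simp only: K[symmetric] h2_fun_scaleC)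
  qed
  have image: "K' ` H2_unit_ball = h2_fun ` (K ` cball 0 1)"
    unfolding H2_unit_ball_eq by (simp add: K image_image)
  have cpt: "compact (closure (K ` cball 0 1))"
    using K' unfolding H2_compact_op_def image compactin_closure_h2_fun by (rule conjunct2)
  then have "bounded (K ` cball 0 1)"
    by (rule bounded_subset[OF compact_imp_bounded closure_subset])
  then obtain B where B: "\<And>c. c \<in> cball 0 1 \<Longrightarrow> norm (K c) \<le> B"
    unfolding bounded_iff by blast
  have "bounded_linear K"
  proof (rule bounded_linear_intro[where K = B])
    show "K (r *\<^sub>R c) = r *\<^sub>R K c" for r c
      by (simp add: scaleR_scaleC scale)
    show "norm (K c) \<le> norm c * B" for c
    proof (cases "c = 0")
      case True
      then show ?thesis
        using scale[of 0 0] by simp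
    next
      case False
      have "norm (K (of_real (inverse (norm c)) *\<^sub>C c)) \<le> B"
        by (rule B) (use False in \<open>simp add: norm_scaleC norm_inverse\<close>)
      then have "inverse (norm c) * norm (K c) \<le> B"
        by (simp only: scale norm_scaleC norm_of_real abs_of_nonneg norm_ge_zero inverse_nonnegative_iff_nonnegative)
      then show ?thesis
        using False by (simp add: field_simps)
    qed
  qed (rule add)
  then have appK: "blinfun_apply (Blinfun K) = K"
    by (rule bounded_linear_Blinfun_apply)
  then have "represents K' (Blinfun K)"
    by (simp add: represents_def K)
  moreover have "compact_operator (Blinfun K)"
    using cpt scale by (simp add: compact_operator_def complex_linear_def appK)
  ultimately show ?thesis
    by blast
qed

text \<open>Both infima are taken over the same set of reals. A compact operator on coefficients is
  represented by many functions \<open>K'\<close>, which differ off \<open>H2_ball\<close> only and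
  give equal norms.\<close>

lemma represents_essential_norm:
  fixes T' :: "('n::finite, 'h) ball_fun \<Rightarrow> ('n, 'h) ball_fun"
  assumes T: "represents T' T"
  shows "H2_essential_norm T' = (INF K\<in>Collect compact_operator. norm (T - K))"
proof -
  have "(\<lambda>K'. H2_op_norm (\<lambda>f X. T' f X - K' f X)) ` Collect H2_compact_op
      = (\<lambda>K. norm (T - K)) ` Collect compact_operator"
  proof (rule set_eqI, rule iffI)
    fix r
    assume "r \<in> (\<lambda>K'. H2_op_norm (\<lambda>f X. T' f X - K' f X)) ` Collect H2_compact_op"
    then obtain K' where "H2_compact_op K'" and r: "r = H2_op_norm (\<lambda>f X. T' f X - K' f X)"
      by blast
    then obtain K where "compact_operator K" "represents K' K"
      using H2_compact_op_represents by blast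
    then show "r \<in> (\<lambda>K. norm (T - K)) ` Collect compact_operator"
      using r represents_op_norm[OF T] by auto
  next
    fix r
    assume "r \<in> (\<lambda>K. norm (T - K)) ` Collect compact_operator"
    then obtain K where K: "compact_operator K" and r: "r = norm (T - K)"
      by blast
    define K' :: "('n, 'h) ball_fun \<Rightarrow> ('n, 'h) ball_fun" where "K' f = h2_fun (blinfun_apply K (h2_vec f))" for f
    have K': "represents K' K"
      by (simp add: represents_def K'_def h2_vec_h2_fun)
    then have "H2_compact_op K'"
      using K represents_compact by (auto simp: compact_operator_def)
    then show "r \<in> (\<lambda>K'. H2_op_norm (\<lambda>f X. T' f X - K' f X)) ` Collect H2_compact_op"
      using r represents_op_norm[OF T K'] by (intro image_eqI[where x = K']) simp_all
  qed
  then show ?thesis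
    by (simp only: H2_essential_norm_def)
qed

text \<open>At the point \<open>0\<close> every series reduces to its constant term, so the
  multiples \<open>a i []\<close> of the identity form a point of the open ball.\<close>

lemma constant_terms_bound:
  fixes \<phi> :: "'n::finite \<Rightarrow> ('n, 'h) ball_fun"
  assumes a: "\<And>i. has_free_expansion (\<phi> i) (a i)" and maps: "\<forall>X\<in>nc_ball. (\<lambda>i. \<phi> i X) \<in> nc_ball"
  shows "\<exists>\<rho>. 0 < \<rho> \<and> \<rho> < 1 \<and> (\<Sum>i\<in>UNIV. (cmod (a i []))\<^sup>2) \<le> \<rho>\<^sup>2"
proof -
  let ?Z = "\<lambda>_ :: 'n. 0 :: 'h operator"
  have Z: "?Z \<in> nc_ball"
    by (rule zero_in_nc_ball)
  have "\<phi> i ?Z = op_scaleC (a i []) id_blinfun" for i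
  proof -
    have word: "word_prod ?Z \<alpha> = 0" if "\<alpha> \<noteq> []" for \<alpha>
      using that by (cases \<alpha>) (auto intro: blinfun_eqI)
    have "hom_part (a i) k ?Z = 0" if "k \<notin> {0}" for k
      unfolding hom_part_def
    proof (rule sum.neutral, rule ballI)
      fix \<alpha> :: "'n list"
      assume "\<alpha> \<in> {\<alpha>. length \<alpha> = k}"
      with that have "\<alpha> \<noteq> []"
        by auto
      then show "op_scaleC (a i \<alpha>) (word_prod ?Z \<alpha>) = 0"
        by (simp add: word linear_0[OF bounded_linear.linear[OF bounded_linear_op_scaleC]])
    qed
    then have "(\<lambda>k. hom_part (a i) k ?Z) sums (\<Sum>k\<in>{0}. hom_part (a i) k ?Z)"
      by (intro sums_finite) simp_all
    moreover have "(\<lambda>k. hom_part (a i) k ?Z) sums \<phi> i ?Z"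
      using a[of i] Z by (simp add: has_free_expansion_def hom_part_def)
    ultimately have "\<phi> i ?Z = (\<Sum>k\<in>{0}. hom_part (a i) k ?Z)"
      by (rule sums_unique2[rotated])
    then show ?thesis
      by (simp add: hom_part_def)
  qed
  with bspec[OF maps Z] have "(\<lambda>i. op_scaleC (a i []) id_blinfun :: 'h operator) \<in> nc_ball"
    by (simp only:)
  then obtain \<rho> where \<rho>: "0 < \<rho>" "\<rho> < 1" "row_bound (\<lambda>i. op_scaleC (a i []) (id_blinfun :: 'h operator)) \<rho>"
    using nc_ballD(2) by blast
  obtain e :: "unit \<Rightarrow> 'h" where e: "orthonormal_on e {()}"
    using orthonormal_exists[OF inf, of "{()}"] by auto
  have "complex_of_real ((norm (e ()))\<^sup>2) = 1"
    unfolding cinner_self[symmetric] using orthonormal_onD[OF e] by simp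
  then have ne: "norm (e ()) = 1"
    by (simp only: of_real_eq_1_iff power2_eq_1_iff) (use norm_ge_zero[of "e ()"] in linarith)
  let ?L = "L2_set (\<lambda>i. cmod (a i [])) UNIV"
  \<comment> \<open>The conjugates are the equality case of Cauchy-Schwarz: the tuple has norm
    \<open>?L\<close> and its image has norm \<open>?L\<^sup>2\<close>.\<close>
  have eval: "(\<Sum>i\<in>UNIV. blinfun_apply (op_scaleC (a i []) id_blinfun) (cnj (a i []) *\<^sub>C e ()))
      = of_real (?L\<^sup>2) *\<^sub>C e ()"
    by (simp only: L2_set_power2 of_real_sum complex_norm_square complex_vector.scale_sum_left
        op_scaleC.rep_eq blinfun_apply_id_blinfun scaleC_scaleC id_apply)
  have "?L\<^sup>2 \<le> \<rho> * ?L"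
    using row_boundD[OF \<rho>(3), of "\<lambda>i. cnj (a i []) *\<^sub>C e ()"]
    by (simp only: eval norm_scaleC ne norm_of_real complex_mod_cnj mult_1_right abs_power2)
  then have "?L * ?L \<le> ?L * \<rho>"
    by (simp only: power2_eq_square mult.commute)
  then have "?L \<le> \<rho>"
    by (rule mult_self_le_imp_le) (use \<rho>(1) in \<open>simp_all add: L2_set_nonneg\<close>)
  then have "?L\<^sup>2 \<le> \<rho>\<^sup>2"
    by (intro power_mono) (simp_all add: L2_set_nonneg)
  with \<rho> show ?thesis
    by (auto simp: L2_set_power2)
qed

text \<open>\<open>T\<close> is prescribed on monomials. For general \<open>c\<close>, cutting off
  at words shorter than \<open>n\<close> yields, after \<open>T\<close> and evaluation at
  \<open>X\<close>, exactly the partial sums of the series in \<open>composition_op\<close>, and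
  continuity identifies the limit.\<close>

lemma composition_represented:
  fixes \<phi> :: "'n::finite \<Rightarrow> ('n, 'h) ball_fun"
  assumes \<phi>: "free_holomorphic_self_map \<phi>"
  shows "\<exists>T. complex_linear T \<and> represents (composition_op \<phi>) T \<and>
    (\<forall>\<alpha>. word_map \<phi> \<alpha> = h2_fun (blinfun_apply T (ket \<alpha>)))"
proof -
  have maps: "\<forall>X\<in>nc_ball. (\<lambda>i. \<phi> i X) \<in> nc_ball"
    using \<phi> by (simp add: free_holomorphic_self_map_def)
  obtain a where a: "\<And>i. has_free_expansion (\<phi> i) (a i)"
    using \<phi> unfolding free_holomorphic_self_map_def free_holomorphic_def by metis
  obtain M where M: "free_multipliers M a"
    using multipliers_exist[where \<phi> = \<phi> and a = a, OF inf maps a] unfolding free_multipliers_def by blast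
  obtain \<rho> where \<rho>: "0 < \<rho>" "\<rho> < 1" "(\<Sum>i\<in>UNIV. (cmod (a i []))\<^sup>2) \<le> \<rho>\<^sup>2"
    using constant_terms_bound[where \<phi> = \<phi> and a = a, OF a maps] by blast
  interpret free_multipliers_strict M a \<rho>
    by (intro free_multipliers_strict.intro M free_multipliers_strict_axioms.intro \<rho>)
  obtain T where T: "complex_linear T" "\<And>\<alpha>. blinfun_apply T (ket \<alpha>) = word_vec \<alpha>"
    using composition_operator_exists by blast
  have word: "word_map \<phi> \<alpha> = h2_fun (word_vec \<alpha>)" for \<alpha>
  proof (rule ext)
    fix X :: "'n \<Rightarrow> 'h operator"
    have "free_eval (ell2_apply (word_vec \<alpha>)) X = word_prod (\<lambda>i. \<phi> i X) \<alpha>" if X: "X \<in> nc_ball"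
      by (rule free_eval_word_vec[where \<phi> = \<phi>, OF a X]) (rule nc_ballD(1)[OF maps[rule_format, OF X]])
    then show "word_map \<phi> \<alpha> X = h2_fun (word_vec \<alpha>) X"
      by (simp add: word_map_def h2_fun_def)
  qed
  have "composition_op \<phi> (h2_fun c) X = h2_fun (blinfun_apply T c) X" for c X
  proof (cases "X \<in> nc_ball")
    case True
    let ?E = "\<lambda>f. free_eval (ell2_apply f) X"
    let ?t = "\<lambda>\<alpha>. op_scaleC (ell2_apply c \<alpha>) (word_map \<phi> \<alpha> X)"
    have lin: "bounded_linear (\<lambda>f. ?E (blinfun_apply T f))"
      by (rule bounded_linear_compose[OF bounded_linear_free_eval[OF True] blinfun.bounded_linear_right])
    have "(\<lambda>n. ?E (blinfun_apply T (blinfun_apply (proj_ell2 {\<alpha>. length \<alpha> < n}) c))) \<longlonglongrightarrow> ?E (blinfun_apply T c)"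
      by (intro bounded_linear.tendsto[OF lin] filterlim_compose[OF proj_ell2_tendsto filterlim_words_less])
    moreover have "?E (blinfun_apply T (blinfun_apply (proj_ell2 {\<alpha>. length \<alpha> < n}) c))
        = (\<Sum>k<n. \<Sum>\<alpha> | length \<alpha> = k. ?t \<alpha>)" for n
    proof -
      have "?E (blinfun_apply T (ell2_apply c \<alpha> *\<^sub>C ket \<alpha>)) = ?t \<alpha>" for \<alpha>
        using T(1) True by (simp add: complex_linear_def T(2) free_eval_scaleC word h2_fun_def)
      then show ?thesis
        by (simp only: proj_ell2_finite[OF finite_words_less] linear_sum[OF bounded_linear.linear[OF lin]]
            sum_words_by_length)
    qed
    ultimately have "(\<lambda>k. \<Sum>\<alpha> | length \<alpha> = k. ?t \<alpha>) sums ?E (blinfun_apply T c)"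
      by (simp only: sums_def)
    then show ?thesis
      unfolding composition_op_def free_coeff_h2_fun using True by (simp add: h2_fun_def sums_iff)
  next
    case False
    then show ?thesis
      by (simp add: composition_op_def word h2_fun_def linear_0[OF bounded_linear.linear[OF bounded_linear_op_scaleC]])
  qed
  then have "represents (composition_op \<phi>) T"
    unfolding represents_def by blast
  with T word show ?thesis
    by metis
qed

end

theorem theorem5p1:
  fixes \<phi> :: "'n::finite \<Rightarrow> ('n, 'h::complex_hilbert) ball_fun"
  assumes "separable_space (euclidean :: 'h topology)"
    and "infinite_dimensional TYPE('h)"
    and "free_holomorphic_self_map \<phi>"
  shows "((\<lambda>k. SUP f\<in>H2_unit_ball.
             sqrt (\<Sum>\<^sub>\<infinity>\<alpha> | length \<alpha> \<ge> k. (cmod (H2_inner f (word_map \<phi> \<alpha>)))\<^sup>2))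
           \<longlonglongrightarrow> H2_essential_norm (composition_op \<phi>)) \<and>
         (H2_compact_op (composition_op \<phi>) \<longleftrightarrow>
           (\<lambda>k. SUP f\<in>H2_unit_ball.
             \<Sum>\<^sub>\<infinity>\<alpha> | length \<alpha> \<ge> k. (cmod (H2_inner f (word_map \<phi> \<alpha>)))\<^sup>2)
           \<longlonglongrightarrow> 0)"
proof -
  note inf = assms(2)
  obtain T where T: "complex_linear T" "represents (composition_op \<phi>) T"
    and word: "\<And>\<alpha>. word_map \<phi> \<alpha> = h2_fun (blinfun_apply T (ket \<alpha>))"
    using composition_represented[OF inf assms(3)] by blast
  let ?S = "\<lambda>k. {\<alpha> :: 'n list. length \<alpha> < k}"
  let ?D = "\<lambda>k. norm (T o\<^sub>L proj_ell2 (- ?S k))"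
  have S: "{\<alpha> :: 'n list. length \<alpha> \<ge> k} = - ?S k" for k
    by auto
  have SUP: "(SUP f\<in>H2_unit_ball. sqrt (\<Sum>\<^sub>\<infinity>\<alpha> | length \<alpha> \<ge> k. (cmod (H2_inner f (word_map \<phi> \<alpha>)))\<^sup>2)) = ?D k"
    and SUP_sq: "(SUP f\<in>H2_unit_ball. \<Sum>\<^sub>\<infinity>\<alpha> | length \<alpha> \<ge> k. (cmod (H2_inner f (word_map \<phi> \<alpha>)))\<^sup>2) = (?D k)\<^sup>2" for k
    using SUP_tail_eq_norm[OF T(1), of "- ?S k"] SUP_tail_sq_eq_norm[OF T(1), of "- ?S k"]
    by (simp_all add: S H2_unit_ball_eq[OF inf] image_image word H2_inner_h2_fun[OF inf])
  \<comment> \<open>The alphabet being finite, the words shorter than \<open>k\<close> form finite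
    sets that exhaust all words.\<close>
  note ess = essential_norm_ell2[OF T(1) finite_words_less filterlim_words_less]
  have "?D \<longlonglongrightarrow> H2_essential_norm (composition_op \<phi>)"
    using ess(1) by (simp only: represents_essential_norm[OF inf T(2)])
  moreover have "H2_compact_op (composition_op \<phi>) \<longleftrightarrow> ?D \<longlonglongrightarrow> 0"
    using ess(2) by (simp only: represents_compact[OF inf T(2,1)])
  moreover have "(\<lambda>k. (?D k)\<^sup>2) \<longlonglongrightarrow> 0 \<longleftrightarrow> ?D \<longlonglongrightarrow> 0"
    using tendsto_null_power[of ?D sequentially 2] tendsto_real_sqrt[of "\<lambda>k. (?D k)\<^sup>2" 0] by auto
  ultimately show ?thesis
    unfolding SUP SUP_sq by blast
qed

end
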